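(* Let $\epsilon\in(0,1)$. An $\textsf{OV}_{n,d}$ instance with sets $A,B$ reduces to a $\{-1,1\}\text{-}\textsf{Max-IP}_{n,d_1}$ instance with sets $\widetilde A,\widetilde B$ such that: (1) $d_1 = \binom{d}{\le O(\sqrt{d\log 1/\epsilon})}^3\cdot 2^{O(\sqrt{d\log 1/\epsilon})}\cdot\epsilon^{-1}$; (2) there is an integer $T>\epsilon^{-1}$ such that if there is $(a,b)\in A\times B$ with $a\cdot b=0$ then $\textsf{OPT}(\widetilde A,\widetilde B)\ge T$; (3) otherwise $|\textsf{OPT}(\widetilde A,\widetilde B)|\le T\cdot\epsilon$; (4) the reduction takes $n\cdot\mathrm{poly}(d_1)$ time.
   Context: $\textsf{OV}_{n,d}$: given two sets $A,B$ of $n$ vectors from $\{0,1\}^d$, decide whether there are $a\in A,b\in B$ with $a\cdot b=0$. $\{-1,1\}\text{-}\textsf{Max-IP}_{n,d}$: given two sets $\widetilde A,\widetilde B$ of $n$ vectors from $\{-1,1\}^d$, compute $\textsf{OPT}(\widetilde A,\widetilde B):=\max_{a\in\widetilde A,b\in\widetilde B}a\cdot b$. The notation $\binom{n}{\le m}$ denotes $\sum_{i=0}^m\binom{n}{i}$.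
   Formalization: Both occurrences of O(√(d log 1/ε)) are read as O(max(1, √(d log 1/ε))), with log to base 2; without the cutoff the claim fails for fixed d as ε→1, since d₁ would be at most 1 while T ≥ 2. *)

theory Defs
  imports
    Complex_Main
    "HOL-Library.Log_Nat"
    "HOL-Library.Landau_Symbols"
    "HOL-Computational_Algebra.Polynomial"
begin

definition dot :: "int list \<Rightarrow> int list \<Rightarrow> int" where
  "dot a b = (\<Sum>i<length a. a ! i * b ! i)"

definition OPT :: "int list set \<Rightarrow> int list set \<Rightarrow> int" where
  "OPT A B = Max {dot a b |a b. a \<in> A \<and> b \<in> B}"

(* A set of n vectors from X^d, presented to and by the machine as a
   repetition-free list of its elements. *)
definition vectors :: "int set \<Rightarrow> nat \<Rightarrow> nat \<Rightarrow> int list list \<Rightarrow> bool" where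
  "vectors X n d vs \<longleftrightarrow>
     length vs = n \<and> distinct vs \<and> (\<forall>v\<in>set vs. length v = d \<and> set v \<subseteq> X)"

definition binom_le :: "nat \<Rightarrow> nat \<Rightarrow> nat" where
  "binom_le n m = (\<Sum>i\<le>m. n choose i)"

(* The argument of both O(.) terms. It equals sqrt (d log (1/eps)) as soon as
   d log (1/eps) >= 1. The lower cutoff at 1 is the usual convention that O(.) absorbs
   additive constants, and it cannot be dropped: for fixed d and eps close to 1 a bare multiple
   of sqrt (d log (1/eps)) would force the dimension to be 1, so that no inner product
   could reach an integer T > 1/eps. *)
definition dlog_root :: "nat \<Rightarrow> real \<Rightarrow> real" where
  "dlog_root d \<epsilon> = max 1 (sqrt (real d * log 2 (1 / \<epsilon>)))"


(* Machine model: random access machine with integer cells (addresses may be negative),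
   structured control, and the logarithmic cost criterion: every integer that occurs as a
   constant, an address, a cell content or an intermediate result is charged its
   bit length. The real number eps is a further input. It does not fit into a
   cell; the machine accesses it only by comparing it with rationals, the test
   Eps_ge p q asking whether p <= q * eps, and it pays for the bit lengths of p and q. *)

type_synonym memory = "int \<Rightarrow> int"

datatype aexp =
    Const int
  | Cell aexp
  | Plus aexp aexp
  | Minus aexp aexp
  | Times aexp aexp
  | Div aexp aexp
  | Less aexp aexp
  | Eps_ge aexp aexp

datatype com =
    Skip
  | Assign aexp aexp
  | Seq com com
  | Cond aexp com com
  | While aexp com

fun aval :: "real \<Rightarrow> memory \<Rightarrow> aexp \<Rightarrow> int" where
  "aval \<epsilon> s (Const c) = c"
| "aval \<epsilon> s (Cell a) = s (aval \<epsilon> s a)"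
| "aval \<epsilon> s (Plus a b) = aval \<epsilon> s a + aval \<epsilon> s b"
| "aval \<epsilon> s (Minus a b) = aval \<epsilon> s a - aval \<epsilon> s b"
| "aval \<epsilon> s (Times a b) = aval \<epsilon> s a * aval \<epsilon> s b"
| "aval \<epsilon> s (Div a b) = aval \<epsilon> s a div aval \<epsilon> s b"
| "aval \<epsilon> s (Less a b) = (if aval \<epsilon> s a < aval \<epsilon> s b then 1 else 0)"
| "aval \<epsilon> s (Eps_ge a b) =
     (if real_of_int (aval \<epsilon> s a) \<le> real_of_int (aval \<epsilon> s b) * \<epsilon> then 1 else 0)"

definition bits :: "int \<Rightarrow> nat" where
  "bits c = 1 + floorlog 2 (nat \<bar>c\<bar>)"

fun acost :: "real \<Rightarrow> memory \<Rightarrow> aexp \<Rightarrow> nat" where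
  "acost \<epsilon> s (Const c) = bits c"
| "acost \<epsilon> s (Cell a) = acost \<epsilon> s a + bits (aval \<epsilon> s (Cell a))"
| "acost \<epsilon> s (Plus a b) = acost \<epsilon> s a + acost \<epsilon> s b + bits (aval \<epsilon> s (Plus a b))"
| "acost \<epsilon> s (Minus a b) = acost \<epsilon> s a + acost \<epsilon> s b + bits (aval \<epsilon> s (Minus a b))"
| "acost \<epsilon> s (Times a b) = acost \<epsilon> s a + acost \<epsilon> s b + bits (aval \<epsilon> s (Times a b))"
| "acost \<epsilon> s (Div a b) = acost \<epsilon> s a + acost \<epsilon> s b + bits (aval \<epsilon> s (Div a b))"
| "acost \<epsilon> s (Less a b) = acost \<epsilon> s a + acost \<epsilon> s b + 1"
| "acost \<epsilon> s (Eps_ge a b) = acost \<epsilon> s a + acost \<epsilon> s b + 1"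

(* exec eps c s t s': with parameter eps, started in memory s, the program c halts after
   time t in memory s'. Assign a b stores the value of b in the cell whose address is
   the value of a; a test succeeds iff its value is nonzero. *)
inductive exec :: "real \<Rightarrow> com \<Rightarrow> memory \<Rightarrow> nat \<Rightarrow> memory \<Rightarrow> bool" for \<epsilon> :: real where
  Skip: "exec \<epsilon> Skip s 1 s"
| Assign: "exec \<epsilon> (Assign a b) s (acost \<epsilon> s a + acost \<epsilon> s b) (s(aval \<epsilon> s a := aval \<epsilon> s b))"
| Seq: "exec \<epsilon> c1 s t1 s1 \<Longrightarrow> exec \<epsilon> c2 s1 t2 s2 \<Longrightarrow> exec \<epsilon> (Seq c1 c2) s (t1 + t2) s2"
| CondTrue: "aval \<epsilon> s b \<noteq> 0 \<Longrightarrow> exec \<epsilon> c1 s t s1 \<Longrightarrow>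
    exec \<epsilon> (Cond b c1 c2) s (acost \<epsilon> s b + t) s1"
| CondFalse: "aval \<epsilon> s b = 0 \<Longrightarrow> exec \<epsilon> c2 s t s1 \<Longrightarrow>
    exec \<epsilon> (Cond b c1 c2) s (acost \<epsilon> s b + t) s1"
| WhileFalse: "aval \<epsilon> s b = 0 \<Longrightarrow> exec \<epsilon> (While b c) s (acost \<epsilon> s b) s"
| WhileTrue: "aval \<epsilon> s b \<noteq> 0 \<Longrightarrow> exec \<epsilon> c s t1 s1 \<Longrightarrow> exec \<epsilon> (While b c) s1 t2 s2 \<Longrightarrow>
    exec \<epsilon> (While b c) s (acost \<epsilon> s b + t1 + t2) s2"

inductive_cases SkipE: "exec \<epsilon> Skip s t s'"
inductive_cases AssignE: "exec \<epsilon> (Assign a b) s t s'"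
inductive_cases SeqE: "exec \<epsilon> (Seq c1 c2) s t s'"
inductive_cases CondE: "exec \<epsilon> (Cond b c1 c2) s t s'"
inductive_cases WhileE: "exec \<epsilon> (While b c) s t s'"

lemma exec_deterministic:
  "exec \<epsilon> c s t s' \<Longrightarrow> exec \<epsilon> c s u s'' \<Longrightarrow> t = u \<and> s' = s''"
proof (induction arbitrary: u s'' rule: exec.induct)
  case (Seq c1 s t1 s1 c2 t2 s2)
  then show ?case by (metis SeqE)
next
  case (WhileTrue s b c t1 s1 t2 s2)
  from WhileTrue.prems obtain v1 r v2 where
    "u = acost \<epsilon> s b + v1 + v2" "exec \<epsilon> c s v1 r" "exec \<epsilon> (While b c) r v2 s''"
    by (rule WhileE) (use WhileTrue.hyps(1) in blast)+
  with WhileTrue.IH show ?case by metis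
next
  case (WhileFalse s b c)
  from WhileFalse.prems show ?case
    by (rule WhileE) (use WhileFalse.hyps in blast)+
next
  case (CondTrue s b c1 t s1 c2)
  from CondTrue.prems show ?case
    by (rule CondE) (use CondTrue.hyps CondTrue.IH in blast)+
next
  case (CondFalse s b c2 t s1 c1)
  from CondFalse.prems show ?case
    by (rule CondE) (use CondFalse.hyps CondFalse.IH in blast)+
qed (auto elim: SkipE AssignE)

definition load :: "int list \<Rightarrow> memory" where
  "load xs i = (if 0 \<le> i \<and> i < int (length xs) then xs ! nat i else 0)"

(* Common encoding of instances of both problems: number of vectors, dimension, the
   entries of the first list of vectors, the entries of the second one. *)
definition encode :: "nat \<Rightarrow> nat \<Rightarrow> int list list \<Rightarrow> int list list \<Rightarrow> int list" where
  "encode n d As Bs = [int n, int d] @ concat As @ concat Bs"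

definition holds :: "memory \<Rightarrow> int list \<Rightarrow> bool" where
  "holds s xs \<longleftrightarrow> (\<forall>i<length xs. s (int i) = xs ! i)"

definition maps_within ::
  "com \<Rightarrow> real \<Rightarrow> int list \<Rightarrow> int list \<Rightarrow> nat \<Rightarrow> bool" where
  "maps_within c \<epsilon> xs ys t \<longleftrightarrow> (\<exists>u s. u \<le> t \<and> exec \<epsilon> c (load xs) u s \<and> holds s ys)"

end

theory Submission
  imports Defs
begin

text \<open>
  An inner product \<open>x\<close> of two 0/1 vectors is tested for zero by a polynomial \<open>P\<close> with
  \<open>P 0 = V\<close> and \<open>\<bar>P x\<bar> \<le> \<epsilon> V\<close> for \<open>1 \<le> x \<le> d\<close>. In the basis of binomials, \<open>P\<close> is a sum of
  \<open>c\<^sub>j (x choose j)\<close>, and \<open>x choose j\<close> is the sum of \<open>a\<^sub>S b\<^sub>S\<close> over the sets \<open>S\<close>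
  of size \<open>j\<close>, where \<open>a\<^sub>S\<close> is the product of the entries of \<open>a\<close> in \<open>S\<close>; so rounding
  the \<open>c\<^sub>j\<close> to integers and repeating monomials gives vectors whose inner product is \<open>P x\<close> up to an additive error of order \<open>binom_le d (degree P)\<close>, which is absorbed by taking \<open>V\<close> of order
  \<open>(binom_le d (degree P))\<^sup>2 / \<epsilon>\<close>.

  Degree \<open>O (sqrt (d log (1/\<epsilon>)))\<close> is reached as follows. Let \<open>l\<close> be about \<open>log (1/\<epsilon>)\<close>. The factor
  \<open>(1 - x/1) \<dots> (1 - x/l)\<close> vanishes at \<open>1, \<dots>, l\<close> but grows like \<open>x\<^sup>l / l!\<close>. It is multiplied by the power \<open>l + 1\<close> of a
  Fejer-type kernel \<open>r\<close> of degree below \<open>K\<close>, with \<open>r 0 \<ge> 1\<close>, \<open>0 \<le> r \<le> 1\<close> and \<open>r x \<le> N / (K\<^sup>2 (x - 1))\<close> for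
  \<open>1 \<le> x \<le> N = d + 1\<close>. With \<open>K\<close> of order \<open>sqrt (d / l)\<close> the product is below \<open>16\<^sup>-\<^sup>l\<close>. When \<open>\<epsilon> \<ge> 1/2\<close> one has
  \<open>l = 0\<close>, and the growth of \<open>r\<close> at 0 alone suffices, with \<open>K\<close> of order \<open>sqrt (d (1/\<epsilon> - 1))\<close>. For \<open>K = 2\<^sup>i\<close>
  the kernel obeys a quadratic recursion, conjugate to Chebyshev doubling, that the machine can run on integers.
\<close>

section \<open>A cost-bounded program logic\<close>

text \<open>The value \<open>eps\<close> may approach 1 as well as 0. Near 1 the bound
  \<open>\<bar>P x\<bar> \<le> eps * V\<close> leaves almost no room for rounding. Hence the peak is
  bounded by \<open>4 * N / (4 * N + 1)\<close> times \<open>eps * P 0\<close>, with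
  \<open>N = d + 1\<close>, and the size of \<open>V\<close> is chosen so that this narrow gap still
  absorbs all rounding errors. Zeros and kernel divide the work: the estimate
  \<open>N / (K^2 * (x - 1))\<close> is weak for small \<open>x\<close>, which is where the zeros
  lie, and it tames the growth of the product for large \<open>x\<close>. The machine sees
  \<open>eps\<close> only through comparisons with rationals. Every parameter depending on it is
  therefore the least integer passing such a test, and minimality is also what bounds the degree.
  The time must be linear in \<open>n\<close> although cost is logarithmic. Distinctness of the
  vectors gives \<open>n \<le> 2 ^ d\<close>, so one cell width proportional to the dimension serves
  the whole run, and the time analysis reduces to counting elementary steps.\<close>

lemma bits_le: "\<bar>x\<bar> < 2 ^ b \<Longrightarrow> bits x \<le> Suc b"
  unfolding bits_def by (simp add: floorlog_le_iff nat_less_iff)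

lemma abs_less_bits: "\<bar>x\<bar> < 2 ^ (bits x - 1)"
proof -
  have "nat \<bar>x\<bar> < 2 ^ floorlog 2 (nat \<bar>x\<bar>)"
    using floorlog_le_iff[of 2 "nat \<bar>x\<bar>" "floorlog 2 (nat \<bar>x\<bar>)"] by simp
  then show ?thesis unfolding bits_def by (simp add: nat_less_iff)
qed

lemma bits_pos: "bits x \<ge> 1"
  by (simp add: bits_def)

lemma bits_mono: "\<bar>x\<bar> \<le> \<bar>y\<bar> \<Longrightarrow> bits x \<le> bits y"
  using bits_le[of x "bits y - 1"] abs_less_bits[of y] bits_pos[of y] by simp

lemma bits_add: "\<bar>z\<bar> \<le> \<bar>x\<bar> + \<bar>y\<bar> \<Longrightarrow> bits z \<le> bits x + bits y"
proof -
  assume z: "\<bar>z\<bar> \<le> \<bar>x\<bar> + \<bar>y\<bar>"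
  let ?a = "bits x - 1" and ?b = "bits y - 1"
  have "(2::int) ^ ?a \<le> 2 ^ (?a + ?b)" "(2::int) ^ ?b \<le> 2 ^ (?a + ?b)"
    by (rule power_increasing; simp)+
  then have "\<bar>z\<bar> < 2 ^ (Suc (?a + ?b))"
    using z abs_less_bits[of x] abs_less_bits[of y] unfolding power_Suc by linarith
  from bits_le[OF this] show ?thesis using bits_pos[of x] bits_pos[of y] by linarith
qed

lemma bits_mult: "bits (x * y) \<le> bits x + bits y"
proof -
  have "\<bar>x * y\<bar> < 2 ^ (bits x - 1) * 2 ^ (bits y - 1)"
    unfolding abs_mult using abs_less_bits[of x] abs_less_bits[of y]
    by (intro mult_strict_mono') auto
  from bits_le[OF this[folded power_add]] show ?thesis using bits_pos[of x] bits_pos[of y] by linarith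
qed

text \<open>Floor division may round away from zero, but never past the dividend, and division by 0
  gives 0. This is why \<open>width (Div a b)\<close> depends on \<open>a\<close> alone.\<close>

lemma abs_div_le: "\<bar>x div y\<bar> \<le> \<bar>x\<bar>" for x y :: int
proof (cases "y = 0")
  case False
  have "\<bar>x div y\<bar> \<le> \<bar>x\<bar>" if "y > 0" for x y :: int
  proof (cases "x \<ge> 0")
    case True
    then show ?thesis using that
      by (metis abs_of_nonneg int_div_less_self linorder_not_less order.order_iff_strict
          pos_imp_zdiv_nonneg_iff div_by_1 zless_imp_add1_zle zero_less_one div_0 add_0 order_antisym_conv)
  next
    case False
    have "- (x div y) \<le> - x"
    proof -
      have "x div y \<ge> x"
        using that False zdiv_mono2_neg[of x 1 y] by simp
      then show ?thesis by simp
    qed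
    moreover have "x div y < 0" using that False pos_imp_zdiv_neg_iff[of y x] by linarith
    ultimately show ?thesis using False by simp
  qed
  from this[of y x] this[of "-y" "-x"] show ?thesis using False by (cases "y > 0") auto
qed simp

text \<open>\<open>bits\<close> of an intermediate result is subadditive in its operands, so a bound on the memory cells
  alone bounds the cost of an expression.\<close>

fun width :: "aexp \<Rightarrow> nat" where
  "width (Const c) = nat \<bar>c\<bar> + 1"
| "width (Cell a) = 1"
| "width (Plus a b) = width a + width b"
| "width (Minus a b) = width a + width b"
| "width (Times a b) = width a + width b"
| "width (Div a b) = width a"
| "width (Less a b) = 2"
| "width (Eps_ge a b) = 2"

fun weight :: "aexp \<Rightarrow> nat" where
  "weight (Const c) = nat \<bar>c\<bar> + 1"
| "weight (Cell a) = weight a + 1"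
| "weight (Plus a b) = weight a + weight b + width a + width b"
| "weight (Minus a b) = weight a + weight b + width a + width b"
| "weight (Times a b) = weight a + weight b + width a + width b"
| "weight (Div a b) = weight a + weight b + width a"
| "weight (Less a b) = weight a + weight b + 1"
| "weight (Eps_ge a b) = weight a + weight b + 1"

definition bounded_mem :: "nat \<Rightarrow> memory \<Rightarrow> bool" where
  "bounded_mem b s \<longleftrightarrow> (\<forall>x. \<bar>s x\<bar> < 2 ^ b)"

lemma bits_const: "bits c \<le> nat \<bar>c\<bar> + 1"
proof -
  have "\<bar>c\<bar> = int (nat \<bar>c\<bar>)" by simp
  also have "\<dots> < int (2 ^ nat \<bar>c\<bar>)" by (simp only: of_nat_less_iff less_exp)
  finally show ?thesis using bits_le[of c "nat \<bar>c\<bar>"] by simp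
qed

lemma bits_aval:
  assumes "bounded_mem b s"
  shows "bits (aval eps s a) \<le> width a * Suc b"
proof (induction a)
  case (Const c)
  then show ?case using bits_const[of c] by (simp add: algebra_simps)
next
  case (Cell a)
  then show ?case using assms bits_le by (simp add: bounded_mem_def)
next
  case (Plus a1 a2)
  then show ?case
    using bits_add[of "aval eps s a1 + aval eps s a2" "aval eps s a1" "aval eps s a2"]
      abs_triangle_ineq[of "aval eps s a1" "aval eps s a2"]
    by (simp add: algebra_simps)
next
  case (Minus a1 a2)
  then show ?case
    using bits_add[of "aval eps s a1 - aval eps s a2" "aval eps s a1" "aval eps s a2"]
      abs_triangle_ineq4[of "aval eps s a1" "aval eps s a2"]
    by (simp add: algebra_simps)
next
  case (Times a1 a2)
  then show ?case using bits_mult[of "aval eps s a1" "aval eps s a2"] by (simp add: algebra_simps)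
next
  case (Div a1 a2)
  then show ?case using bits_mono[OF abs_div_le[of "aval eps s a1" "aval eps s a2"]] by simp
next
  case (Less a1 a2)
  then show ?case using bits_const[of 1] bits_const[of 0] by simp
next
  case (Eps_ge a1 a2)
  then show ?case using bits_const[of 1] bits_const[of 0] by simp
qed

lemma acost_le_weight:
  assumes "bounded_mem b s"
  shows "acost eps s a \<le> weight a * Suc b"
proof (induction a)
  case (Const c)
  then show ?case using bits_const[of c] by (simp add: algebra_simps)
next
  case (Cell a)
  have "bits (aval eps s (Cell a)) \<le> Suc b" using bits_aval[OF assms, of eps "Cell a"] by simp
  with Cell show ?case by simp
next
  case (Plus a1 a2)
  then show ?case using bits_aval[OF assms, of eps "Plus a1 a2"] by (simp add: algebra_simps)
next
  case (Minus a1 a2)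
  then show ?case using bits_aval[OF assms, of eps "Minus a1 a2"] by (simp add: algebra_simps)
next
  case (Times a1 a2)
  then show ?case using bits_aval[OF assms, of eps "Times a1 a2"] by (simp add: algebra_simps)
next
  case (Div a1 a2)
  then show ?case using bits_aval[OF assms, of eps "Div a1 a2"] by (simp add: algebra_simps)
qed (simp_all add: algebra_simps)

text \<open>\<open>t\<close> counts elementary steps. With all cells below \<open>2 ^ b\<close>, an
  expression costs at most its weight times \<open>Suc b\<close>, and 1000 dominates the weights in
  all programs below, so each step has the same price. Intermediate results may exceed
  \<open>2 ^ b\<close>; their length is charged through \<open>width\<close>.\<close>

definition terminates ::
    "real \<Rightarrow> nat \<Rightarrow> memory \<Rightarrow> com \<Rightarrow> nat \<Rightarrow> (memory \<Rightarrow> bool) \<Rightarrow> bool" where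
  "terminates eps b s c t Q \<longleftrightarrow>
     (\<exists>u s'. exec eps c s u s' \<and> u \<le> 1000 * Suc b * t \<and> bounded_mem b s' \<and> Q s')"

lemma terminates_mono:
  assumes "terminates eps b s c t Q" "t \<le> t'" "\<And>s'. bounded_mem b s' \<Longrightarrow> Q s' \<Longrightarrow> Q' s'"
  shows "terminates eps b s c t' Q'"
proof -
  obtain u s' where "exec eps c s u s'" "u \<le> 1000 * Suc b * t" "bounded_mem b s'" "Q s'"
    using assms(1) unfolding terminates_def by blast
  moreover have "1000 * Suc b * t \<le> 1000 * Suc b * t'" using assms(2) by simp
  ultimately show ?thesis using assms(3) unfolding terminates_def by (meson order_trans)
qed

lemma terminates_Skip: "bounded_mem b s \<Longrightarrow> Q s \<Longrightarrow> terminates eps b s Skip 1 Q"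
  unfolding terminates_def by (intro exI[of _ 1] exI[of _ s]) (auto intro: exec.Skip[simplified])

lemma terminates_Assign:
  assumes "bounded_mem b s" "weight a + weight e \<le> 1000" "\<bar>aval eps s e\<bar> < 2 ^ b"
    "bounded_mem b (s(aval eps s a := aval eps s e)) \<Longrightarrow> Q (s(aval eps s a := aval eps s e))"
  shows "terminates eps b s (Assign a e) 1 Q"
proof -
  have bm: "bounded_mem b (s(aval eps s a := aval eps s e))"
    using assms(1,3) by (auto simp: bounded_mem_def)
  have "acost eps s a + acost eps s e \<le> (weight a + weight e) * Suc b"
    using acost_le_weight[OF assms(1), of eps a] acost_le_weight[OF assms(1), of eps e]
    by (simp add: algebra_simps)
  also have "\<dots> \<le> 1000 * Suc b" using assms(2) by (rule mult_le_mono1)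
  finally show ?thesis unfolding terminates_def using exec.Assign assms(4)[OF bm] bm by fastforce
qed

lemma terminates_Seq:
  assumes "terminates eps b s c1 t1 (\<lambda>s'. terminates eps b s' c2 t2 Q)"
  shows "terminates eps b s (Seq c1 c2) (t1 + t2) Q"
proof -
  obtain u1 s1 u2 s2 where "exec eps c1 s u1 s1" "u1 \<le> 1000 * Suc b * t1"
    "exec eps c2 s1 u2 s2" "u2 \<le> 1000 * Suc b * t2" "bounded_mem b s2" "Q s2"
    using assms unfolding terminates_def by blast
  then show ?thesis unfolding terminates_def
    by (intro exI[of _ "u1 + u2"] exI[of _ s2]) (auto intro: exec.Seq simp: algebra_simps)
qed

lemma terminates_Seq_Assign:
  assumes "bounded_mem b s" "weight a + weight e \<le> 1000" "\<bar>aval eps s e\<bar> < 2 ^ b"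
    "bounded_mem b (s(aval eps s a := aval eps s e)) \<Longrightarrow>
      terminates eps b (s(aval eps s a := aval eps s e)) c t Q"
  shows "terminates eps b s (Seq (Assign a e) c) (Suc t) Q"
proof -
  have "terminates eps b s (Assign a e) 1 (\<lambda>s'. terminates eps b s' c t Q)"
    using assms by (rule terminates_Assign)
  from terminates_Seq[OF this] show ?thesis by simp
qed

lemma terminates_Cond:
  assumes "bounded_mem b s" "weight g \<le> 1000"
    "aval eps s g \<noteq> 0 \<Longrightarrow> terminates eps b s c1 t Q"
    "aval eps s g = 0 \<Longrightarrow> terminates eps b s c2 t Q"
  shows "terminates eps b s (Cond g c1 c2) (Suc t) Q"
proof -
  have "acost eps s g \<le> weight g * Suc b" by (rule acost_le_weight[OF assms(1)])
  also have "\<dots> \<le> 1000 * Suc b" using assms(2) by (rule mult_le_mono1)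
  finally have *: "acost eps s g \<le> 1000 * Suc b" .
  show ?thesis
  proof (cases "aval eps s g = 0")
    case True
    from assms(4)[OF True] obtain u s' where u: "exec eps c2 s u s'" "u \<le> 1000 * Suc b * t"
      "bounded_mem b s'" "Q s'" unfolding terminates_def by blast
    from exec.CondFalse[OF True u(1), of c1] show ?thesis
      using u * unfolding terminates_def
      by (intro exI[of _ "acost eps s g + u"] exI[of _ s']) (auto simp: algebra_simps)
  next
    case False
    from assms(3)[OF False] obtain u s' where u: "exec eps c1 s u s'" "u \<le> 1000 * Suc b * t"
      "bounded_mem b s'" "Q s'" unfolding terminates_def by blast
    from exec.CondTrue[OF False u(1), of c2] show ?thesis
      using u * unfolding terminates_def
      by (intro exI[of _ "acost eps s g + u"] exI[of _ s']) (auto simp: algebra_simps)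
  qed
qed

text \<open>The invariant is indexed by the number of completed rounds, and the number of rounds is
  known in advance. Each round pays one step for its guard, and the final failing test pays one
  more.\<close>

lemma terminates_While:
  assumes "bounded_mem b s" "weight g \<le> 1000" "I 0 s"
    and step: "\<And>j s. j < n \<Longrightarrow> I j s \<Longrightarrow> bounded_mem b s \<Longrightarrow>
      aval eps s g \<noteq> 0 \<and> terminates eps b s c t (I (Suc j))"
    and fin: "\<And>s. I n s \<Longrightarrow> aval eps s g = 0"
    and post: "\<And>s. bounded_mem b s \<Longrightarrow> I n s \<Longrightarrow> Q s"
  shows "terminates eps b s (While g c) (Suc (n * Suc t)) Q"
proof -
  have cost: "acost eps s g \<le> 1000 * Suc b" if "bounded_mem b s" for s
  proof -
    have "acost eps s g \<le> weight g * Suc b" by (rule acost_le_weight[OF that])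
    also have "\<dots> \<le> 1000 * Suc b" using assms(2) by (rule mult_le_mono1)
    finally show ?thesis .
  qed
  have "terminates eps b s (While g c) (Suc (m * Suc t)) (I n)"
    if "m \<le> n" "I (n - m) s" "bounded_mem b s" for m s
    using that
  proof (induction m arbitrary: s)
    case 0
    then show ?case using exec.WhileFalse[OF fin] cost[of s] unfolding terminates_def by fastforce
  next
    case (Suc m)
    have "n - Suc m < n" "Suc (n - Suc m) = n - m" using Suc.prems(1) by auto
    with step[of "n - Suc m" s] Suc.prems have g: "aval eps s g \<noteq> 0"
      and "terminates eps b s c t (I (n - m))" by auto
    then obtain u1 s1 where 1: "exec eps c s u1 s1" "u1 \<le> 1000 * Suc b * t" "bounded_mem b s1"
      "I (n - m) s1" unfolding terminates_def by blast
    from Suc.IH[OF _ 1(4,3)] Suc.prems(1) obtain u2 s2 where 2: "exec eps (While g c) s1 u2 s2"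
      "u2 \<le> 1000 * Suc b * Suc (m * Suc t)" "bounded_mem b s2" "I n s2"
      unfolding terminates_def by (meson Suc_leD)
    have "acost eps s g + u1 + u2 \<le>
        1000 * Suc b * 1 + 1000 * Suc b * t + 1000 * Suc b * Suc (m * Suc t)"
      using cost[OF Suc.prems(3)] 1(2) 2(2) by linarith
    also have "\<dots> = 1000 * Suc b * Suc (Suc m * Suc t)" by (simp only: distrib_left[symmetric]) simp
    finally show ?case
      using exec.WhileTrue[OF g 1(1) 2(1)] 2(3,4) unfolding terminates_def by blast
  qed
  from this[of n s] assms(1,3) have "terminates eps b s (While g c) (Suc (n * Suc t)) (I n)" by simp
  then show ?thesis by (rule terminates_mono) (auto intro: post)
qed

section \<open>Subsets of bounded size and Newton expansion\<close>

text \<open>Pascal's rule against arbitrary coefficients; both the count over subsets and Newton's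
  expansion rest on it.\<close>

lemma pascal_sum:
  fixes h :: "nat \<Rightarrow> int"
  shows "(\<Sum>j\<le>k. h j * int (Suc x choose j)) =
    (\<Sum>j\<le>k. h j * int (x choose j)) + (\<Sum>j<k. h (Suc j) * int (x choose j))"
  by (induction k) (simp_all add: algebra_simps)

text \<open>Subsets are decreasing lists. Their order is the one in which the machine appends
  products, so a monomial has the same index in the machine's table and in the output
  vectors.\<close>

fun subs :: "nat \<Rightarrow> nat \<Rightarrow> nat list list" where
  "subs k 0 = [[]]"
| "subs k (Suc d) = subs k d @ map ((#) d) (filter (\<lambda>S. length S < k) (subs k d))"

lemma subs_bounds: "S \<in> set (subs k d) \<Longrightarrow> length S \<le> k \<and> length S \<le> d \<and> set S \<subseteq> {..<d}"
  by (induction d arbitrary: S) (auto, fastforce+)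

lemma singleton_in_subs: "j < d \<Longrightarrow> k \<ge> 1 \<Longrightarrow> [j] \<in> set (subs k d)"
proof (induction d)
  case (Suc d)
  have "[] \<in> set (subs k d)" by (induction d) auto
  with Suc show ?case by (auto simp: less_Suc_eq)
qed simp

text \<open>If \<open>x\<close> of the variables equal 1, exactly \<open>x choose j\<close> of the
  products over \<open>j\<close>-sets survive. The weight \<open>f\<close> varies in the induction
  because adjoining the element \<open>d\<close> shifts all sizes by one.\<close>

lemma sum_subs:
  fixes z f :: "nat \<Rightarrow> int"
  assumes "\<And>i. i < d \<Longrightarrow> z i \<in> {0, 1}" "int x = (\<Sum>i<d. z i)"
  shows "(\<Sum>S\<leftarrow>subs k d. f (length S) * prod_list (map z S)) = (\<Sum>j\<le>k. f j * int (x choose j))"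
  using assms
proof (induction d arbitrary: x f)
  case 0
  then have "x = 0" by simp
  have "(\<Sum>j\<le>k. f j * int (0 choose j)) = (\<Sum>j\<le>k. if j = 0 then f j else 0)"
    by (intro sum.cong) auto
  with \<open>x = 0\<close> show ?case by simp
next
  case (Suc d)
  have z: "z d \<in> {0, 1}" "\<And>i. i < d \<Longrightarrow> z i \<in> {0, 1}" using Suc.prems(1) by auto
  have "0 \<le> (\<Sum>i<d. z i)" using z(2) by (intro sum_nonneg) fastforce
  then obtain y where y: "int y = (\<Sum>i<d. z i)" using nonneg_int_cases by metis
  \<comment> \<open>The value 0 at \<open>k\<close> expresses the filter \<open>length S < k\<close>
    as a weight.\<close>
  define f' where "f' j = (if j < k then f (Suc j) else 0)" for j
  have "(\<Sum>S\<leftarrow>map ((#) d) (filter (\<lambda>S. length S < k) (subs k d)). f (length S) * prod_list (map z S))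
      = (\<Sum>S\<leftarrow>subs k d. z d * (f' (length S) * prod_list (map z S)))"
    unfolding map_map comp_def sum_list_map_filter' f'_def
    by (intro arg_cong[where f = sum_list] map_cong) auto
  also have "\<dots> = z d * (\<Sum>j\<le>k. f' j * int (y choose j))"
    using Suc.IH[OF z(2) y, of f'] by (simp add: sum_list_const_mult)
  also have "(\<Sum>j\<le>k. f' j * int (y choose j)) = (\<Sum>j<k. f (Suc j) * int (y choose j))"
    by (simp add: f'_def lessThan_Suc_atMost[symmetric])
  finally have "(\<Sum>S\<leftarrow>subs k (Suc d). f (length S) * prod_list (map z S)) =
    (\<Sum>j\<le>k. f j * int (y choose j)) + z d * (\<Sum>j<k. f (Suc j) * int (y choose j))"
    using Suc.IH[OF z(2) y, of f] by simp
  moreover have "z d = 0 \<and> x = y \<or> z d = 1 \<and> x = Suc y" using Suc.prems(2) y z(1) by auto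
  ultimately show ?case using pascal_sum[of f y k] by auto
qed

text \<open>The case of \<open>sum_subs\<close> in which all variables and weights are 1.\<close>

lemma length_subs: "length (subs k d) = binom_le d k"
proof -
  have one: "prod_list (map (\<lambda>_. 1) S) = (1::int)" for S :: "nat list" by (induction S) auto
  have "int (length (subs k d)) = (\<Sum>S\<leftarrow>subs k d. 1 * prod_list (map (\<lambda>_. 1) S))"
    unfolding one by (simp add: sum_list_triv)
  also have "\<dots> = int (binom_le d k)"
    using sum_subs[of d "\<lambda>_. 1" d "\<lambda>_. 1" k] by (simp add: binom_le_def)
  finally show ?thesis by simp
qed

lemma binom_le_ge: "k \<ge> 1 \<Longrightarrow> Suc d \<le> binom_le d k"
proof -
  assume "k \<ge> 1"
  then have "(\<Sum>i\<in>{0,1}. d choose i) \<le> binom_le d k"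
    unfolding binom_le_def by (intro sum_mono2) auto
  then show ?thesis by simp
qed

lemma binom_le_mono: "x \<le> d \<Longrightarrow> binom_le x k \<le> binom_le d k"
  unfolding binom_le_def by (intro sum_mono binomial_right_mono)

section \<open>Forward differences and the binomial basis\<close>

definition diff :: "(nat \<Rightarrow> int) \<Rightarrow> nat \<Rightarrow> int" where
  "diff f x = f (Suc x) - f x"

lemma diff_funpow_Suc: "(diff ^^ Suc j) f x = (diff ^^ j) f (Suc x) - (diff ^^ j) f x"
  by (simp add: diff_def)

lemma newton_expansion: "f x = (\<Sum>j\<le>x. (diff ^^ j) f 0 * int (x choose j))"
proof (induction x arbitrary: f)
  case (Suc x)
  have "f (Suc x) = f x + diff f x" by (simp add: diff_def)
  also have "\<dots> = (\<Sum>j\<le>x. (diff ^^ j) f 0 * int (x choose j)) +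
      (\<Sum>j\<le>x. (diff ^^ Suc j) f 0 * int (x choose j))"
    using Suc.IH[of f] Suc.IH[of "diff f"] by (simp add: funpow_swap1)
  also have "\<dots> = (\<Sum>j\<le>Suc x. (diff ^^ j) f 0 * int (Suc x choose j))"
    unfolding pascal_sum[of _ x "Suc x"] lessThan_Suc_atMost by simp
  finally show ?case .
qed simp

text \<open>Each difference at most doubles the bound; this is the origin of the factor
  \<open>2 ^ deg d eps\<close> in \<open>copies\<close>.\<close>

lemma diff_funpow_bound:
  assumes "\<And>y. y \<le> x + j \<Longrightarrow> \<bar>f y\<bar> \<le> M"
  shows "\<bar>(diff ^^ j) f x\<bar> \<le> 2 ^ j * M"
  using assms
proof (induction j arbitrary: x)
  case (Suc j)
  have "\<bar>(diff ^^ j) f (Suc x)\<bar> \<le> 2 ^ j * M" "\<bar>(diff ^^ j) f x\<bar> \<le> 2 ^ j * M"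
    using Suc by auto
  then show ?case unfolding diff_funpow_Suc power_Suc by linarith
qed auto

text \<open>On the naturals, a vanishing \<open>k\<close>-th difference characterises the
  polynomials of degree less than \<open>k\<close>. This form yields the coefficients in the
  binomial basis without any change of basis.\<close>

definition degree_below :: "nat \<Rightarrow> (nat \<Rightarrow> int) \<Rightarrow> bool" where
  "degree_below k f \<longleftrightarrow> (diff ^^ k) f = (\<lambda>_. 0)"

lemma degree_below_0 [simp]: "degree_below 0 f \<longleftrightarrow> f = (\<lambda>_. 0)"
  by (simp add: degree_below_def)

lemma degree_below_Suc: "degree_below (Suc k) f \<longleftrightarrow> degree_below k (diff f)"
  by (simp add: degree_below_def funpow_swap1)

lemma degree_below_zero [simp]: "degree_below k (\<lambda>_. 0)"
  by (induction k) (simp_all add: degree_below_Suc diff_def[abs_def])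

lemma degree_below_mono: "degree_below k f \<Longrightarrow> k \<le> l \<Longrightarrow> degree_below l f"
proof (induction k arbitrary: l f)
  case (Suc k)
  then show ?case by (cases l) (simp_all add: degree_below_Suc)
qed simp

lemma degree_below_add:
  "degree_below k f \<Longrightarrow> degree_below k g \<Longrightarrow> degree_below k (\<lambda>x. f x + g x)"
proof (induction k arbitrary: f g)
  case (Suc k)
  have "diff (\<lambda>x. f x + g x) = (\<lambda>x. diff f x + diff g x)" by (auto simp: diff_def)
  with Suc show ?case by (simp add: degree_below_Suc)
qed simp

lemma degree_below_shift: "degree_below k f \<Longrightarrow> degree_below k (\<lambda>x. f (Suc x))"
proof (induction k arbitrary: f)
  case (Suc k)
  have "diff (\<lambda>x. f (Suc x)) = (\<lambda>x. diff f (Suc x))" by (auto simp: diff_def)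
  with Suc show ?case by (simp add: degree_below_Suc)
qed simp

lemma degree_below_const: "degree_below (Suc k) (\<lambda>_. c)"
  by (simp add: degree_below_Suc diff_def[abs_def])

text \<open>By the discrete Leibniz rule
  \<open>diff (f g) x = diff f x * g (Suc x) + f x * diff g x\<close>, both summands have a smaller
  sum of degrees.\<close>

lemma degree_below_mult:
  "degree_below (Suc k) f \<Longrightarrow> degree_below (Suc l) g \<Longrightarrow> degree_below (Suc (k + l)) (\<lambda>x. f x * g x)"
proof (induction "k + l" arbitrary: k l f g rule: less_induct)
  case less
  have 1: "degree_below (k + l) (\<lambda>x. diff f x * g (Suc x))"
  proof (cases k)
    case 0
    with less.prems(1) show ?thesis by (simp add: degree_below_Suc)
  next
    case (Suc k')
    then show ?thesis
      using less.hyps[of k' l "diff f" "\<lambda>x. g (Suc x)"] less.prems degree_below_shift[OF less.prems(2)]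
      by (simp add: degree_below_Suc)
  qed
  have 2: "degree_below (k + l) (\<lambda>x. f x * diff g x)"
  proof (cases l)
    case 0
    with less.prems(2) show ?thesis by (simp add: degree_below_Suc)
  next
    case (Suc l')
    then show ?thesis
      using less.hyps[of k l' f "diff g"] less.prems by (simp add: degree_below_Suc)
  qed
  have "diff (\<lambda>x. f x * g x) = (\<lambda>x. diff f x * g (Suc x) + f x * diff g x)"
    by (auto simp: diff_def algebra_simps)
  with degree_below_add[OF 1 2] show ?case by (simp add: degree_below_Suc)
qed

lemma degree_below_power:
  "degree_below (Suc k) f \<Longrightarrow> degree_below (Suc (n * k)) (\<lambda>x. f x ^ n)"
proof (induction n)
  case 0
  then show ?case using degree_below_const[of 0 1] by simp
next
  case (Suc n)
  then show ?case using degree_below_mult[of k f "n * k"] by simp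
qed

lemma degree_below_linear: "degree_below (Suc (Suc k)) (\<lambda>x. a + c * int x)"
proof -
  have "diff (\<lambda>x. a + c * int x) = (\<lambda>_. c)" by (auto simp: diff_def algebra_simps)
  then show ?thesis by (simp add: degree_below_Suc[of "Suc k"] degree_below_const)
qed

text \<open>Terms beyond \<open>k\<close> vanish by the degree, terms beyond \<open>x\<close>
  because the binomial coefficient is 0, so the two cutoffs can be exchanged through
  \<open>max k x\<close>.\<close>

lemma truncated_newton_expansion:
  assumes "degree_below (Suc k) f"
  shows "f x = (\<Sum>j\<le>k. (diff ^^ j) f 0 * int (x choose j))"
proof -
  have zero: "(diff ^^ j) f 0 = 0" if "j > k" for j
    using degree_below_mono[OF assms, of j] that by (simp add: degree_below_def)
  have "f x = (\<Sum>j\<le>x. (diff ^^ j) f 0 * int (x choose j))" by (rule newton_expansion)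
  also have "\<dots> = (\<Sum>j\<le>max k x. (diff ^^ j) f 0 * int (x choose j))"
    by (intro sum.mono_neutral_left) auto
  also have "\<dots> = (\<Sum>j\<le>k. (diff ^^ j) f 0 * int (x choose j))"
    by (intro sum.mono_neutral_right) (auto simp: zero)
  finally show ?thesis .
qed

section \<open>A polynomial with a sharp peak at zero\<close>

text \<open>With \<open>N = d + 1\<close> and \<open>sin^2 t = (x - 1) / N\<close> for
  \<open>1 < x \<le> N + 1\<close>, this is \<open>sin^2 (2^i t) / (4^i sin^2 t)\<close> times
  \<open>N ^ (2^i - 1)\<close>, a Fejer kernel with cleared denominators. The shift by 1 places
  \<open>x = 0\<close> just outside the interval of oscillation.\<close>

fun kernel :: "nat \<Rightarrow> nat \<Rightarrow> nat \<Rightarrow> int" where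
  "kernel d 0 x = 1"
| "kernel d (Suc i) x =
     kernel d i x * (int (Suc d) ^ 2 ^ i - (int x - 1) * 4 ^ i * kernel d i x)"

lemma degree_below_kernel: "degree_below (2 ^ i) (kernel d i)"
proof (induction i)
  case 0
  then show ?case using degree_below_const[of 0 1] by (simp add: fun_eq_iff[symmetric] kernel.simps(1)[abs_def])
next
  case (Suc i)
  obtain k where k: "2 ^ i = Suc k" by (metis not0_implies_Suc power_not_zero zero_neq_numeral)
  have "degree_below (Suc (Suc 0 + k)) (\<lambda>x. (4 ^ i + (- (4 ^ i)) * int x) * kernel d i x)"
    by (rule degree_below_mult[OF degree_below_linear]) (use Suc k in simp)
  then have "degree_below (Suc (Suc k))
      (\<lambda>x. int (Suc d) ^ 2 ^ i + (4 ^ i + (- (4 ^ i)) * int x) * kernel d i x)"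
    by (intro degree_below_add degree_below_const) simp
  then have "degree_below (Suc (k + Suc k))
      (\<lambda>x. kernel d i x * (int (Suc d) ^ 2 ^ i + (4 ^ i + (- (4 ^ i)) * int x) * kernel d i x))"
    using Suc k by (intro degree_below_mult) auto
  moreover have "kernel d (Suc i) =
      (\<lambda>x. kernel d i x * (int (Suc d) ^ 2 ^ i + (4 ^ i + (- (4 ^ i)) * int x) * kernel d i x))"
    by (auto simp: algebra_simps)
  moreover have "Suc (k + Suc k) = 2 ^ Suc i" using k by simp
  ultimately show ?case by simp
qed

fun rkernel :: "nat \<Rightarrow> nat \<Rightarrow> nat \<Rightarrow> real" where
  "rkernel d 0 x = 1"
| "rkernel d (Suc i) x =
     rkernel d i x * (1 - (real x - 1) * (4 ^ i / Suc d) * rkernel d i x)"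

text \<open>The ratio of the two kernels is \<open>Suc d ^ (2 ^ i - 1)\<close>; the factor on the
  left avoids the subtraction in the exponent.\<close>

lemma kernel_eq: "real_of_int (kernel d i x) * Suc d = Suc d ^ 2 ^ i * rkernel d i x"
proof (induction i)
  case (Suc i)
  define N where "N = real (Suc d)"
  have N: "N > 0" by (simp add: N_def)
  from Suc have k: "real_of_int (kernel d i x) = N ^ 2 ^ i * rkernel d i x / N"
    using N by (simp add: N_def field_simps)
  have p: "N ^ 2 ^ Suc i = N ^ 2 ^ i * N ^ 2 ^ i" by (simp add: power_mult mult_2 power_add)
  have "real_of_int (kernel d (Suc i) x) * N =
      (N ^ 2 ^ i * rkernel d i x / N) * (N ^ 2 ^ i - (real x - 1) * 4 ^ i * (N ^ 2 ^ i * rkernel d i x / N)) * N"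
    unfolding kernel.simps of_int_mult of_int_diff k by (simp add: N_def)
  also have "\<dots> = N ^ 2 ^ Suc i * rkernel d (Suc i) x"
    unfolding p rkernel.simps N_def[symmetric] using N by (simp add: field_simps)
  finally show ?case by (simp add: N_def)
qed simp

text \<open>With \<open>w = (x - 1) 4\<^sup>i r / N\<close> the recursion is the logistic map \<open>w \<mapsto> 4 w (1 - w)\<close>, which
  is Chebyshev doubling; hence \<open>r\<close> is a Fejer-type kernel in \<open>[1, N + 1]\<close> that peaks at 0.\<close>

lemma rkernel_range:
  assumes "1 \<le> x" "x \<le> Suc (Suc d)"
  shows "0 \<le> rkernel d i x \<and> rkernel d i x \<le> 1 \<and>
    (real x - 1) * (4 ^ i / Suc d) * rkernel d i x \<le> 1"
proof (induction i)
  case 0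
  then show ?case using assms by (simp add: field_simps)
next
  case (Suc i)
  define r where "r = rkernel d i x"
  define w where "w = (real x - 1) * (4 ^ i / Suc d) * r"
  have r: "0 \<le> r" "r \<le> 1" "w \<le> 1" using Suc by (auto simp: r_def w_def)
  have w: "0 \<le> w" unfolding w_def using assms(1) r(1) by (intro mult_nonneg_nonneg) auto
  have s: "rkernel d (Suc i) x = r * (1 - w)" by (simp add: r_def w_def)
  have "(real x - 1) * (4 ^ Suc i / Suc d) * rkernel d (Suc i) x = 4 * w * (1 - w)"
    unfolding s by (simp add: w_def)
  also have "\<dots> = 1 - (2 * w - 1)\<^sup>2" by (simp add: power2_eq_square algebra_simps)
  also have "\<dots> \<le> 1" by simp
  finally show ?case unfolding s using r w by (auto intro!: mult_nonneg_nonneg mult_le_one)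
qed

text \<open>At 0 the factor \<open>x - 1\<close> is negative, so each doubling multiplies the value
  \<open>r\<close> by \<open>1 + 4 ^ i * r / N\<close>.\<close>

lemma rkernel_peak: "1 \<le> rkernel d i 0 \<and> 1 + 4 ^ i / Suc d \<le> rkernel d (Suc i) 0"
proof (induction i)
  case (Suc i)
  define r where "r = rkernel d (Suc i) 0"
  define a where "a = (4::real) ^ Suc i / Suc d"
  have "(0::real) \<le> 4 ^ i / Suc d" by simp
  with Suc have r: "1 \<le> r" unfolding r_def by linarith
  have a: "0 \<le> a" by (simp add: a_def)
  have "rkernel d (Suc (Suc i)) 0 = r * (1 + a * r)" by (simp add: r_def a_def)
  moreover have "1 * (1 + a * 1) \<le> r * (1 + a * r)" using r a
    by (intro mult_mono add_mono mult_left_mono) auto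
  ultimately show ?case using r by (simp add: a_def r_def)
qed simp

text \<open>\<open>n ^ n / n!\<close> is a single term of the series for
  \<open>exp n\<close>.\<close>

lemma power_self_le_fact: "real n ^ n \<le> 3 ^ n * fact n"
proof -
  have "(\<Sum>k\<in>{n}. (1 / fact k) * real n ^ k) \<le> (\<Sum>k. (1 / fact k) * real n ^ k)"
    using summable_exp[of "real n"] by (intro sum_le_suminf) (auto simp: field_simps)
  also have "\<dots> = exp (real n)" by (simp add: exp_def scaleR_conv_of_real field_simps)
  also have "\<dots> = exp 1 ^ n" by (simp add: exp_of_nat_mult[symmetric])
  also have "\<dots> \<le> 3 ^ n" using exp_le by (intro power_mono) auto
  finally show ?thesis by (simp add: field_simps)
qed

text \<open>\<open>2 ^ (level eps + 1)\<close> lies between \<open>1 / eps\<close> and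
  \<open>2 / eps\<close> and serves as an integer substitute for \<open>1 / eps\<close>. The level
  is 0 exactly when \<open>eps \<ge> 1/2\<close>.\<close>

definition level :: "real \<Rightarrow> nat" where
  "level eps = (LEAST j. 1 \<le> 2 ^ (j + 1) * eps)"

text \<open>Once all of \<open>1, ..., d\<close> are zeros, smaller \<open>eps\<close> asks for no
  more of them, and the cap keeps the degree under control. With \<open>Suc d\<close> as the cap,
  \<open>zeros = 0\<close> is equivalent to \<open>level = 0\<close> even for
  \<open>d = 0\<close>.\<close>

definition zeros :: "nat \<Rightarrow> real \<Rightarrow> nat" where
  "zeros d eps = min (level eps) (Suc d)"

text \<open>The first test serves \<open>l \<ge> 1\<close>: it yields
  \<open>(x - 1) * r \<le> l / 48\<close>, where \<open>48 = 3 * 16\<close>; the 3 pays for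
  \<open>l^l \<le> 3^l * l!\<close> and \<open>16^-l\<close> remains. The second test says
  \<open>4^i \<ge> 48 * N * (1/eps - 1)\<close> and serves \<open>l = 0\<close>.\<close>

definition sharp_enough :: "nat \<Rightarrow> real \<Rightarrow> nat \<Rightarrow> bool" where
  "sharp_enough d eps i \<longleftrightarrow>
     48 * Suc d \<le> 4 ^ i * zeros d eps \<or> 48 * real (Suc d) \<le> (4 ^ i + 48 * real (Suc d)) * eps"

text \<open>The kernel with \<open>i = 0\<close> is constant and has no peak, hence
  \<open>1 \<le> i\<close>.\<close>

definition doublings :: "nat \<Rightarrow> real \<Rightarrow> nat" where
  "doublings d eps = (LEAST i. 1 \<le> i \<and> sharp_enough d eps i)"

definition deg :: "nat \<Rightarrow> real \<Rightarrow> nat" where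
  "deg d eps = Suc (zeros d eps) * 2 ^ doublings d eps"

text \<open>The factors \<open>1 - x/j\<close> are cleared of denominators, which scales the product
  by \<open>l!\<close>. The exponent \<open>Suc l\<close> leaves one kernel factor when
  \<open>l = 0\<close>.\<close>

definition peak :: "nat \<Rightarrow> real \<Rightarrow> nat \<Rightarrow> int" where
  "peak d eps x = (\<Prod>j=1..zeros d eps. int j - int x) * kernel d (doublings d eps) x ^ Suc (zeros d eps)"

lemma degree_below_prod:
  "degree_below (Suc l) (\<lambda>x. \<Prod>j=1..l. int j - int x)"
proof (induction l)
  case 0
  then show ?case using degree_below_const[of 0 1] by simp
next
  case (Suc l)
  have "degree_below (Suc (Suc 0)) (\<lambda>x. int (Suc l) + (-1) * int x)" by (rule degree_below_linear)
  from degree_below_mult[OF Suc this] show ?case by (simp add: algebra_simps)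
qed

lemma degree_below_peak: "degree_below (Suc (deg d eps)) (peak d eps)"
proof -
  define l where "l = zeros d eps"
  obtain k where k: "2 ^ doublings d eps = Suc k"
    by (metis not0_implies_Suc power_not_zero zero_neq_numeral)
  have "degree_below (Suc k) (kernel d (doublings d eps))" using degree_below_kernel k by metis
  from degree_below_mult[OF degree_below_prod[of l] degree_below_power[OF this, of "Suc l"]]
  have "degree_below (Suc (l + Suc l * k)) (peak d eps)" by (simp add: peak_def[abs_def] l_def)
  then show ?thesis by (rule degree_below_mono) (simp add: deg_def k l_def)
qed

context
  fixes eps :: real and d :: nat
  assumes eps01: "0 < eps" "eps < 1"
begin

lemma level_ex: "\<exists>j. 1 \<le> 2 ^ (j + 1) * eps"
proof -
  obtain j where "1 / eps < 2 ^ j" using real_arch_pow[of 2 "1 / eps"] by auto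
  moreover have "(2::real) ^ j \<le> 2 ^ (j + 1)" by simp
  ultimately have "1 / eps \<le> 2 ^ (j + 1)" by linarith
  then show ?thesis using eps01 by (intro exI[of _ j]) (simp add: field_simps)
qed

lemma level: "1 \<le> 2 ^ (level eps + 1) * eps"
  unfolding level_def using level_ex by (rule LeastI_ex)

lemma less_level: "j < level eps \<Longrightarrow> 2 ^ (j + 1) * eps < 1"
  unfolding level_def using not_less_Least by fastforce

lemma level_upper: "2 ^ (level eps + 1) * eps \<le> 2"
proof (cases "level eps")
  case (Suc j)
  have "2 ^ (level eps + 1) * eps = 2 * (2 ^ (j + 1) * eps)" by (simp add: Suc)
  moreover have "2 ^ (j + 1) * eps < 1" using less_level[of j] Suc by simp
  ultimately show ?thesis by linarith
qed (use eps01 in simp)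

lemma doublings_ex: "\<exists>i. 1 \<le> i \<and> sharp_enough d eps i"
proof -
  obtain i where i: "48 * real (Suc d) / eps < 4 ^ i" using real_arch_pow[of 4] by auto
  have "(4::real) ^ i \<le> 4 ^ Suc i" by simp
  with i have "48 * real (Suc d) / eps \<le> 4 ^ Suc i" by linarith
  then have "48 * real (Suc d) \<le> 4 ^ Suc i * eps" using eps01 by (simp add: field_simps)
  moreover have "0 \<le> 48 * real (Suc d) * eps" using eps01 by simp
  ultimately have "sharp_enough d eps (Suc i)" unfolding sharp_enough_def distrib_right by linarith
  then show ?thesis by auto
qed

lemma doublings: "1 \<le> doublings d eps" "sharp_enough d eps (doublings d eps)"
  unfolding doublings_def using LeastI_ex[OF doublings_ex] by auto

lemma less_doublings: "1 \<le> i \<Longrightarrow> i < doublings d eps \<Longrightarrow> \<not> sharp_enough d eps i"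
  unfolding doublings_def using not_less_Least by blast

text \<open>A positive level means \<open>eps < 1/2\<close>, and then the second test already forces
  \<open>48 * N \<le> 4 ^ i\<close>, which implies the first.\<close>

lemma sharp_enough_zeros:
  assumes "sharp_enough d eps i" "zeros d eps \<ge> 1"
  shows "48 * real (Suc d) \<le> 4 ^ i * real (zeros d eps)"
proof (cases "48 * Suc d \<le> 4 ^ i * zeros d eps")
  case True
  then have "real (48 * Suc d) \<le> real (4 ^ i * zeros d eps)" by (simp only: of_nat_le_iff)
  then show ?thesis by simp
next
  case False
  then have 1: "48 * real (Suc d) \<le> 4 ^ i * eps + 48 * real (Suc d) * eps"
    using assms(1) by (simp add: sharp_enough_def algebra_simps)
  have "level eps > 0" using assms(2) by (simp add: zeros_def)
  from less_level[OF this] have e: "eps \<le> 1 / 2" by simp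
  have "48 * real (Suc d) * eps \<le> 48 * real (Suc d) * (1 / 2)" using e by (rule mult_left_mono) simp
  moreover have "(4::real) ^ i * eps \<le> 4 ^ i * (1 / 2)" using e by (rule mult_left_mono) simp
  ultimately have "48 * real (Suc d) \<le> 4 ^ i" using 1 by linarith
  also have "(4::real) ^ i * 1 \<le> 4 ^ i * real (zeros d eps)" using assms(2) by (intro mult_left_mono) auto
  finally show ?thesis by simp
qed

lemma real_peak:
  "real_of_int (peak d eps x) * Suc d ^ Suc (zeros d eps) =
   (\<Prod>j=1..zeros d eps. real j - real x) * rkernel d (doublings d eps) x ^ Suc (zeros d eps) *
     (Suc d ^ 2 ^ doublings d eps) ^ Suc (zeros d eps)"
proof -
  have "real_of_int (peak d eps x) * Suc d ^ Suc (zeros d eps) = (\<Prod>j=1..zeros d eps. real j - real x) *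
     (real_of_int (kernel d (doublings d eps) x) * Suc d) ^ Suc (zeros d eps)"
    unfolding peak_def by (simp only: of_int_mult of_int_prod of_int_power of_int_diff of_int_of_nat_eq
      of_nat_power power_mult_distrib mult_ac)
  then show ?thesis unfolding kernel_eq by (simp only: power_mult_distrib of_nat_power mult_ac)
qed

text \<open>The factors \<open>4 * N + 1\<close> and \<open>4 * N\<close> reserve a relative gap of
  \<open>1 / (4 * N + 1)\<close> below \<open>eps\<close> for the later rounding. For
  \<open>l = 0\<close> only the height at 0 helps; otherwise points up to \<open>l\<close> are zeros
  and the kernel controls the others.\<close>

lemma normalized_peak_bound:
  defines "l \<equiv> zeros d eps" and "i \<equiv> doublings d eps"
  assumes x: "1 \<le> x" "x \<le> d"
  shows "\<bar>\<Prod>j=1..l. real j - real x\<bar> * rkernel d i x ^ Suc l * (4 * Suc d + 1)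
    \<le> eps * (4 * Suc d) * (fact l * rkernel d i 0 ^ Suc l)"
proof -
  define N where "N = real (Suc d)"
  have N: "N \<ge> 1" by (simp add: N_def)
  note r = rkernel_range[OF x(1), of d i] rkernel_peak[of d i]
  consider "l = 0" | "l \<ge> 1" "x \<le> l" | "l \<ge> 1" "x > l" by linarith
  then show ?thesis
  proof cases
    case 1
    obtain i' where i': "i = Suc i'" using doublings(1) unfolding i_def by (cases "doublings d eps") auto
    have lev: "level eps = 0" using 1 by (simp add: l_def zeros_def)
    have e: "1 / 2 \<le> eps" using level lev by simp
    have s: "48 * N \<le> 4 ^ i * eps + 48 * N * eps"
      using doublings(2) 1 by (simp add: sharp_enough_def l_def i_def N_def algebra_simps)
    have "(4::real) ^ 1 \<le> 4 ^ i" unfolding i' by (intro power_increasing) auto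
    then have "4 * (1 / 2) \<le> 4 ^ i * eps" using e by (intro mult_mono) auto
    \<comment> \<open>One twelfth of \<open>s\<close> gives
      \<open>4 * N \<le> eps * (4 * N) + eps * 4^i / 12\<close>, and
      \<open>eps * 4^i \<ge> 2\<close> pays for the additional 1. Since
      \<open>4^i = 4 * 4^i'\<close>, the sum is \<open>eps * (4 * N)\<close> times the guaranteed
      growth at 0.\<close>
    with s have "4 * N + 1 \<le> eps * (4 * N) + eps * 4 ^ i" by (simp add: algebra_simps)
    also have "\<dots> = eps * (4 * N) * (1 + 4 ^ i' / N)" using N by (simp add: i' field_simps)
    also have "\<dots> \<le> eps * (4 * N) * rkernel d i 0"
      using eps01 N rkernel_peak[of d i'] unfolding i' N_def[symmetric]
      by (intro mult_left_mono) auto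
    finally have "1 * (4 * N + 1) \<le> eps * (4 * N) * rkernel d i 0" by simp
    moreover have "rkernel d i x * (4 * N + 1) \<le> 1 * (4 * N + 1)"
      using r(1) x N by (intro mult_right_mono) auto
    ultimately have "rkernel d i x * (4 * N + 1) \<le> eps * (4 * N) * rkernel d i 0" by linarith
    then show ?thesis using 1 by (simp add: N_def)
  next
    case 2
    then have "(\<Prod>j=1..l. real j - real x) = 0" using x by (intro prod_zero) auto
    moreover have "0 \<le> eps * (4 * Suc d) * (fact l * rkernel d i 0 ^ Suc l)"
      using eps01 r(2) by (intro mult_nonneg_nonneg zero_le_power) auto
    ultimately show ?thesis by (simp only: abs_zero mult_zero_left)
  next
    case 3
    \<comment> \<open>A point beyond all zeros but at most \<open>d\<close> shows that the cap in
      \<open>zeros\<close> is not active.\<close>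
    have "l < Suc d" using 3 x by linarith
    then have lev: "l = level eps" by (simp add: l_def zeros_def)
    have sharp: "48 * N \<le> 4 ^ i * real l"
      using sharp_enough_zeros[OF doublings(2)] 3 by (simp add: N_def l_def i_def)
    define y where "y = real x - 1"
    define r where "r = rkernel d i x"
    have y: "y \<ge> 0" and r01: "0 \<le> r" "r \<le> 1" "y * (4 ^ i / N) * r \<le> 1"
      using x rkernel_range[OF x(1), of d i] by (auto simp: y_def r_def N_def)
    have "\<bar>\<Prod>j=1..l. real j - real x\<bar> = (\<Prod>j=1..l. \<bar>real j - real x\<bar>)" by (rule abs_prod)
    also have "\<dots> \<le> (\<Prod>j=1..l. y)" using 3 by (intro prod_mono) (auto simp: y_def)
    also have "\<dots> = y ^ l" by simp
    finally have p: "\<bar>\<Prod>j=1..l. real j - real x\<bar> \<le> y ^ l" .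
    have "y * r * 48 \<le> l"
    proof -
      have "y * r * 4 ^ i \<le> N" using r01(3) N by (simp add: field_simps)
      then have "y * r * 4 ^ i * 48 \<le> 4 ^ i * real l" using sharp by linarith
      then show ?thesis by (simp add: algebra_simps)
    qed
    then have "y * r \<le> real l / 48" by simp
    then have "(y * r) ^ l \<le> (real l / 48) ^ l" using y r01 by (intro power_mono) auto
    also have "\<dots> = real l ^ l / 48 ^ l" by (simp add: power_divide)
    also have "\<dots> \<le> 3 ^ l * fact l / 48 ^ l"
      using power_self_le_fact[of l] by (intro divide_right_mono) auto
    also have "\<dots> = fact l * (1 / 16) ^ l"
    proof -
      have "(48::real) ^ l = 3 ^ l * 16 ^ l" by (simp add: power_mult_distrib[symmetric])
      then show ?thesis by (simp add: field_simps)
    qed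
    finally have yr: "(y * r) ^ l \<le> fact l * (1 / 16) ^ l" .
    have "\<bar>\<Prod>j=1..l. real j - real x\<bar> * r ^ Suc l \<le> y ^ l * r ^ l"
    proof (rule mult_mono[OF p])
      show "r ^ Suc l \<le> r ^ l" using r01 by (intro power_decreasing) auto
    qed (use y r01 in auto)
    also have "\<dots> \<le> fact l * (1 / 16) ^ l" using yr by (simp add: power_mult_distrib)
    finally have a: "\<bar>\<Prod>j=1..l. real j - real x\<bar> * r ^ Suc l \<le> fact l * (1 / 16) ^ l" .
    \<comment> \<open>Split \<open>16^-l = 2^-l * 8^-l\<close>: since \<open>l \<ge> 1\<close>, the
      part \<open>8^-l\<close> pays for the constants, while \<open>2^-l \<le> 2 * eps\<close> by
      the choice of the level.\<close>
    have "(1 / 16 :: real) ^ l * (4 * N + 1) \<le> eps * (4 * N)"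
    proof -
      have "(1 / 16 :: real) ^ l * 4 \<le> (1 / 2) ^ l"
      proof -
        have "(1 / 8 :: real) ^ l \<le> (1 / 8) ^ 1" using 3 by (intro power_decreasing) auto
        then have "(1 / 2 :: real) ^ l * ((1 / 8) ^ l * 4) \<le> (1 / 2) ^ l * 1"
          by (intro mult_left_mono) auto
        then show ?thesis by (simp add: power_mult_distrib[symmetric] mult.assoc[symmetric])
      qed
      then have "(1 / 16 :: real) ^ l * 8 \<le> 2 * (1 / 2) ^ l" by linarith
      also have "\<dots> \<le> 4 * eps" using level unfolding lev[symmetric] by (simp add: field_simps)
      finally have "(1 / 16 :: real) ^ l * 8 * N \<le> 4 * eps * N" using N by (intro mult_right_mono) auto
      moreover have "(1 / 16 :: real) ^ l * (4 * N + 1) \<le> (1 / 16) ^ l * (8 * N)"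
        using N by (intro mult_left_mono) auto
      moreover have "(1 / 16 :: real) ^ l * (8 * N) = (1 / 16) ^ l * 8 * N" "eps * (4 * N) = 4 * eps * N"
        by simp_all
      ultimately show ?thesis by linarith
    qed
    then have "fact l * ((1 / 16) ^ l * (4 * N + 1)) \<le> fact l * (eps * (4 * N))"
      by (intro mult_left_mono) auto
    moreover have "\<bar>\<Prod>j=1..l. real j - real x\<bar> * r ^ Suc l * (4 * N + 1) \<le> fact l * (1 / 16) ^ l * (4 * N + 1)"
      using a N by (intro mult_right_mono) auto
    moreover have "eps * (4 * N) * (fact l * 1) \<le> eps * (4 * N) * (fact l * rkernel d i 0 ^ Suc l)"
      using eps01 N rkernel_peak[of d i] by (intro mult_left_mono one_le_power) auto
    ultimately show ?thesis unfolding r_def N_def[symmetric] by (simp add: algebra_simps N_def)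
  qed
qed

lemma prod_fact: "(\<Prod>j=1..l. real j - real (0::nat)) = fact l"
  by (simp add: fact_prod)

lemma peak_0_pos: "peak d eps 0 > 0"
proof -
  have "real_of_int (peak d eps 0) * Suc d ^ Suc (zeros d eps) > 0"
    unfolding real_peak prod_fact using rkernel_peak[of d "doublings d eps"]
    by (intro mult_pos_pos zero_less_power) auto
  then have "real_of_int (peak d eps 0) > 0" by (rule zero_less_mult_pos2) (simp del: power_Suc)
  then show ?thesis by simp
qed

lemma peak_bound:
  assumes x: "1 \<le> x" "x \<le> d"
  shows "\<bar>real_of_int (peak d eps x)\<bar> * (4 * Suc d + 1) \<le> eps * (4 * Suc d) * peak d eps 0"
proof -
  define l i N M where "l = zeros d eps" and "i = doublings d eps"
    and "N = real (Suc d ^ Suc l)" and "M = real ((Suc d ^ 2 ^ i) ^ Suc l)"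
  have pos: "N > 0" "M > 0" by (simp_all add: N_def M_def del: power_Suc)
  have rk: "0 \<le> rkernel d i x" using rkernel_range[OF x(1)] x by auto
  have "\<bar>real_of_int (peak d eps x)\<bar> * N = \<bar>real_of_int (peak d eps x) * N\<bar>" using pos by (simp add: abs_mult)
  also have "\<dots> = \<bar>(\<Prod>j=1..l. real j - real x)\<bar> * rkernel d i x ^ Suc l * M"
    using real_peak[of x] pos rk unfolding N_def M_def l_def i_def
    by (simp add: abs_mult)
  finally have 1: "\<bar>real_of_int (peak d eps x)\<bar> * N = \<bar>(\<Prod>j=1..l. real j - real x)\<bar> * rkernel d i x ^ Suc l * M" .
  have 2: "peak d eps 0 * N = fact l * rkernel d i 0 ^ Suc l * M"
    using real_peak[of 0] unfolding N_def M_def l_def i_def prod_fact by simp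
  have "\<bar>real_of_int (peak d eps x)\<bar> * (4 * Suc d + 1) * N =
      (\<bar>real_of_int (peak d eps x)\<bar> * N) * (4 * Suc d + 1)"
    by (simp only: mult_ac)
  also have "\<dots> =
      \<bar>(\<Prod>j=1..l. real j - real x)\<bar> * rkernel d i x ^ Suc l * (4 * Suc d + 1) * M"
    unfolding 1 by (simp only: mult_ac)
  also have "\<dots> \<le> eps * (4 * Suc d) * (fact l * rkernel d i 0 ^ Suc l) * M"
    using normalized_peak_bound[OF x] pos unfolding l_def i_def by (intro mult_right_mono) auto
  also have "\<dots> = eps * (4 * Suc d) * peak d eps 0 * N" using 2 by (simp only: mult.assoc)
  finally show ?thesis using pos by (simp only: mult_le_cancel_right_pos)
qed

lemma peak_le:
  assumes "x \<le> d"
  shows "\<bar>peak d eps x\<bar> \<le> peak d eps 0"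
proof (cases "x = 0")
  case False
  define p p0 where "p = \<bar>real_of_int (peak d eps x)\<bar>" and "p0 = real_of_int (peak d eps 0)"
  have "p0 > 0" using peak_0_pos by (simp add: p0_def)
  have "p * (4 * Suc d) \<le> p * (4 * Suc d + 1)" by (simp add: p_def algebra_simps)
  also have "\<dots> \<le> eps * (4 * Suc d) * p0" using peak_bound[of x] False assms by (simp add: p_def p0_def)
  also have "\<dots> \<le> 1 * (4 * Suc d) * p0" using eps01 \<open>p0 > 0\<close> by (intro mult_right_mono) auto
  finally have "p * (4 * Suc d) \<le> p0 * (4 * Suc d)" by (simp only: mult_1 mult.commute)
  then have "p \<le> p0" by (rule mult_right_le_imp_le) simp
  then show ?thesis unfolding p_def p0_def by linarith
qed (use peak_0_pos in simp)

end

section \<open>Integer coefficients\<close>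

text \<open>Let \<open>B = binom_le d (deg d eps)\<close>. Rounding costs at most 2 per coefficient,
  in total at most \<open>2 * B\<close>, and the gap left by \<open>peak_bound\<close> is
  \<open>V * eps / (4 * N + 1)\<close>. As \<open>4 * N + 1 \<le> 5 * B\<close>, the choice
  \<open>10 * B^2 / eps\<close> suffices, with the power of two in place of
  \<open>1 / eps\<close>.\<close>

definition scale :: "nat \<Rightarrow> real \<Rightarrow> int" where
  "scale d eps = 10 * int (binom_le d (deg d eps)) ^ 2 * 2 ^ (level eps + 1)"

text \<open>By \<open>coef_bound\<close>, \<open>V * \<bar>c_j\<bar> / F 0\<close> is at most
  \<open>2 ^ j * V\<close>, so this many signed copies can realise every coefficient.\<close>

definition copies :: "nat \<Rightarrow> real \<Rightarrow> int" where
  "copies d eps = 2 ^ deg d eps * scale d eps"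

definition dim :: "nat \<Rightarrow> real \<Rightarrow> nat" where
  "dim d eps = 4 * binom_le d (deg d eps) * nat (copies d eps)"

definition coef :: "nat \<Rightarrow> real \<Rightarrow> nat \<Rightarrow> int" where
  "coef d eps j = (diff ^^ j) (peak d eps) 0"

text \<open>\<open>positives\<close> is the number of copies of a monomial of degree \<open>j\<close> that enter with a plus sign, so
  the monomial gets the integer coefficient \<open>2 p - W\<close>, which approximates \<open>V c\<^sub>j / F 0\<close>.\<close>

definition positives :: "nat \<Rightarrow> real \<Rightarrow> nat \<Rightarrow> int" where
  "positives d eps j = (scale d eps * coef d eps j + copies d eps * peak d eps 0) div (2 * peak d eps 0)"

definition rounded :: "nat \<Rightarrow> real \<Rightarrow> nat \<Rightarrow> int" where
  "rounded d eps x = (\<Sum>j\<le>deg d eps. (2 * positives d eps j - copies d eps) * int (x choose j))"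

lemma deg_pos: "deg d eps \<ge> 1"
  by (simp add: deg_def Suc_leI)

lemma binom_deg_ge: "Suc d \<le> binom_le d (deg d eps)"
  by (rule binom_le_ge[OF deg_pos])

lemma scale_pos: "scale d eps > 0"
  using binom_deg_ge[of d eps] by (simp add: scale_def)

lemma copies_pos: "copies d eps > 0"
  using scale_pos by (simp add: copies_def)

context
  fixes eps :: real and d :: nat
  assumes eps01: "0 < eps" "eps < 1"
begin

lemma coef_bound:
  assumes "j \<le> d"
  shows "\<bar>coef d eps j\<bar> \<le> 2 ^ j * peak d eps 0"
  unfolding coef_def using peak_le[OF eps01] assms by (intro diff_funpow_bound) auto

text \<open>The peak is controlled only on \<open>0, ..., d\<close>, and the \<open>j\<close>-th
  difference at 0 reaches as far as \<open>j\<close>, hence \<open>j \<le> d\<close>. Monomials in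
  \<open>d\<close> variables have no larger degree.\<close>

lemma positives_range:
  assumes "j \<le> d" "j \<le> deg d eps"
  shows "0 \<le> positives d eps j \<and> positives d eps j \<le> copies d eps"
proof -
  define V W F c where "V = scale d eps" "W = copies d eps" "F = peak d eps 0" "c = coef d eps j"
  note defs = this
  have F: "F > 0" using peak_0_pos[OF eps01] by (simp add: defs)
  have V: "V > 0" using scale_pos by (simp add: defs)
  have c: "\<bar>c\<bar> \<le> 2 ^ j * F" using coef_bound[OF assms(1)] by (simp add: defs)
  have "\<bar>V * c\<bar> = V * \<bar>c\<bar>" using V by (simp add: abs_mult)
  also have "\<dots> \<le> V * (2 ^ j * F)" using c V by (intro mult_left_mono) auto
  also have "\<dots> \<le> V * (2 ^ deg d eps * F)" using assms(2) V F
    by (intro mult_left_mono mult_right_mono power_increasing) auto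
  also have "\<dots> = W * F" by (simp add: copies_def defs)
  finally have "- (W * F) \<le> V * c" "V * c \<le> W * F" by linarith+
  then have *: "0 \<le> V * c + W * F" "V * c + W * F \<le> W * (2 * F)" by (auto simp: algebra_simps)
  from *(2) have "(V * c + W * F) div (2 * F) \<le> W * (2 * F) div (2 * F)"
    using F by (intro zdiv_mono1) auto
  also have "\<dots> = W" using F by simp
  finally have "(V * c + W * F) div (2 * F) \<le> W" .
  moreover have "0 \<le> (V * c + W * F) div (2 * F)" using * F by (simp add: pos_imp_zdiv_nonneg_iff)
  moreover have "positives d eps j = (V * c + W * F) div (2 * F)" by (simp add: positives_def defs)
  ultimately show ?thesis by (simp add: defs(2))
qed

lemma positives_approx:
  "\<bar>(2 * positives d eps j - copies d eps) * peak d eps 0 - scale d eps * coef d eps j\<bar> \<le> 2 * peak d eps 0"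
proof -
  define V W F c where "V = scale d eps" "W = copies d eps" "F = peak d eps 0" "c = coef d eps j"
  have F: "F > 0" using peak_0_pos[OF eps01] by (simp add: V_W_F_c_def)
  define p where "p = (V * c + W * F) div (2 * F)"
  have "2 * F * p + (V * c + W * F) mod (2 * F) = V * c + W * F" unfolding p_def by (rule mult_div_mod_eq)
  moreover have "0 \<le> (V * c + W * F) mod (2 * F)" "(V * c + W * F) mod (2 * F) < 2 * F"
    using F by auto
  moreover have "(2 * p - W) * F = 2 * F * p - W * F" by (simp add: algebra_simps)
  ultimately have "\<bar>(2 * p - W) * F - V * c\<bar> \<le> 2 * F" by linarith
  then show ?thesis by (simp add: positives_def V_W_F_c_def p_def)
qed

text \<open>The constant coefficient is \<open>F 0\<close> itself and \<open>scale\<close> is even,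
  so the division defining \<open>positives d eps 0\<close> is exact. Orthogonal pairs thus meet the
  threshold without rounding loss.\<close>

lemma rounded_0: "rounded d eps 0 = scale d eps"
proof -
  define H where "H = 5 * int (binom_le d (deg d eps)) ^ 2 * 2 ^ (level eps + 1)"
  have V: "scale d eps = 2 * H" by (simp add: scale_def H_def)
  define F where "F = peak d eps 0"
  have F: "F > 0" using peak_0_pos[OF eps01] by (simp add: F_def)
  have "positives d eps 0 = ((H + 2 ^ deg d eps * H) * (2 * F)) div (2 * F)"
    unfolding positives_def coef_def copies_def V F_def by (simp add: algebra_simps)
  also have "\<dots> = H + 2 ^ deg d eps * H" using F by (intro nonzero_mult_div_cancel_right) auto
  finally have "2 * positives d eps 0 - copies d eps = scale d eps" by (simp add: copies_def V)
  moreover have "rounded d eps 0 = (\<Sum>j\<le>deg d eps. if j = 0 then 2 * positives d eps 0 - copies d eps else 0)"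
    unfolding rounded_def by (intro sum.cong) auto
  ultimately show ?thesis by simp
qed

lemma rounded_small:
  assumes x: "1 \<le> x" "x \<le> d"
  shows "\<bar>real_of_int (rounded d eps x)\<bar> \<le> real_of_int (scale d eps) * eps"
proof -
  define V F k B where "V = scale d eps" "F = peak d eps 0" "k = deg d eps" "B = int (binom_le d (deg d eps))"
  note defs = this
  have F: "F > 0" using peak_0_pos[OF eps01] by (simp add: defs)
  have "\<bar>rounded d eps x * F - V * peak d eps x\<bar> =
      \<bar>\<Sum>j\<le>k. ((2 * positives d eps j - copies d eps) * F - V * coef d eps j) * int (x choose j)\<bar>"
    unfolding rounded_def truncated_newton_expansion[OF degree_below_peak, of d eps x]
    by (simp add: defs coef_def sum_distrib_left sum_distrib_right sum_subtractf[symmetric] algebra_simps)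
  also have "\<dots> \<le> (\<Sum>j\<le>k. \<bar>((2 * positives d eps j - copies d eps) * F - V * coef d eps j) * int (x choose j)\<bar>)"
    by (rule sum_abs)
  also have "\<dots> \<le> (\<Sum>j\<le>k. 2 * F * int (x choose j))"
    unfolding abs_mult using positives_approx F by (intro sum_mono mult_mono) (auto simp: defs)
  also have "\<dots> = 2 * F * int (binom_le x k)" by (simp add: binom_le_def sum_distrib_left)
  also have "\<dots> \<le> 2 * F * B" using binom_le_mono[OF x(2), of k] F by (intro mult_left_mono) (auto simp: defs)
  finally have 1: "\<bar>rounded d eps x * F - V * peak d eps x\<bar> \<le> 2 * F * B" .
  define a f v b N where "a = \<bar>real_of_int (rounded d eps x)\<bar>" "f = real_of_int F" "v = real_of_int V"
    "b = real_of_int B" "N = real (Suc d)"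
  note rdefs = this
  have f: "f > 0" using F by (simp add: rdefs)
  have v: "v > 0" using scale_pos[of d eps] by (simp add: rdefs defs)
  have N: "1 \<le> N" "N \<le> b" using binom_deg_ge[of d eps] by (simp_all add: rdefs defs)
  define p where "p = \<bar>real_of_int (peak d eps x)\<bar>"
  have "\<bar>rounded d eps x\<bar> * F \<le> V * \<bar>peak d eps x\<bar> + 2 * F * B"
  proof -
    have "\<bar>rounded d eps x * F\<bar> \<le> \<bar>V * peak d eps x\<bar> + 2 * F * B" using 1 by linarith
    then show ?thesis using F scale_pos[of d eps] by (simp add: abs_mult defs)
  qed
  then have "real_of_int (\<bar>rounded d eps x\<bar> * F) \<le> real_of_int (V * \<bar>peak d eps x\<bar> + 2 * F * B)"
    by (simp only: of_int_le_iff)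
  then have 2: "a * f \<le> v * p + 2 * f * b" by (simp add: rdefs p_def)
  have 3: "p * (4 * N + 1) \<le> eps * (4 * N) * f"
    using peak_bound[OF eps01 x] by (simp add: p_def rdefs defs algebra_simps)
  have 4: "2 * b * (4 * N + 1) \<le> v * eps"
  proof -
    have "2 * b * (4 * N + 1) \<le> 2 * b * (5 * b)" using N by (intro mult_left_mono) auto
    also have "\<dots> = 10 * b ^ 2 * 1" by (simp add: power2_eq_square)
    also have "\<dots> \<le> 10 * b ^ 2 * (2 ^ (level eps + 1) * eps)"
      using level[OF eps01] by (intro mult_left_mono) auto
    also have "\<dots> = v * eps" by (simp add: rdefs defs scale_def)
    finally show ?thesis .
  qed
  \<comment> \<open>The peak contributes at most \<open>4 * N\<close> shares of
    \<open>v * eps * f\<close>; the rounding error fits into the one share that is left.\<close>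
  have "a * f * (4 * N + 1) \<le> (v * p + 2 * f * b) * (4 * N + 1)"
    using 2 N by (intro mult_right_mono) auto
  also have "\<dots> = v * (p * (4 * N + 1)) + f * (2 * b * (4 * N + 1))" by (simp add: algebra_simps)
  also have "\<dots> \<le> v * (eps * (4 * N) * f) + f * (v * eps)"
    using 3 4 v f by (intro add_mono mult_left_mono) auto
  also have "\<dots> = (v * eps) * (f * (4 * N + 1))" by (simp add: algebra_simps)
  finally have "a * (f * (4 * N + 1)) \<le> (v * eps) * (f * (4 * N + 1))" by (simp only: mult.assoc)
  then have "a \<le> v * eps" by (rule mult_right_le_imp_le) (use f N in auto)
  then show ?thesis by (simp add: rdefs defs)
qed

section \<open>The degree is of order \<open>dlog_root\<close>\<close>

lemma dlog_root_ge_1: "dlog_root d eps \<ge> 1"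
  by (simp add: dlog_root_def)

lemma log_inverse_pos: "0 < log 2 (1 / eps)"
  using eps01 by (subst zero_less_log_cancel_iff) auto

lemma dlog_root_sq: "dlog_root d eps ^ 2 = max 1 (real d * log 2 (1 / eps))"
proof (cases "1 \<le> real d * log 2 (1 / eps)")
  case True
  then have "1 \<le> sqrt (real d * log 2 (1 / eps))" by simp
  then show ?thesis using True by (simp add: dlog_root_def max_def)
next
  case False
  then have "\<not> 1 \<le> sqrt (real d * log 2 (1 / eps))" by simp
  then show ?thesis using False by (simp add: dlog_root_def max_def)
qed

text \<open>Minimality of the level gives \<open>l \<le> log 2 (1 / eps)\<close>, and
  \<open>Suc d \<le> 2 * d\<close> for positive \<open>d\<close>. For \<open>d = 0\<close> the cap
  leaves \<open>l \<le> 1\<close>, which the cutoff in \<open>dlog_root\<close> covers.\<close>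

lemma zeros_bound: "real (zeros d eps) * Suc d \<le> 2 * dlog_root d eps ^ 2"
proof (cases "level eps")
  case 0
  then show ?thesis by (simp add: zeros_def)
next
  case (Suc j)
  have "2 ^ level eps * eps < 1" using less_level[OF eps01, of j] Suc by simp
  then have "2 powr real (level eps) < 1 / eps" using eps01 by (simp add: powr_realpow field_simps)
  then have L: "real (level eps) \<le> log 2 (1 / eps)" using eps01 by (subst le_log_iff) auto
  show ?thesis
  proof (cases "d = 0")
    case True
    have "real (zeros d eps) \<le> 1" using True by (simp add: zeros_def)
    then show ?thesis using True dlog_root_sq by simp
  next
    case False
    have "real (zeros d eps) * Suc d \<le> log 2 (1 / eps) * (2 * real d)"
      using False L log_inverse_pos by (intro mult_mono) (auto simp: zeros_def)
    also have "\<dots> = 2 * (real d * log 2 (1 / eps))" by simp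
    also have "\<dots> \<le> 2 * dlog_root d eps ^ 2" unfolding dlog_root_sq by (intro mult_left_mono) auto
    finally show ?thesis .
  qed
qed

text \<open>The square is \<open>(l + 1)^2 * 4^i\<close>. By minimality \<open>i - 1\<close> fails
  both tests, which bounds \<open>4^i\<close> from above; for \<open>i = 1\<close> there is no
  smaller candidate and the cap \<open>l \<le> N\<close> is used instead. The worst case is
  \<open>768 * 2\<close>, rounded up to \<open>40^2\<close>.\<close>

lemma deg_sq_bound: "real (deg d eps) ^ 2 \<le> 1600 * dlog_root d eps ^ 2"
proof -
  define l i N R where "l = zeros d eps" "i = doublings d eps" "N = real (Suc d)" "R = dlog_root d eps ^ 2"
  note defs = this
  have R: "R \<ge> 1" using dlog_root_sq by (simp add: defs)
  have N: "N \<ge> 1" by (simp add: defs)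
  have k: "real (deg d eps) ^ 2 = (real l + 1) ^ 2 * 4 ^ i"
  proof -
    have "((2::real) ^ i) ^ 2 = (2 ^ 2) ^ i" by (simp only: power_mult[symmetric] mult.commute[of i 2])
    moreover have "real (deg d eps) = (real l + 1) * 2 ^ i" by (simp add: deg_def defs algebra_simps)
    ultimately show ?thesis by (simp add: power_mult_distrib)
  qed
  have lN: "real l * N \<le> 2 * R" using zeros_bound by (simp add: defs)
  have iq: "i \<ge> 1" using doublings(1)[OF eps01] by (simp add: defs)
  show ?thesis
  proof (cases "i = 1")
    case True
    have "real l \<le> N" by (simp add: defs zeros_def)
    then have "real l * real l \<le> real l * N" by (intro mult_left_mono) auto
    with lN have "real l ^ 2 \<le> 2 * R" by (simp add: power2_eq_square)
    moreover have "(real l + 1) ^ 2 \<le> 2 * real l ^ 2 + 2"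
      using zero_le_power2[of "real l - 1"] by (simp add: power2_eq_square algebra_simps)
    ultimately show ?thesis unfolding k using True R by (simp add: defs)
  next
    case False
    then obtain i' where i': "i = Suc i'" "1 \<le> i'" using iq by (cases i) auto
    have ns: "\<not> sharp_enough d eps i'" using less_doublings[OF eps01, of i'] i' by (simp add: defs)
    show ?thesis
    proof (cases "l = 0")
      case False
      have "4 ^ i' * l < 48 * Suc d" using ns by (simp add: sharp_enough_def defs)
      then have "real (4 ^ i' * l) < real (48 * Suc d)" by (simp only: of_nat_less_iff)
      then have a: "4 ^ i * real l \<le> 192 * N" by (simp add: i' defs)
      have "(real l + 1) ^ 2 \<le> (2 * real l) ^ 2" using False by (intro power_mono) auto
      then have "(real l + 1) ^ 2 * 4 ^ i \<le> (2 * real l) ^ 2 * 4 ^ i" by (intro mult_right_mono) auto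
      also have "\<dots> = 4 * real l * (4 ^ i * real l)" by (simp add: power2_eq_square)
      also have "\<dots> \<le> 4 * real l * (192 * N)" using a by (intro mult_left_mono) auto
      also have "\<dots> = 768 * (real l * N)" by simp
      finally show ?thesis unfolding k using lN R by (simp add: defs)
    next
      case True
      then have "level eps = 0" by (simp add: defs zeros_def)
      then have e: "1 / 2 \<le> eps" using level[OF eps01] by simp
      have "(4 ^ i' + 48 * N) * eps < 48 * N" using ns by (simp add: sharp_enough_def defs)
      then have "4 ^ i' * eps \<le> 48 * N * (1 - eps)" by (simp add: algebra_simps)
      moreover have "4 ^ i' * (1 / 2) \<le> 4 ^ i' * eps" using e by (intro mult_left_mono) auto
      ultimately have "4 ^ i' \<le> 96 * (N * (1 - eps))" by linarith
      then have a: "4 ^ i \<le> 384 * N * (1 - eps)" by (simp add: i')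
      \<comment> \<open>In the regime \<open>eps \<ge> 1/2\<close> the failed test bounds
        \<open>4^i\<close> by a multiple of \<open>N * (1 - eps)\<close>;
        \<open>ln y \<le> y - 1\<close> turns this into a logarithm, and base 2 only enlarges
        it.\<close>
      have ll: "1 - eps \<le> log 2 (1 / eps)"
      proof -
        have "1 - eps \<le> - ln eps" using ln_le_minus_one[of eps] eps01 by simp
        also have "\<dots> * 1 \<le> - ln eps * (1 / ln 2)"
          using eps01 ln_le_minus_one[of 2] by (intro mult_left_mono) (auto simp: field_simps)
        finally show ?thesis using eps01 by (simp add: log_def ln_div)
      qed
      have "N * (1 - eps) \<le> 2 * R"
      proof (cases "d = 0")
        case True
        then show ?thesis using e R eps01 by (simp add: defs)
      next
        case False
        then have "N * (1 - eps) \<le> (2 * real d) * log 2 (1 / eps)"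
          using ll eps01 by (intro mult_mono) (auto simp: defs)
        also have "\<dots> = 2 * (real d * log 2 (1 / eps))" by simp
        also have "\<dots> \<le> 2 * R" unfolding defs dlog_root_sq by (intro mult_left_mono) auto
        finally show ?thesis .
      qed
      then have "4 ^ i \<le> 1600 * R" using a R by linarith
      then have "(real l + 1) ^ 2 * 4 ^ i \<le> 1600 * R" using True by simp
      then show ?thesis unfolding k by (simp only: defs(4))
    qed
  qed
qed

lemma deg_bound: "real (deg d eps) \<le> 40 * dlog_root d eps"
proof (rule power2_le_imp_le)
  show "(real (deg d eps))\<^sup>2 \<le> (40 * dlog_root d eps)\<^sup>2"
    using deg_sq_bound by (simp add: power_mult_distrib)
qed (use dlog_root_ge_1 in simp)

end

section \<open>The vectors of the Max-IP instance\<close>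

definition monomial :: "int list \<Rightarrow> nat list \<Rightarrow> int" where
  "monomial v S = prod_list (map ((!) v) S)"

text \<open>Coordinates are ordered by monomial \<open>t\<close>, then copy \<open>r\<close>, then
  gadget slot \<open>g\<close>, so that \<open>i = (t * W + r) * 4 + g\<close> with
  \<open>W = nat (copies d eps)\<close>.\<close>

definition block :: "nat \<Rightarrow> real \<Rightarrow> nat \<Rightarrow> nat list" where
  "block d eps i = subs (deg d eps) d ! (i div (4 * nat (copies d eps)))"

text \<open>The gadget for one copy of a monomial: with \<open>s = 2 a\<^sub>S - 1\<close> and \<open>t = 2 b\<^sub>S - 1\<close>, the vectors
  \<open>(1, 1, s, s)\<close> and \<open>(1, t, 1, t)\<close> have inner product \<open>(1 + s) (1 + t) = 4 a\<^sub>S b\<^sub>S\<close>.\<close>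

definition entry_left :: "nat \<Rightarrow> real \<Rightarrow> int list \<Rightarrow> nat \<Rightarrow> int" where
  "entry_left d eps v i = (if i mod 4 < 2 then 1 else 2 * monomial v (block d eps i) - 1)"

text \<open>The sign of a copy multiplies its whole gadget and is carried by the right vector alone;
  odd slots hold the monomial.\<close>

definition entry_right :: "nat \<Rightarrow> real \<Rightarrow> int list \<Rightarrow> nat \<Rightarrow> int" where
  "entry_right d eps v i =
     (if int (i div 4 mod nat (copies d eps)) < positives d eps (length (block d eps i)) then 1 else - 1) *
     (if even i then 1 else 2 * monomial v (block d eps i) - 1)"

definition image_left :: "nat \<Rightarrow> real \<Rightarrow> int list \<Rightarrow> int list" where
  "image_left d eps v = map (entry_left d eps v) [0..<dim d eps]"

definition image_right :: "nat \<Rightarrow> real \<Rightarrow> int list \<Rightarrow> int list" where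
  "image_right d eps v = map (entry_right d eps v) [0..<dim d eps]"

lemma monomial_01:
  assumes "set v \<subseteq> {0, 1}" "set S \<subseteq> {..<length v}"
  shows "monomial v S \<in> {0, 1}"
  using assms(2)
proof (induction S)
  case (Cons j S)
  then have "v ! j \<in> {0, 1}" using subsetD[OF assms(1) nth_mem[of j v]] by simp
  with Cons show ?case by (auto simp: monomial_def)
qed (simp add: monomial_def)

lemma block_in_subs:
  assumes "i < dim d eps"
  shows "i div (4 * nat (copies d eps)) < binom_le d (deg d eps)" "block d eps i \<in> set (subs (deg d eps) d)"
proof -
  show "i div (4 * nat (copies d eps)) < binom_le d (deg d eps)"
    using assms by (intro less_mult_imp_div_less) (simp add: dim_def mult_ac)
  then show "block d eps i \<in> set (subs (deg d eps) d)"
    by (simp add: block_def length_subs[symmetric])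
qed

lemma monomial_block_01:
  assumes "i < dim d eps" "set v \<subseteq> {0, 1}" "length v = d"
  shows "monomial v (block d eps i) \<in> {0, 1}"
  using monomial_01[OF assms(2)] subs_bounds[OF block_in_subs(2)[OF assms(1)]] assms(3) by simp

lemma set_image_left:
  "set v \<subseteq> {0, 1} \<Longrightarrow> length v = d \<Longrightarrow> set (image_left d eps v) \<subseteq> {-1, 1}"
  using monomial_block_01[of _ d eps v] by (fastforce simp: image_left_def entry_left_def)

lemma set_image_right:
  "set v \<subseteq> {0, 1} \<Longrightarrow> length v = d \<Longrightarrow> set (image_right d eps v) \<subseteq> {-1, 1}"
  using monomial_block_01[of _ d eps v] by (fastforce simp: image_right_def entry_right_def)

text \<open>The new instance must again consist of repetition-free lists. The degree is at least 1,
  so singletons occur among the monomials and every input bit can be read off some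
  coordinate.\<close>

lemma image_injective:
  assumes "length v = d" "length w = d" "v \<noteq> w"
  shows "image_left d eps v \<noteq> image_left d eps w" "image_right d eps v \<noteq> image_right d eps w"
proof -
  define W where "W = nat (copies d eps)"
  have W: "W > 0" using copies_pos[of d eps] by (simp add: W_def)
  obtain j where j: "j < d" "v ! j \<noteq> w ! j" using assms nth_equalityI by metis
  from singleton_in_subs[OF j(1) deg_pos[of d eps]] obtain t where
    t: "t < binom_le d (deg d eps)" "subs (deg d eps) d ! t = [j]"
    by (auto simp: in_set_conv_nth length_subs)
  have i: "t * (4 * W) + g < dim d eps" "block d eps (t * (4 * W) + g) = [j]" if "g < 4" for g
  proof -
    have "t * (4 * W) + g < Suc t * (4 * W)" using that W by simp
    also have "\<dots> \<le> binom_le d (deg d eps) * (4 * W)" using t(1) by (intro mult_le_mono1) simp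
    finally show "t * (4 * W) + g < dim d eps" by (simp add: dim_def W_def mult_ac)
    have "(t * (4 * W) + g) div (4 * W) = t" using that W by simp
    then show "block d eps (t * (4 * W) + g) = [j]" by (simp add: block_def t(2) W_def)
  qed
  have even: "even (t * (4 * W))" by simp
  \<comment> \<open>Slot 2 exposes the monomial on the left. On the right slot 1 does, where both
    vectors carry the same sign.\<close>
  have mod4: "(t * (4 * W) + 2) mod 4 = 2" using mod_mult_self3[of "t * W" 4 2] by (simp add: mult_ac)
  have "image_left d eps v ! (t * (4 * W) + 2) \<noteq> image_left d eps w ! (t * (4 * W) + 2)"
    using i[of 2] j mod4 by (simp add: image_left_def entry_left_def monomial_def)
  then show "image_left d eps v \<noteq> image_left d eps w" by auto
  have "image_right d eps v ! (t * (4 * W) + 1) \<noteq> image_right d eps w ! (t * (4 * W) + 1)"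
    using i[of 1] j even by (simp add: image_right_def entry_right_def monomial_def)
  then show "image_right d eps v \<noteq> image_right d eps w" by auto
qed

lemma sum_blocks:
  fixes f :: "nat \<Rightarrow> int"
  shows "(\<Sum>i<a * b. f i) = (\<Sum>t<a. \<Sum>j<b. f (t * b + j))"
proof -
  have "(\<Sum>j<b. f (t * b + j)) = sum f {t * b..<t * b + b}" for t
    by (simp add: sum.atLeastLessThan_shift_0[of f "t * b"] lessThan_atLeast0)
  then show ?thesis by (simp add: sum.nat_group)
qed

lemma sum_signs:
  assumes "0 \<le> p" "p \<le> int W"
  shows "(\<Sum>r<W. if int r < p then 1 else - 1) = 2 * p - int W"
proof -
  obtain q where q: "p = int q" "q \<le> W" using assms by (metis nonneg_int_cases of_nat_le_iff)
  have "(\<Sum>r<W. if r < q then 1 else - 1 :: int) = 2 * int q - int W" using q(2)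
  proof (induction W)
    case (Suc W)
    show ?case
    proof (cases "q = Suc W")
      case True
      then show ?thesis by simp
    next
      case False
      with Suc show ?thesis by simp
    qed
  qed simp
  then show ?thesis by (simp add: q(1))
qed

text \<open>The copies of a monomial \<open>S\<close> add up to \<open>2 * p - W\<close> times
  \<open>4 * a_S * b_S\<close>. Since \<open>a_S * b_S\<close> is the monomial \<open>S\<close> of
  the coordinatewise product, which has \<open>x\<close> ones, \<open>sum_subs\<close> turns the
  total into binomials of \<open>x\<close>.\<close>

lemma dot_image:
  assumes eps01: "0 < eps" "eps < 1"
    and v: "set v \<subseteq> {0, 1}" "length v = d" and w: "set w \<subseteq> {0, 1}" "length w = d"
    and x: "int x = dot v w"
  shows "dot (image_left d eps v) (image_right d eps w) = 4 * rounded d eps x"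
proof -
  define W B L p where "W = nat (copies d eps)" "B = binom_le d (deg d eps)" "L = subs (deg d eps) d"
    "p = positives d eps"
  note defs = this
  have W: "W > 0" "int W = copies d eps" using copies_pos[of d eps] by (simp_all add: defs)
  have cell: "entry_left d eps v i * entry_right d eps w i =
      (if int r < p (length (L ! t)) then 1 else - 1) *
      ((if g < 2 then 1 else 2 * monomial v (L ! t) - 1) * (if even g then 1 else 2 * monomial w (L ! t) - 1))"
    if "r < W" "g < 4" "i = t * (W * 4) + (r * 4 + g)" for t r g i
  proof -
    have rg: "r * 4 + g < W * 4" using that by linarith
    have "i div (W * 4) = t" unfolding that(3) using rg by simp
    then have "block d eps i = L ! t" by (simp add: block_def defs mult.commute)
    moreover have e: "i = g + (t * W + r) * 4" using that(3) by (simp add: algebra_simps)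
    have "i mod 4 = g" unfolding e using that(2) by (simp only: mod_mult_self1 mod_less)
    moreover have "even i = even g" unfolding e by simp
    moreover have "i div 4 = t * W + r" unfolding e using that(2) by (subst div_mult_self1) auto
    moreover from this have "i div 4 mod W = r" using that(1) by simp
    ultimately show ?thesis by (simp add: entry_left_def entry_right_def flip: defs)
  qed
  have "dot (image_left d eps v) (image_right d eps w) =
      (\<Sum>i<B * (W * 4). entry_left d eps v i * entry_right d eps w i)"
    by (simp add: dot_def image_left_def image_right_def dim_def defs mult_ac)
  also have "\<dots> = (\<Sum>t<B. \<Sum>r<W. \<Sum>g<(4::nat). (if int r < p (length (L ! t)) then 1 else - 1) *
      ((if g < 2 then 1 else 2 * monomial v (L ! t) - 1) * (if even g then 1 else 2 * monomial w (L ! t) - 1)))"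
    unfolding sum_blocks by (intro sum.cong refl) (use cell in auto)
  also have "\<dots> = (\<Sum>t<B. \<Sum>r<W. (if int r < p (length (L ! t)) then 1 else - 1) *
      (4 * (monomial v (L ! t) * monomial w (L ! t))))"
  proof -
    have "{..<4::nat} = {0, 1, 2, 3}" by auto
    then show ?thesis by (intro sum.cong refl) (simp add: algebra_simps)
  qed
  also have "\<dots> = (\<Sum>t<B. (2 * p (length (L ! t)) - copies d eps) * (4 * (monomial v (L ! t) * monomial w (L ! t))))"
  proof (intro sum.cong refl)
    fix t assume "t \<in> {..<B}"
    then have "L ! t \<in> set L" by (simp add: defs length_subs)
    then have "length (L ! t) \<le> d" "length (L ! t) \<le> deg d eps"
      using subs_bounds unfolding defs by blast+
    from positives_range[OF eps01 this] show "(\<Sum>r<W. (if int r < p (length (L ! t)) then 1 else - 1) *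
        (4 * (monomial v (L ! t) * monomial w (L ! t)))) =
      (2 * p (length (L ! t)) - copies d eps) * (4 * (monomial v (L ! t) * monomial w (L ! t)))"
      unfolding sum_distrib_right[symmetric] W(2)[symmetric] by (subst sum_signs) (auto simp: defs)
  qed
  also have "\<dots> = 4 * (\<Sum>S\<leftarrow>L. (2 * p (length S) - copies d eps) * prod_list (map (\<lambda>j. v ! j * w ! j) S))"
  proof -
    have m: "monomial v S * monomial w S = prod_list (map (\<lambda>j. v ! j * w ! j) S)" for S
      unfolding monomial_def by (induction S) (auto simp: algebra_simps)
    show ?thesis unfolding m
      by (simp add: sum_list_sum_nth sum_distrib_left lessThan_atLeast0 defs length_subs mult_ac)
  qed
  also have "\<dots> = 4 * rounded d eps x"
  proof -
    have "v ! i * w ! i \<in> {0, 1}" if "i < d" for i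
      using subsetD[OF v(1) nth_mem[of i]] subsetD[OF w(1) nth_mem[of i]] v w that by auto
    moreover have "int x = (\<Sum>i<d. v ! i * w ! i)" using x v by (simp add: dot_def)
    ultimately show ?thesis unfolding rounded_def defs
      by (subst sum_subs[of d "\<lambda>j. v ! j * w ! j" x "\<lambda>j. 2 * positives d eps j - copies d eps"]) auto
  qed
  finally show ?thesis .
qed

lemma dot_01:
  assumes "set v \<subseteq> {0, 1}" "length v = d" "set w \<subseteq> {0, 1}" "length w = d"
  obtains x where "int x = dot v w" "x \<le> d"
proof -
  have 1: "v ! i * w ! i \<in> {0, 1}" if "i < d" for i
    using subsetD[OF assms(1) nth_mem[of i]] subsetD[OF assms(3) nth_mem[of i]] assms that by auto
  have "0 \<le> dot v w" unfolding dot_def assms(2) using 1 by (intro sum_nonneg) fastforce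
  moreover have "dot v w \<le> (\<Sum>i<d. 1)" unfolding dot_def assms(2) using 1 by (intro sum_mono) fastforce
  ultimately show ?thesis using that[of "nat (dot v w)"] by simp
qed

section \<open>Size of the numbers\<close>

lemma less_power_2: "x \<le> m \<Longrightarrow> int x < 2 ^ m"
proof -
  assume "x \<le> m"
  have "x < 2 ^ m" using less_exp[of m] \<open>x \<le> m\<close> by linarith
  then have "int x < int (2 ^ m)" by (simp only: of_nat_less_iff)
  then show ?thesis by simp
qed

text \<open>The factor \<open>4 ^ i * (8 * N)\<close> closes the induction: with it, both summands
  in the recursion are at most an eighth of \<open>(8 * N) ^ 2 ^ i\<close>, which leaves room for
  the next factor 4.\<close>

lemma kernel_size:
  assumes "x \<le> Suc d"
  shows "\<bar>kernel d i x\<bar> * 4 ^ i * (8 * int (Suc d)) \<le> (8 * int (Suc d)) ^ 2 ^ i"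
proof (induction i)
  case (Suc i)
  define N r Z where "N = int (Suc d)" "r = \<bar>kernel d i x\<bar>" "Z = (8 * N) ^ 2 ^ i"
  note defs = this
  have N: "N \<ge> 1" and r: "r \<ge> 0" by (simp_all add: defs)
  have Z: "Z \<ge> 0" using N by (simp add: defs(3))
  have IH: "r * 4 ^ i * (8 * N) \<le> Z" using Suc by (simp add: defs)
  have x: "\<bar>int x - 1\<bar> \<le> N" using assms by (simp add: defs)
  have NZ: "N ^ 2 ^ i * 8 \<le> Z"
  proof -
    have "(8::int) ^ 1 \<le> 8 ^ 2 ^ i" by (intro power_increasing) auto
    then have "N ^ 2 ^ i * 8 \<le> N ^ 2 ^ i * 8 ^ 2 ^ i" using N by (intro mult_left_mono) auto
    then show ?thesis by (simp add: defs(3) power_mult_distrib mult.commute)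
  qed
  have "\<bar>kernel d (Suc i) x\<bar> = r * \<bar>N ^ 2 ^ i - (int x - 1) * 4 ^ i * kernel d i x\<bar>"
    by (simp add: abs_mult defs)
  also have "\<dots> \<le> r * (N ^ 2 ^ i + N * 4 ^ i * r)"
  proof (intro mult_left_mono r)
    have "\<bar>(int x - 1) * 4 ^ i * kernel d i x\<bar> = \<bar>int x - 1\<bar> * (4 ^ i * r)" by (simp add: abs_mult defs)
    also have "\<dots> \<le> N * (4 ^ i * r)" using x r by (intro mult_right_mono) auto
    finally have "\<bar>(int x - 1) * 4 ^ i * kernel d i x\<bar> \<le> N * 4 ^ i * r" by (simp add: mult.assoc)
    moreover have "N ^ 2 ^ i \<ge> 0" using N by simp
    ultimately show "\<bar>N ^ 2 ^ i - (int x - 1) * 4 ^ i * kernel d i x\<bar> \<le> N ^ 2 ^ i + N * 4 ^ i * r" by linarith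
  qed
  finally have k: "\<bar>kernel d (Suc i) x\<bar> \<le> r * (N ^ 2 ^ i + N * 4 ^ i * r)" .
  have 2: "4 * (N ^ 2 ^ i + N * 4 ^ i * r) \<le> Z" using NZ IH by (simp add: algebra_simps)
  have "\<bar>kernel d (Suc i) x\<bar> * 4 ^ Suc i * (8 * N) \<le> r * (N ^ 2 ^ i + N * 4 ^ i * r) * 4 ^ Suc i * (8 * N)"
    using k N by (intro mult_right_mono) auto
  also have "\<dots> = (r * 4 ^ i * (8 * N)) * (4 * (N ^ 2 ^ i + N * 4 ^ i * r))" by (simp add: algebra_simps)
  also have "\<dots> \<le> Z * Z" using IH 2 Z N r by (intro mult_mono) auto
  also have "\<dots> = (8 * N) ^ 2 ^ Suc i" by (simp only: defs(3) power_Suc mult_2 power_add)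
  finally show ?case by (simp only: defs)
qed (simp add: assms)

lemma kernel_le:
  assumes "x \<le> Suc d"
  shows "\<bar>kernel d i x\<bar> \<le> (8 * int (Suc d)) ^ 2 ^ i"
proof -
  have "(1::int) * 1 \<le> 4 ^ i * (8 * int (Suc d))" by (intro mult_mono) auto
  then have "\<bar>kernel d i x\<bar> * 1 \<le> \<bar>kernel d i x\<bar> * (4 ^ i * (8 * int (Suc d)))"
    by (intro mult_left_mono) auto
  with kernel_size[OF assms, of i] show ?thesis by (simp only: mult.assoc mult_1_right)
qed

lemma power_8_bound:
  assumes "j \<le> m * k"
  shows "(8 * int (Suc d)) ^ j \<le> 2 ^ (4 * m * (k * Suc d))"
proof -
  have "8 * int (Suc d) \<le> 2 ^ 3 * 2 ^ Suc d" using less_power_2[of "Suc d" "Suc d"] by simp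
  also have "\<dots> = (2::int) ^ (3 + Suc d)" by (simp only: power_add)
  also have "\<dots> \<le> 2 ^ (4 * Suc d)" by (intro power_increasing) auto
  finally have "(8 * int (Suc d)) ^ j \<le> (2 ^ (4 * Suc d)) ^ j" by (intro power_mono) auto
  also have "\<dots> = 2 ^ (4 * Suc d * j)" by (simp only: power_mult)
  also have "\<dots> \<le> 2 ^ (4 * Suc d * (m * k))" using assms by (intro power_increasing mult_le_mono) auto
  finally show ?thesis by (simp only: mult_ac)
qed

text \<open>The loop invariant of \<open>peak_prog\<close>, which multiplies one zero factor and one
  kernel factor per round, starting from a single kernel. Its intermediate values have to fit into
  cells, too.\<close>

definition partial_peak :: "nat \<Rightarrow> real \<Rightarrow> nat \<Rightarrow> nat \<Rightarrow> int" where
  "partial_peak d eps m x = (\<Prod>j=1..m. int j - int x) * kernel d (doublings d eps) x ^ Suc m"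

lemma partial_peak_Suc:
  "partial_peak d eps (Suc m) x =
   partial_peak d eps m x * ((int (Suc m) - int x) * kernel d (doublings d eps) x)"
  by (simp add: partial_peak_def)

lemma partial_peak_le:
  assumes "x \<le> Suc d" "m \<le> zeros d eps"
  shows "\<bar>partial_peak d eps m x\<bar> \<le> 2 ^ (8 * (deg d eps * Suc d))"
proof -
  define N i where "N = 8 * int (Suc d)" "i = doublings d eps"
  note defs = this
  have mN: "m \<le> Suc d" using assms(2) by (simp add: zeros_def)
  have "\<bar>\<Prod>j=1..m. int j - int x\<bar> = (\<Prod>j=1..m. \<bar>int j - int x\<bar>)" by (rule abs_prod)
  also have "\<dots> \<le> (\<Prod>j=1..m. N)" using assms(1) mN by (intro prod_mono) (auto simp: defs)
  finally have 1: "\<bar>\<Prod>j=1..m. int j - int x\<bar> \<le> N ^ m" by simp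
  have 2: "\<bar>kernel d i x ^ Suc m\<bar> \<le> (N ^ 2 ^ i) ^ Suc m"
    unfolding power_abs using kernel_le[OF assms(1)] by (intro power_mono) (auto simp: defs)
  have "\<bar>partial_peak d eps m x\<bar> \<le> N ^ m * (N ^ 2 ^ i) ^ Suc m"
    unfolding partial_peak_def abs_mult using 1 2 by (intro mult_mono) (auto simp: defs)
  also have "\<dots> = N ^ (m + 2 ^ i * Suc m)" by (simp only: power_add power_mult)
  also have "\<dots> \<le> 2 ^ (4 * 2 * (deg d eps * Suc d))" unfolding defs
  proof (rule power_8_bound)
    have "m \<le> 1 * Suc m" by simp
    also have "\<dots> \<le> 2 ^ doublings d eps * Suc m" by (intro mult_le_mono) auto
    finally have "m + 2 ^ doublings d eps * Suc m \<le> 2 ^ doublings d eps * Suc m + 2 ^ doublings d eps * Suc m"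
      by (rule add_right_mono)
    also have "\<dots> \<le> 2 * deg d eps"
    proof -
      have "2 ^ doublings d eps * Suc m \<le> 2 ^ doublings d eps * Suc (zeros d eps)"
        using assms(2) by (intro mult_le_mono2) simp
      then show ?thesis by (simp only: deg_def mult.commute)
    qed
    finally show "m + 2 ^ doublings d eps * Suc m \<le> 2 * deg d eps" .
  qed
  finally show ?thesis by simp
qed

lemma dim_eq: "dim d eps = 40 * 2 ^ deg d eps * binom_le d (deg d eps) ^ 3 * 2 ^ (level eps + 1)"
proof -
  have "copies d eps = int (2 ^ deg d eps * (10 * binom_le d (deg d eps) ^ 2 * 2 ^ (level eps + 1)))"
    by (simp add: copies_def scale_def)
  then have "nat (copies d eps) = 2 ^ deg d eps * (10 * binom_le d (deg d eps) ^ 2 * 2 ^ (level eps + 1))"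
    by (simp only: nat_int)
  then show ?thesis by (simp add: dim_def power3_eq_cube power2_eq_square)
qed

text \<open>All loop counts and bit lengths below are charged to the dimension. The cube of
  \<open>binom_le\<close>, itself at least \<open>Suc d\<close>, leaves room even for the quadratic
  difference table.\<close>

lemma dim_lower:
  "deg d eps * Suc d \<le> dim d eps" "Suc d \<le> dim d eps" "2 ^ deg d eps \<le> dim d eps"
  "2 ^ (level eps + 1) \<le> dim d eps" "binom_le d (deg d eps) * Suc d \<le> dim d eps" "40 \<le> dim d eps"
  "nat (copies d eps) \<le> dim d eps" "binom_le d (deg d eps) \<le> dim d eps" "Suc d * Suc d \<le> dim d eps"
proof -
  define B P E where "B = binom_le d (deg d eps)" "P = (2::nat) ^ deg d eps" "E = (2::nat) ^ (level eps + 1)"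
  note defs = this
  have pos: "Suc d \<le> B" "1 \<le> B" "1 \<le> P" "1 \<le> E" using binom_deg_ge[of d eps] by (simp_all add: defs)
  have D: "dim d eps = 40 * (P * E * (B * B * B))" by (simp add: dim_eq defs power3_eq_cube)
  have "1 * 1 \<le> P * E" "1 * 1 \<le> B * B" using pos by (intro mult_le_mono; simp)+
  then have 1: "1 \<le> P * E" "1 \<le> B * B" by auto
  have 2: "P * E * (B * B * 1) \<le> P * E * (B * B * B)" using pos by (intro mult_le_mono) auto
  have 3: "P * 1 * (B * 1) \<le> P * E * (B * B)" "1 * (B * B) \<le> P * E * (B * B)"
    "P * E * 1 \<le> P * E * (B * B)" "1 * 1 * (B * B) \<le> P * E * (B * B)"
    using pos 1 by (intro mult_le_mono; simp)+
  have "deg d eps * Suc d \<le> P * B" using pos less_exp[of "deg d eps"] unfolding defs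
    by (intro mult_le_mono) auto
  then show "deg d eps * Suc d \<le> dim d eps" using 2 3 D by linarith
  have "1 * B \<le> B * B" using pos by (intro mult_le_mono) auto
  then show "Suc d \<le> dim d eps" "B \<le> dim d eps" using pos 2 3 D by linarith+
  have "P * 1 \<le> P * E" "1 * E \<le> P * E" using pos by (intro mult_le_mono; simp)+
  then show "P \<le> dim d eps" "E \<le> dim d eps" using 2 3 D by linarith+
  have "B * Suc d \<le> B * B" "Suc d * Suc d \<le> B * B" using pos by (intro mult_le_mono; simp)+
  then show "B * Suc d \<le> dim d eps" "Suc d * Suc d \<le> dim d eps" using 2 3 D by linarith+
  have "1 * 1 * 1 \<le> P * E * (B * B * B)" using pos by (intro mult_le_mono) auto
  then show "40 \<le> dim d eps" using D by linarith
  have "1 * nat (copies d eps) \<le> (4 * B) * nat (copies d eps)" using pos by (intro mult_le_mono) auto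
  then show "nat (copies d eps) \<le> dim d eps" by (simp add: dim_def defs)
qed

text \<open>Addresses stay below \<open>2\<^sup>2\<^sup>D\<close>, kernel values below \<open>2\<^sup>4\<^sup>D\<close>, the products below \<open>2\<^sup>8\<^sup>D\<close> and the
  differences below \<open>2\<^sup>9\<^sup>D\<close>, where \<open>D\<close> is the dimension.\<close>

definition capacity :: "nat \<Rightarrow> real \<Rightarrow> nat" where
  "capacity d eps = 10 * dim d eps"

abbreviation (input) fits :: "nat \<Rightarrow> real \<Rightarrow> memory \<Rightarrow> bool" where
  "fits d eps \<equiv> bounded_mem (capacity d eps)"

abbreviation (input) halts :: "nat \<Rightarrow> real \<Rightarrow> memory \<Rightarrow> com \<Rightarrow> nat \<Rightarrow> (memory \<Rightarrow> bool) \<Rightarrow> bool" where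
  "halts d eps \<equiv> terminates eps (capacity d eps)"

lemma le_capacity: "\<bar>x\<bar> \<le> 2 ^ j \<Longrightarrow> j < capacity d eps \<Longrightarrow> \<bar>x\<bar> < 2 ^ capacity d eps" for x :: int
  using power_strict_increasing[of j "capacity d eps" "2::int"] by linarith

lemma nat_capacity: "x \<le> m * dim d eps \<Longrightarrow> m < 10 \<Longrightarrow> \<bar>int x\<bar> < 2 ^ capacity d eps"
proof (rule le_capacity)
  assume "x \<le> m * dim d eps" "m < 10"
  show "\<bar>int x\<bar> \<le> 2 ^ (m * dim d eps)" using less_power_2[OF \<open>x \<le> m * dim d eps\<close>] by simp
  show "m * dim d eps < capacity d eps" using \<open>m < 10\<close> dim_lower(6)[of d eps] by (simp add: capacity_def)
qed

lemma deg_lower: "2 ^ doublings d eps \<le> deg d eps" "zeros d eps \<le> deg d eps" "doublings d eps \<le> deg d eps"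
proof -
  have "1 * 2 ^ doublings d eps \<le> deg d eps" unfolding deg_def by (intro mult_le_mono) auto
  then show "2 ^ doublings d eps \<le> deg d eps" by simp
  then show "doublings d eps \<le> deg d eps" using less_exp[of "doublings d eps"] by linarith
  have "Suc (zeros d eps) * 1 \<le> deg d eps" unfolding deg_def by (intro mult_le_mono) auto
  then show "zeros d eps \<le> deg d eps" by simp
qed

lemma deg_le_dim: "deg d eps \<le> dim d eps" "level eps < dim d eps" "doublings d eps \<le> dim d eps"
proof -
  show 1: "deg d eps \<le> dim d eps" using less_exp[of "deg d eps"] dim_lower(3)[of d eps] by linarith
  show "level eps < dim d eps" using less_exp[of "level eps + 1"] dim_lower(4)[of eps d] by linarith
  show "doublings d eps \<le> dim d eps" using deg_lower(3)[of d eps] 1 by linarith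
qed

lemma capacity_power_4: "j \<le> doublings d eps \<Longrightarrow> \<bar>4 ^ j\<bar> < (2::int) ^ capacity d eps"
proof (rule le_capacity)
  assume "j \<le> doublings d eps"
  have "(4::int) ^ j = 2 ^ (2 * j)" by (simp add: power_mult)
  then show "\<bar>(4::int) ^ j\<bar> \<le> 2 ^ (2 * j)" by simp
  show "2 * j < capacity d eps"
    using \<open>j \<le> doublings d eps\<close> deg_le_dim(3)[of d eps] dim_lower(6)[of d eps] by (simp add: capacity_def)
qed

lemma capacity_power_2: "j \<le> m * dim d eps \<Longrightarrow> m < 10 \<Longrightarrow> \<bar>2 ^ j\<bar> < (2::int) ^ capacity d eps"
  by (rule le_capacity[where j = j]) (use dim_lower(6)[of d eps] in
    \<open>auto simp: capacity_def intro!: le_less_trans[of j "m * dim d eps"]\<close>)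

lemma capacity_kernel:
  assumes "x \<le> Suc d" "i \<le> doublings d eps"
  shows "\<bar>kernel d i x\<bar> < 2 ^ capacity d eps" "\<bar>int (Suc d) ^ 2 ^ i\<bar> < 2 ^ capacity d eps"
proof -
  have "(2::nat) ^ i \<le> 2 ^ doublings d eps" using assms(2) by (intro power_increasing) auto
  then have "2 ^ i \<le> 1 * deg d eps" using deg_lower(1)[of d eps] by linarith
  from power_8_bound[OF this, of d] have 1: "(8 * int (Suc d)) ^ 2 ^ i \<le> 2 ^ (4 * (deg d eps * Suc d))"
    by (simp only: mult_1_right)
  have 2: "4 * (deg d eps * Suc d) < capacity d eps"
    using dim_lower(1,6)[where d = d and eps = eps] by (simp add: capacity_def)
  show "\<bar>kernel d i x\<bar> < 2 ^ capacity d eps"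
    using le_capacity[OF order_trans[OF kernel_le[OF assms(1)] 1] 2] .
  have "int (Suc d) ^ 2 ^ i \<le> (8 * int (Suc d)) ^ 2 ^ i" by (intro power_mono) auto
  moreover have "0 \<le> int (Suc d) ^ 2 ^ i" by simp
  ultimately have "\<bar>int (Suc d) ^ 2 ^ i\<bar> \<le> 2 ^ (4 * (deg d eps * Suc d))" using 1 by linarith
  from le_capacity[OF this 2] show "\<bar>int (Suc d) ^ 2 ^ i\<bar> < 2 ^ capacity d eps" .
qed

lemma capacity_partial_peak:
  assumes "x \<le> Suc d" "m \<le> zeros d eps"
  shows "\<bar>partial_peak d eps m x\<bar> < 2 ^ capacity d eps"
  by (rule le_capacity[OF partial_peak_le[OF assms]])
    (use dim_lower(1,6)[where d = d and eps = eps] in \<open>simp add: capacity_def\<close>)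

lemma capacity_diff:
  assumes "x + j \<le> d"
  shows "\<bar>(diff ^^ j) (peak d eps) x\<bar> < 2 ^ capacity d eps"
proof (rule le_capacity)
  have "\<bar>peak d eps y\<bar> \<le> 2 ^ (8 * (deg d eps * Suc d))" if "y \<le> x + j" for y
    using partial_peak_le[of y d "zeros d eps" eps] that assms by (simp add: peak_def partial_peak_def)
  then have "\<bar>(diff ^^ j) (peak d eps) x\<bar> \<le> 2 ^ j * 2 ^ (8 * (deg d eps * Suc d))"
    by (intro diff_funpow_bound) auto
  then show "\<bar>(diff ^^ j) (peak d eps) x\<bar> \<le> 2 ^ (j + 8 * (deg d eps * Suc d))" by (simp add: power_add)
  show "j + 8 * (deg d eps * Suc d) < capacity d eps"
    using dim_lower(1,2,6)[where d = d and eps = eps] assms unfolding capacity_def by linarith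
qed

section \<open>The machine program\<close>

abbreviation (input) "reg_n \<equiv> - 1 :: int"
abbreviation (input) "reg_d \<equiv> - 2 :: int"
abbreviation (input) "reg_N \<equiv> - 3 :: int"
abbreviation (input) "reg_E \<equiv> - 4 :: int"
abbreviation (input) "reg_l \<equiv> - 5 :: int"
abbreviation (input) "reg_q \<equiv> - 6 :: int"
abbreviation (input) "reg_K \<equiv> - 7 :: int"
abbreviation (input) "reg_k \<equiv> - 8 :: int"
abbreviation (input) "reg_P \<equiv> - 9 :: int"
abbreviation (input) "reg_x \<equiv> - 10 :: int"
abbreviation (input) "reg_R \<equiv> - 11 :: int"
abbreviation (input) "reg_D \<equiv> - 12 :: int"
abbreviation (input) "reg_Q \<equiv> - 13 :: int"
abbreviation (input) "reg_F \<equiv> - 14 :: int"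
abbreviation (input) "reg_j \<equiv> - 15 :: int"
abbreviation (input) "reg_len \<equiv> - 16 :: int"
abbreviation (input) "reg_old \<equiv> - 17 :: int"
abbreviation (input) "reg_vec \<equiv> - 18 :: int"
abbreviation (input) "reg_out \<equiv> - 19 :: int"
abbreviation (input) "reg_i \<equiv> - 20 :: int"
abbreviation (input) "reg_t \<equiv> - 21 :: int"
abbreviation (input) "reg_W \<equiv> - 22 :: int"
abbreviation (input) "reg_V \<equiv> - 23 :: int"
abbreviation (input) "reg_in \<equiv> - 24 :: int"
abbreviation (input) "reg_dim \<equiv> - 25 :: int"
abbreviation (input) "reg_r \<equiv> - 26 :: int"
abbreviation (input) "reg_g \<equiv> - 27 :: int"
abbreviation (input) "reg_y \<equiv> - 28 :: int"
abbreviation (input) "reg_p \<equiv> - 29 :: int"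

abbreviation Reg :: "int \<Rightarrow> aexp" where "Reg x \<equiv> Cell (Const x)"
abbreviation Set_to :: "int \<Rightarrow> aexp \<Rightarrow> com" where "Set_to x e \<equiv> Assign (Const x) e"

text \<open>Four arrays are interleaved in the negative addresses below the registers: 0 holds a copy of the
  input vectors, 1 and 2 the values and degrees of the monomials, 3 the difference table.\<close>

definition arr :: "int \<Rightarrow> int \<Rightarrow> int" where
  "arr a j = - 32 - a - 4 * j"

definition Arr :: "int \<Rightarrow> aexp \<Rightarrow> aexp" where
  "Arr a e = Minus (Const (- 32 - a)) (Times (Const 4) e)"

lemma aval_Arr [simp]: "aval eps s (Arr a e) = arr a (aval eps s e)"
  by (simp add: Arr_def arr_def)

lemma weight_Arr [simp]: "weight (Arr a e) = 2 * nat \<bar>- 32 - a\<bar> + 17 + weight e + 2 * width e"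
  by (simp add: Arr_def)

lemma width_Arr [simp]: "width (Arr a e) = nat \<bar>- 32 - a\<bar> + 6 + width e"
  by (simp add: Arr_def)

lemma arr_eq [simp]:
  "0 \<le> a \<Longrightarrow> a < 4 \<Longrightarrow> 0 \<le> a' \<Longrightarrow> a' < 4 \<Longrightarrow> arr a i = arr a' j \<longleftrightarrow> a = a' \<and> i = j"
  unfolding arr_def by presburger

lemma arr_less: "0 \<le> a \<Longrightarrow> 0 \<le> j \<Longrightarrow> arr a j < - 31"
  by (simp add: arr_def)

lemma arr_neq [simp]:
  "0 \<le> a \<Longrightarrow> 0 \<le> j \<Longrightarrow> - 31 \<le> c \<Longrightarrow> arr a j \<noteq> c"
  "0 \<le> a \<Longrightarrow> 0 \<le> j \<Longrightarrow> - 31 \<le> c \<Longrightarrow> c \<noteq> arr a j"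
  using arr_less[of a j] by auto

definition cells :: "int \<Rightarrow> int set" where
  "cells a = arr a ` {0..}"

lemma arr_in_cells [simp]:
  "0 \<le> a \<Longrightarrow> a < 4 \<Longrightarrow> 0 \<le> a' \<Longrightarrow> a' < 4 \<Longrightarrow> 0 \<le> j \<Longrightarrow> arr a j \<in> cells a' \<longleftrightarrow> a = a'"
  by (auto simp: cells_def)

lemma not_in_cells [simp]: "0 \<le> a \<Longrightarrow> - 31 \<le> c \<Longrightarrow> c \<notin> cells a"
  using arr_less[of a] by (fastforce simp: cells_def)

text \<open>A frame condition: \<open>X\<close> collects the cells that a program part may
  change.\<close>

definition agree :: "int set \<Rightarrow> memory \<Rightarrow> memory \<Rightarrow> bool" where
  "agree X s s' \<longleftrightarrow> (\<forall>a. a \<notin> X \<longrightarrow> s' a = s a)"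

lemma agreeD: "agree X s s' \<Longrightarrow> a \<notin> X \<Longrightarrow> s' a = s a"
  by (simp add: agree_def)

lemma agree_refl: "agree X s s"
  by (simp add: agree_def)

lemma agree_upd: "agree X s s' \<Longrightarrow> a \<in> X \<Longrightarrow> agree X s (s'(a := v))"
  by (simp add: agree_def)

lemma agree_trans: "agree X s s' \<Longrightarrow> agree Y s' s'' \<Longrightarrow> Y \<subseteq> X \<Longrightarrow> agree X s s''"
  by (auto simp: agree_def subset_iff)

lemma terminates_assign:
  assumes "bounded_mem b s" "aval eps s a = x" "aval eps s e = v" "weight a + weight e \<le> 1000"
    "\<bar>v\<bar> < 2 ^ b" "bounded_mem b (s(x := v)) \<Longrightarrow> Q (s(x := v))"
  shows "terminates eps b s (Assign a e) 1 Q"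
  using terminates_Assign[of b s a e eps Q] assms by simp

lemma terminates_seq_assign:
  assumes "bounded_mem b s" "aval eps s a = x" "aval eps s e = v" "weight a + weight e \<le> 1000"
    "\<bar>v\<bar> < 2 ^ b" "bounded_mem b (s(x := v)) \<Longrightarrow> terminates eps b (s(x := v)) c t Q"
  shows "terminates eps b s (Seq (Assign a e) c) (Suc t) Q"
  using terminates_Seq_Assign[of b s a e eps] assms by simp

lemma terminates_seq:
  assumes "terminates eps b s c1 t1 R" "\<And>s'. bounded_mem b s' \<Longrightarrow> R s' \<Longrightarrow> terminates eps b s' c2 t2 Q"
  shows "terminates eps b s (Seq c1 c2) (t1 + t2) Q"
  by (rule terminates_Seq, rule terminates_mono[OF assms(1)]) (use assms(2) in auto)

section \<open>Computing the parameters and the coefficients\<close>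

definition level_prog :: com where
  "level_prog =
     Seq (Set_to reg_E (Const 2)) (Seq (Set_to reg_l (Const 0))
    (While (Minus (Const 1) (Eps_ge (Const 1) (Reg reg_E)))
       (Seq (Set_to reg_l (Plus (Reg reg_l) (Less (Reg reg_l) (Reg reg_N))))
            (Set_to reg_E (Times (Const 2) (Reg reg_E))))))"

text \<open>The product of the two 0/1 values is a conjunction: the loop continues while both tests
  of \<open>sharp_enough\<close> fail. The initial values 4 and 2 belong to
  \<open>i = 1\<close>.\<close>

definition doublings_prog :: com where
  "doublings_prog =
     Seq (Set_to reg_q (Const 4)) (Seq (Set_to reg_K (Const 2))
    (While (Times (Less (Times (Reg reg_q) (Reg reg_l)) (Times (Const 48) (Reg reg_N)))
              (Minus (Const 1) (Eps_ge (Times (Const 48) (Reg reg_N))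
                                       (Plus (Reg reg_q) (Times (Const 48) (Reg reg_N))))))
       (Seq (Set_to reg_q (Times (Const 4) (Reg reg_q)))
            (Set_to reg_K (Times (Const 2) (Reg reg_K))))))"

definition power_prog :: com where
  "power_prog =
     Seq (Set_to reg_k (Times (Plus (Reg reg_l) (Const 1)) (Reg reg_K)))
    (Seq (Set_to reg_P (Const 1)) (Seq (Set_to reg_i (Const 0))
    (While (Less (Reg reg_i) (Reg reg_k))
       (Seq (Set_to reg_P (Times (Const 2) (Reg reg_P)))
            (Set_to reg_i (Plus (Reg reg_i) (Const 1)))))))"

text \<open>The output will occupy the same cells from address 2 on, so the input is moved to
  negative addresses before anything is written.\<close>

definition copy_prog :: com where
  "copy_prog =
     Seq (Set_to reg_i (Const 0))
    (While (Less (Reg reg_i) (Times (Times (Const 2) (Reg reg_n)) (Reg reg_d)))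
       (Seq (Assign (Arr 0 (Reg reg_i)) (Cell (Plus (Const 2) (Reg reg_i))))
            (Set_to reg_i (Plus (Reg reg_i) (Const 1)))))"

text \<open>\<open>reg_Q\<close> holds \<open>4 ^ i\<close> and, compared with \<open>reg_q\<close>,
  also acts as the loop counter; \<open>reg_D\<close> obtains \<open>N ^ 2 ^ i\<close> by repeated
  squaring.\<close>

definition kernel_prog :: com where
  "kernel_prog =
     Seq (Set_to reg_R (Const 1)) (Seq (Set_to reg_Q (Const 1)) (Seq (Set_to reg_D (Reg reg_N))
    (While (Less (Reg reg_Q) (Reg reg_q))
       (Seq (Set_to reg_R (Times (Reg reg_R) (Minus (Reg reg_D)
               (Times (Times (Minus (Reg reg_x) (Const 1)) (Reg reg_Q)) (Reg reg_R)))))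
       (Seq (Set_to reg_D (Times (Reg reg_D) (Reg reg_D)))
            (Set_to reg_Q (Times (Const 4) (Reg reg_Q))))))))"

definition peak_prog :: com where
  "peak_prog =
     Seq (Set_to reg_F (Reg reg_R)) (Seq (Set_to reg_j (Const 0))
    (While (Less (Reg reg_j) (Reg reg_l))
       (Seq (Set_to reg_j (Plus (Reg reg_j) (Const 1)))
            (Set_to reg_F (Times (Reg reg_F) (Times (Minus (Reg reg_j) (Reg reg_x)) (Reg reg_R)))))))"

definition table_prog :: com where
  "table_prog =
     Seq (Set_to reg_x (Const 0))
    (While (Less (Reg reg_x) (Reg reg_N))
       (Seq kernel_prog (Seq peak_prog
       (Seq (Assign (Arr 3 (Reg reg_x)) (Reg reg_F))
            (Set_to reg_x (Plus (Reg reg_x) (Const 1)))))))"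

text \<open>The table is updated in place. Running \<open>x\<close> downwards ensures that entry
  \<open>x - 1\<close> still has the previous order when it is read.\<close>

definition difference_prog :: com where
  "difference_prog =
     Seq (Set_to reg_j (Const 1))
    (While (Less (Reg reg_j) (Reg reg_N))
       (Seq (Set_to reg_x (Reg reg_d))
       (Seq (While (Less (Minus (Reg reg_j) (Const 1)) (Reg reg_x))
               (Seq (Assign (Arr 3 (Reg reg_x))
                      (Minus (Cell (Arr 3 (Reg reg_x))) (Cell (Arr 3 (Minus (Reg reg_x) (Const 1))))))
                    (Set_to reg_x (Minus (Reg reg_x) (Const 1)))))
            (Set_to reg_j (Plus (Reg reg_j) (Const 1))))))"

context
  fixes eps :: real and d :: nat
  assumes eps01: "0 < eps" "eps < 1"
begin

text \<open>The comparison \<open>reg_l < reg_N\<close> is added as a 0/1 value, which computes the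
  minimum in \<open>zeros\<close> without branching while \<open>reg_E\<close> goes on
  doubling.\<close>

lemma level_prog:
  assumes b: "fits d eps s" and N: "s reg_N = int (Suc d)"
  shows "halts d eps s level_prog (5 * dim d eps)
    (\<lambda>s'. agree {reg_E, reg_l} s s' \<and> s' reg_E = 2 ^ (level eps + 1) \<and> s' reg_l = int (zeros d eps))"
proof -
  define I where "I j s' \<longleftrightarrow> agree {reg_E, reg_l} s s' \<and> s' reg_E = 2 ^ (j + 1) \<and> s' reg_l = int (min j (Suc d))"
    for j s'
  have E: "\<bar>2 ^ (j + 1)\<bar> < (2::int) ^ capacity d eps" if "j \<le> level eps" for j
    using that deg_le_dim(2)[of eps d] by (intro capacity_power_2[where m = 1]) auto
  have l: "\<bar>int (min j (Suc d))\<bar> < 2 ^ capacity d eps" for j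
    using dim_lower(2)[of d eps] by (intro nat_capacity[where m = 1]) auto
  have "halts d eps s level_prog (Suc (Suc (Suc (level eps * Suc (Suc 1)))))
    (\<lambda>s'. agree {reg_E, reg_l} s s' \<and> s' reg_E = 2 ^ (level eps + 1) \<and> s' reg_l = int (zeros d eps))"
    unfolding level_prog_def
    apply (rule terminates_seq_assign[where x = reg_E and v = 2], fact b, simp, simp, simp,
        use E[of 0] in simp)
    apply (rule terminates_seq_assign[where x = reg_l and v = 0], assumption, simp, simp, simp, simp)
    apply (rule terminates_While[where I = I], assumption, simp)
    subgoal by (simp add: I_def agree_def)
    subgoal premises p for j s1
    proof
      note j = p(3) and I = p(4) and b = p(5)
      have [simp]: "s1 reg_N = int (Suc d)" using I N by (simp add: I_def agree_def)
      show "aval eps s1 (Minus (Const 1) (Eps_ge (Const 1) (Reg reg_E))) \<noteq> 0"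
        using I less_level[OF eps01 j] by (simp add: I_def)
      show "halts d eps s1 (Seq (Set_to reg_l (Plus (Reg reg_l) (Less (Reg reg_l) (Reg reg_N))))
          (Set_to reg_E (Times (Const 2) (Reg reg_E)))) (Suc 1) (I (Suc j))"
        apply (rule terminates_seq_assign[where x = reg_l and v = "int (min (Suc j) (Suc d))"], fact b,
            simp, use I in \<open>simp add: I_def\<close>, simp, rule l)
        apply (rule terminates_assign[where x = reg_E and v = "2 ^ (Suc j + 1)"], assumption,
            simp, use I in \<open>simp add: I_def\<close>, simp, use E[of "Suc j"] j in simp)
        using I by (simp add: I_def agree_def)
    qed
    subgoal using level[OF eps01] by (simp add: I_def)
    subgoal by (auto simp: I_def zeros_def)
    done
  then show ?thesis using deg_le_dim(2)[of eps d] dim_lower(6)[of d eps] by (rule_tac terminates_mono) auto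
qed

end

lemma small_const: "\<bar>x\<bar> \<le> 40 \<Longrightarrow> \<bar>x\<bar> < 2 ^ capacity d eps" for x :: int
  using nat_capacity[of "nat \<bar>x\<bar>" 1 d eps] dim_lower(6)[of d eps] by simp

lemma small_nat: "x \<le> dim d eps \<Longrightarrow> \<bar>int x\<bar> < 2 ^ capacity d eps"
  using nat_capacity[of x 1 d eps] by simp

text \<open>With \<open>n \<le> 2 ^ d\<close>, addresses have about \<open>2 + d + dim d eps\<close>
  bits, so no factor \<open>log n\<close> enters the running time.\<close>

lemma capacity_address:
  assumes "n \<le> 2 ^ d" "x \<le> 2 + 2 * n * dim d eps"
  shows "\<bar>int x\<bar> < 2 ^ capacity d eps"
proof (rule le_capacity)
  have "x \<le> 2 + 2 * (n * dim d eps)" using assms(2) by (simp add: mult.assoc)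
  also have "\<dots> \<le> 2 + 2 * (2 ^ d * dim d eps)" using assms(1) by (intro add_left_mono mult_le_mono) auto
  also have "\<dots> \<le> 2 + 2 * (2 ^ d * 2 ^ dim d eps)"
    using less_exp[of "dim d eps"] by (intro add_left_mono mult_le_mono) auto
  also have "\<dots> \<le> 2 * (2 ^ d * 2 ^ dim d eps) + 2 * (2 ^ d * 2 ^ dim d eps)" by simp
  also have "\<dots> = 2 ^ (2 + d + dim d eps)" by (simp add: power_add)
  finally have "int x \<le> int (2 ^ (2 + d + dim d eps))" by (simp only: of_nat_le_iff)
  then show "\<bar>int x\<bar> \<le> 2 ^ (2 + d + dim d eps)" by simp
  show "2 + d + dim d eps < capacity d eps" using dim_lower(2,6)[of d eps] by (simp add: capacity_def)
qed

context
  fixes eps :: real and d :: nat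
  assumes eps01: "0 < eps" "eps < 1"
begin

lemma doublings_prog:
  assumes b: "fits d eps s" and N: "s reg_N = int (Suc d)" and l: "s reg_l = int (zeros d eps)"
  shows "halts d eps s doublings_prog (5 * dim d eps)
    (\<lambda>s'. agree {reg_q, reg_K} s s' \<and> s' reg_q = 4 ^ doublings d eps \<and> s' reg_K = 2 ^ doublings d eps)"
proof -
  define I where "I j s' \<longleftrightarrow> agree {reg_q, reg_K} s s' \<and> s' reg_q = 4 ^ Suc j \<and> s' reg_K = 2 ^ Suc j"
    for j s'
  let ?g = "Times (Less (Times (Reg reg_q) (Reg reg_l)) (Times (Const 48) (Reg reg_N)))
    (Minus (Const 1) (Eps_ge (Times (Const 48) (Reg reg_N)) (Plus (Reg reg_q) (Times (Const 48) (Reg reg_N)))))"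
  obtain n where n: "doublings d eps = Suc n" using doublings(1)[OF eps01, of d] by (cases "doublings d eps") auto
  have guard: "aval eps s1 ?g = 0 \<longleftrightarrow> sharp_enough d eps (Suc j)" if "I j s1" for j s1
  proof -
    have "s1 reg_N = int (Suc d)" "s1 reg_l = int (zeros d eps)" "s1 reg_q = 4 ^ Suc j"
      using that N l by (simp_all add: I_def agree_def)
    moreover have "48 * int (Suc d) \<le> 4 ^ Suc j * int (zeros d eps) \<longleftrightarrow> 48 * Suc d \<le> 4 ^ Suc j * zeros d eps"
      using of_nat_le_iff[of "48 * Suc d" "4 ^ Suc j * zeros d eps", where 'a = int] by simp
    ultimately show ?thesis by (simp add: sharp_enough_def del: power_Suc) linarith
  qed
  have "halts d eps s doublings_prog (Suc (Suc (Suc (n * Suc (Suc 1)))))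
    (\<lambda>s'. agree {reg_q, reg_K} s s' \<and> s' reg_q = 4 ^ doublings d eps \<and> s' reg_K = 2 ^ doublings d eps)"
    unfolding doublings_prog_def
    apply (rule terminates_seq_assign[where x = reg_q and v = 4], fact b, simp, simp, simp, rule small_const, simp)
    apply (rule terminates_seq_assign[where x = reg_K and v = 2], assumption, simp, simp, simp, rule small_const, simp)
    apply (rule terminates_While[where I = I], assumption, simp)
    subgoal by (simp add: I_def agree_def)
    subgoal premises p for j s1
    proof
      note j = p(3) and I = p(4) and b = p(5)
      show "aval eps s1 ?g \<noteq> 0"
        unfolding guard[OF I] using less_doublings[OF eps01, of "Suc j" d] j n by simp
      show "halts d eps s1 (Seq (Set_to reg_q (Times (Const 4) (Reg reg_q)))
            (Set_to reg_K (Times (Const 2) (Reg reg_K)))) (Suc 1) (I (Suc j))"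
        apply (rule terminates_seq_assign[where x = reg_q and v = "4 ^ Suc (Suc j)"], fact b,
            simp, use I in \<open>simp add: I_def\<close>, simp, rule capacity_power_4, use j n in simp)
        apply (rule terminates_assign[where x = reg_K and v = "2 ^ Suc (Suc j)"], assumption,
            simp, use I in \<open>simp add: I_def\<close>, simp, rule capacity_power_2[where m = 1],
            use j n deg_le_dim(3)[of d eps] in simp, simp)
        using I by (simp add: I_def agree_def)
    qed
    subgoal using guard[of n] doublings(2)[OF eps01, of d] n by simp
    subgoal by (auto simp: I_def n)
    done
  then show ?thesis using deg_le_dim(3)[of d eps] dim_lower(6)[of d eps] n by (rule_tac terminates_mono) auto
qed

lemma power_prog:
  assumes b: "fits d eps s" and l: "s reg_l = int (zeros d eps)" and K: "s reg_K = 2 ^ doublings d eps"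
  shows "halts d eps s power_prog (5 * dim d eps)
    (\<lambda>s'. agree {reg_k, reg_P, reg_i} s s' \<and> s' reg_k = int (deg d eps) \<and> s' reg_P = 2 ^ deg d eps)"
proof -
  define I where "I j s' \<longleftrightarrow> agree {reg_k, reg_P, reg_i} s s' \<and> s' reg_k = int (deg d eps) \<and>
      s' reg_P = 2 ^ j \<and> s' reg_i = int j"
    for j s'
  have "halts d eps s power_prog (Suc (Suc (Suc (Suc (deg d eps * Suc (Suc 1))))))
    (\<lambda>s'. agree {reg_k, reg_P, reg_i} s s' \<and> s' reg_k = int (deg d eps) \<and> s' reg_P = 2 ^ deg d eps)"
    unfolding power_prog_def
    apply (rule terminates_seq_assign[where x = reg_k and v = "int (deg d eps)"], fact b, simp,
        simp add: l K deg_def algebra_simps, simp, rule small_nat, rule deg_le_dim)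
    apply (rule terminates_seq_assign[where x = reg_P and v = 1], assumption, simp, simp, simp, rule small_const, simp)
    apply (rule terminates_seq_assign[where x = reg_i and v = 0], assumption, simp, simp, simp, rule small_const, simp)
    apply (rule terminates_While[where I = I], assumption, simp)
    subgoal by (simp add: I_def agree_def)
    subgoal premises p for j s1
    proof
      note j = p(4) and I = p(5) and b = p(6)
      show "aval eps s1 (Less (Reg reg_i) (Reg reg_k)) \<noteq> 0" using I j by (simp add: I_def)
      show "halts d eps s1 (Seq (Set_to reg_P (Times (Const 2) (Reg reg_P)))
            (Set_to reg_i (Plus (Reg reg_i) (Const 1)))) (Suc 1) (I (Suc j))"
        apply (rule terminates_seq_assign[where x = reg_P and v = "2 ^ Suc j"], fact b,
            simp, use I in \<open>simp add: I_def\<close>, simp, rule capacity_power_2[where m = 1],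
            use j deg_le_dim(1)[of d eps] in simp, simp)
        apply (rule terminates_assign[where x = reg_i and v = "int (Suc j)"], assumption,
            simp, use I in \<open>simp add: I_def\<close>, simp, rule small_nat,
            use j deg_le_dim(1)[of d eps] in simp)
        using I by (simp add: I_def agree_def)
    qed
    subgoal by (simp add: I_def)
    subgoal by (simp add: I_def)
    done
  then show ?thesis using deg_le_dim(1)[of d eps] dim_lower(6)[of d eps] by (rule_tac terminates_mono) auto
qed

lemma copy_prog:
  assumes b: "fits d eps s" and n: "s reg_n = int n" "n \<le> 2 ^ d" and d: "s reg_d = int d"
  shows "halts d eps s copy_prog (5 * n * dim d eps + 5)
    (\<lambda>s'. agree ({reg_i} \<union> cells 0) s s' \<and> (\<forall>j<2 * n * d. s' (arr 0 (int j)) = s (2 + int j)))"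
proof -
  define I where "I m s' \<longleftrightarrow> agree ({reg_i} \<union> cells 0) s s' \<and> s' reg_i = int m \<and>
      (\<forall>j<m. s' (arr 0 (int j)) = s (2 + int j))"
    for m s'
  have nd: "2 * n * d \<le> 2 * n * dim d eps" using dim_lower(2)[of d eps] by simp
  have "halts d eps s copy_prog (Suc (Suc (2 * n * d * Suc (Suc 1))))
    (\<lambda>s'. agree ({reg_i} \<union> cells 0) s s' \<and> (\<forall>j<2 * n * d. s' (arr 0 (int j)) = s (2 + int j)))"
    unfolding copy_prog_def
    apply (rule terminates_seq_assign[where x = reg_i and v = 0], fact b, simp, simp, simp, rule small_const, simp)
    apply (rule terminates_While[where I = I], assumption, simp)
    subgoal by (simp add: I_def agree_def)
    subgoal premises p for m s1
    proof
      note m = p(2) and I = p(3) and b = p(4)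
      have [simp]: "s1 reg_n = int n" "s1 reg_d = int d" "s1 (2 + int m) = s (2 + int m)" "s1 reg_i = int m"
        using I n d by (simp_all add: I_def agree_def)
      have "int m < int (2 * n * d)" using m by (simp only: of_nat_less_iff)
      then show "aval eps s1 (Less (Reg reg_i) (Times (Times (Const 2) (Reg reg_n)) (Reg reg_d))) \<noteq> 0" by simp
      show "halts d eps s1 (Seq (Assign (Arr 0 (Reg reg_i)) (Cell (Plus (Const 2) (Reg reg_i))))
            (Set_to reg_i (Plus (Reg reg_i) (Const 1)))) (Suc 1) (I (Suc m))"
        apply (rule terminates_seq_assign[where x = "arr 0 (int m)" and v = "s (2 + int m)"], fact b,
            simp, simp, simp, use assms(1) in \<open>simp add: bounded_mem_def\<close>)
        apply (rule terminates_assign[where x = reg_i and v = "int (Suc m)"], assumption,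
            simp, simp, simp, rule capacity_address[OF n(2)], use m nd in linarith)
        using I by (auto simp: I_def agree_def less_Suc_eq)
    qed
    subgoal premises p for s1
    proof -
      have "s1 reg_n = int n" "s1 reg_d = int d" "s1 reg_i = int (2 * n * d)"
        using p(2) n d by (simp_all add: I_def agree_def)
      then show ?thesis by simp
    qed
    subgoal by (simp add: I_def)
    done
  then show ?thesis
  proof (rule terminates_mono)
    have "2 * n * d * Suc (Suc 1) \<le> 6 * n * d" by simp
    moreover have "6 * n * d \<le> 5 * n * dim d eps"
    proof -
      have "6 * d \<le> 5 * (8 * Suc d)" by simp
      also have "8 * Suc d \<le> dim d eps"
      proof -
        have "40 * (1 * Suc d * 1) \<le> 40 * (2 ^ deg d eps * binom_le d (deg d eps) ^ 3 * 2 ^ (level eps + 1))"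
          using binom_deg_ge[of d eps] self_le_power[of "binom_le d (deg d eps)" 3]
          by (intro mult_le_mono) auto
        then show ?thesis by (simp add: dim_eq algebra_simps)
      qed
      finally have "6 * d \<le> 5 * dim d eps" by simp
      then have "n * (6 * d) \<le> n * (5 * dim d eps)" by (rule mult_le_mono2)
      then show ?thesis by (simp add: mult_ac)
    qed
    ultimately show "Suc (Suc (2 * n * d * Suc (Suc 1))) \<le> 5 * n * dim d eps + 5" by linarith
  qed
qed

lemma kernel_prog:
  assumes b: "fits d eps s" and N: "s reg_N = int (Suc d)" and q: "s reg_q = 4 ^ doublings d eps"
    and x: "s reg_x = int x" "x \<le> d"
  shows "halts d eps s kernel_prog (4 * doublings d eps + 4)
    (\<lambda>s'. agree {reg_R, reg_Q, reg_D} s s' \<and> s' reg_R = kernel d (doublings d eps) x)"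
proof -
  define I where "I i s' \<longleftrightarrow> agree {reg_R, reg_Q, reg_D} s s' \<and> s' reg_R = kernel d i x \<and>
      s' reg_Q = 4 ^ i \<and> s' reg_D = int (Suc d) ^ 2 ^ i"
    for i s'
  have "halts d eps s kernel_prog (Suc (Suc (Suc (Suc (doublings d eps * Suc (Suc (Suc 1)))))))
    (\<lambda>s'. agree {reg_R, reg_Q, reg_D} s s' \<and> s' reg_R = kernel d (doublings d eps) x)"
    unfolding kernel_prog_def
    apply (rule terminates_seq_assign[where x = reg_R and v = 1], fact b, simp, simp, simp, rule small_const, simp)
    apply (rule terminates_seq_assign[where x = reg_Q and v = 1], assumption, simp, simp, simp, rule small_const, simp)
    apply (rule terminates_seq_assign[where x = reg_D and v = "int (Suc d)"], assumption, simp, simp add: N, simp,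
        rule small_nat, rule dim_lower)
    apply (rule terminates_While[where I = I], assumption, simp)
    subgoal by (simp add: I_def agree_def)
    subgoal premises p for i s1
    proof
      note i = p(4) and I = p(5) and b = p(6)
      have [simp]: "s1 reg_q = 4 ^ doublings d eps" "s1 reg_x = int x" "s1 reg_R = kernel d i x"
        "s1 reg_Q = 4 ^ i" "s1 reg_D = int (Suc d) ^ 2 ^ i"
        using I q x by (simp_all add: I_def agree_def)
      show "aval eps s1 (Less (Reg reg_Q) (Reg reg_q)) \<noteq> 0" using i by simp
      show "halts d eps s1 (Seq (Set_to reg_R (Times (Reg reg_R) (Minus (Reg reg_D)
               (Times (Times (Minus (Reg reg_x) (Const 1)) (Reg reg_Q)) (Reg reg_R)))))
         (Seq (Set_to reg_D (Times (Reg reg_D) (Reg reg_D)))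
            (Set_to reg_Q (Times (Const 4) (Reg reg_Q))))) (Suc (Suc 1)) (I (Suc i))"
        apply (rule terminates_seq_assign[where x = reg_R and v = "kernel d (Suc i) x"], fact b,
            simp, simp, simp, rule capacity_kernel, use x in simp, use i in simp)
        apply (rule terminates_seq_assign[where x = reg_D and v = "int (Suc d) ^ 2 ^ Suc i"], assumption,
            simp, simp add: power_add[symmetric] mult_2, simp, rule capacity_kernel[where x = 0], simp, use i in simp)
        apply (rule terminates_assign[where x = reg_Q and v = "4 ^ Suc i"], assumption,
            simp, simp, simp, rule capacity_power_4, use i in simp)
        using I by (simp add: I_def agree_def)
    qed
    subgoal premises p for s1
    proof -
      have "s1 reg_q = 4 ^ doublings d eps" "s1 reg_Q = 4 ^ doublings d eps"
        using p(4) q by (simp_all add: I_def agree_def)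
      then show ?thesis by simp
    qed
    subgoal by (simp add: I_def)
    done
  then show ?thesis by (rule terminates_mono) auto
qed

lemma peak_prog:
  assumes b: "fits d eps s" and l: "s reg_l = int (zeros d eps)" and x: "s reg_x = int x" "x \<le> d"
    and R: "s reg_R = kernel d (doublings d eps) x"
  shows "halts d eps s peak_prog (3 * zeros d eps + 3)
    (\<lambda>s'. agree {reg_F, reg_j} s s' \<and> s' reg_F = peak d eps x)"
proof -
  define I where "I m s' \<longleftrightarrow> agree {reg_F, reg_j} s s' \<and> s' reg_F = partial_peak d eps m x \<and> s' reg_j = int m"
    for m s'
  have zd: "zeros d eps \<le> dim d eps" using deg_lower(2)[of d eps] deg_le_dim(1)[of d eps] by linarith
  have "halts d eps s peak_prog (Suc (Suc (Suc (zeros d eps * Suc (Suc 1)))))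
    (\<lambda>s'. agree {reg_F, reg_j} s s' \<and> s' reg_F = peak d eps x)"
    unfolding peak_prog_def
    apply (rule terminates_seq_assign[where x = reg_F and v = "kernel d (doublings d eps) x"], fact b, simp,
        simp add: R, simp, rule capacity_kernel, use x in simp, simp)
    apply (rule terminates_seq_assign[where x = reg_j and v = 0], assumption, simp, simp, simp, rule small_const, simp)
    apply (rule terminates_While[where I = I], assumption, simp)
    subgoal by (simp add: I_def agree_def partial_peak_def)
    subgoal premises p for m s1
    proof
      note m = p(3) and I = p(4) and b = p(5)
      have [simp]: "s1 reg_l = int (zeros d eps)" "s1 reg_x = int x" "s1 reg_R = kernel d (doublings d eps) x"
        "s1 reg_F = partial_peak d eps m x" "s1 reg_j = int m"
        using I l x R by (simp_all add: I_def agree_def)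
      show "aval eps s1 (Less (Reg reg_j) (Reg reg_l)) \<noteq> 0" using m by simp
      show "halts d eps s1 (Seq (Set_to reg_j (Plus (Reg reg_j) (Const 1)))
            (Set_to reg_F (Times (Reg reg_F) (Times (Minus (Reg reg_j) (Reg reg_x)) (Reg reg_R))))) (Suc 1) (I (Suc m))"
        apply (rule terminates_seq_assign[where x = reg_j and v = "int (Suc m)"], fact b,
            simp, simp, simp, rule small_nat, use m zd in simp)
        apply (rule terminates_assign[where x = reg_F and v = "partial_peak d eps (Suc m) x"], assumption,
            simp, simp add: partial_peak_Suc, simp, rule capacity_partial_peak, use x in simp, use m in simp)
        using I by (simp add: I_def agree_def)
    qed
    subgoal using l by (simp add: I_def agree_def)
    subgoal by (simp add: I_def peak_def partial_peak_def)
    done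
  then show ?thesis by (rule terminates_mono) auto
qed

lemma table_prog:
  assumes b: "fits d eps s" and N: "s reg_N = int (Suc d)" and q: "s reg_q = 4 ^ doublings d eps"
    and l: "s reg_l = int (zeros d eps)"
  shows "halts d eps s table_prog (20 * dim d eps)
    (\<lambda>s'. agree ({reg_x, reg_R, reg_Q, reg_D, reg_F, reg_j} \<union> cells 3) s s' \<and>
      (\<forall>y\<le>d. s' (arr 3 (int y)) = peak d eps y))"
proof -
  let ?X = "{reg_x, reg_R, reg_Q, reg_D, reg_F, reg_j} \<union> cells 3"
  define I where "I x s' \<longleftrightarrow> agree ?X s s' \<and> s' reg_x = int x \<and> (\<forall>y<x. s' (arr 3 (int y)) = peak d eps y)"
    for x s'
  let ?t = "4 * doublings d eps + 4 + (3 * zeros d eps + 3 + Suc 1)"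
  have "halts d eps s table_prog (Suc (Suc (Suc d * Suc ?t)))
    (\<lambda>s'. agree ?X s s' \<and> (\<forall>y\<le>d. s' (arr 3 (int y)) = peak d eps y))"
    unfolding table_prog_def
    apply (rule terminates_seq_assign[where x = reg_x and v = 0], fact b, simp, simp, simp, rule small_const, simp)
    apply (rule terminates_While[where I = I], assumption, simp)
    subgoal by (simp add: I_def agree_def)
    subgoal premises p for x s1
    proof
      note x = p(2) and I = p(3) and b = p(4)
      have s1: "s1 reg_l = int (zeros d eps)" "s1 reg_N = int (Suc d)" "s1 reg_q = 4 ^ doublings d eps"
         "s1 reg_x = int x"
        using I l N q by (simp_all add: I_def agree_def)
      show "aval eps s1 (Less (Reg reg_x) (Reg reg_N)) \<noteq> 0" using x s1 by simp
      show "halts d eps s1 (Seq kernel_prog (Seq peak_prog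
       (Seq (Assign (Arr 3 (Reg reg_x)) (Reg reg_F))
            (Set_to reg_x (Plus (Reg reg_x) (Const 1)))))) ?t (I (Suc x))"
      proof (rule terminates_seq[OF kernel_prog[OF b s1(2,3,4)]])
        show "x \<le> d" using x by simp
        fix s2 assume b2: "fits d eps s2"
          and 2: "agree {reg_R, reg_Q, reg_D} s1 s2 \<and> s2 reg_R = kernel d (doublings d eps) x"
        have s2: "s2 reg_l = int (zeros d eps)" "s2 reg_x = int x"
          using 2 s1 by (simp_all add: agree_def)
        show "halts d eps s2 (Seq peak_prog (Seq (Assign (Arr 3 (Reg reg_x)) (Reg reg_F))
            (Set_to reg_x (Plus (Reg reg_x) (Const 1))))) (3 * zeros d eps + 3 + Suc 1) (I (Suc x))"
        proof (rule terminates_seq[OF peak_prog[OF b2 s2]])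
          show "x \<le> d" using x by simp
          show "s2 reg_R = kernel d (doublings d eps) x" using 2 by simp
          fix s3 assume b3: "fits d eps s3" and 3: "agree {reg_F, reg_j} s2 s3 \<and> s3 reg_F = peak d eps x"
          have s3: "s3 reg_F = peak d eps x" "s3 reg_x = int x" using 3 s2 by (simp_all add: agree_def)
          have a: "agree ?X s s3" using I 2 3 by (auto simp: I_def agree_def)
          have t: "\<forall>y<x. s3 (arr 3 (int y)) = peak d eps y" using I 2 3 by (auto simp: I_def agree_def)
          show "halts d eps s3 (Seq (Assign (Arr 3 (Reg reg_x)) (Reg reg_F))
            (Set_to reg_x (Plus (Reg reg_x) (Const 1)))) (Suc 1) (I (Suc x))"
            apply (rule terminates_seq_assign[where x = "arr 3 (int x)" and v = "peak d eps x"], fact b3,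
                simp add: s3, simp add: s3, simp, use capacity_diff[of x 0 d eps] x in simp)
            apply (rule terminates_assign[where x = reg_x and v = "int (Suc x)"], assumption,
                simp, simp add: s3, simp, rule small_nat, use x dim_lower(2)[of d eps] in linarith)
            using a t by (auto simp: I_def less_Suc_eq intro!: agree_upd)
        qed
      qed
    qed
    subgoal using N by (simp add: I_def agree_def)
    subgoal by (simp add: I_def less_Suc_eq_le)
    done
  then show ?thesis
  proof (rule terminates_mono)
    have 1: "Suc d * doublings d eps \<le> Suc d * deg d eps" "Suc d * zeros d eps \<le> Suc d * deg d eps"
      using deg_lower by (intro mult_le_mono2; simp)+
    have 2: "Suc d * deg d eps \<le> dim d eps" using dim_lower(1)[of d eps] by (simp only: mult.commute)
    have 3: "Suc d * Suc ?t = 4 * (Suc d * doublings d eps) + 3 * (Suc d * zeros d eps) + 10 * Suc d"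
      by (simp add: algebra_simps)
    have "Suc (Suc z) \<le> 20 * D"
      if "x \<le> c" "y \<le> c" "c \<le> D" "z = 4 * x + 3 * y + 10 * e" "e \<le> D" "40 \<le> D" for x y c D z e :: nat
      using that by linarith
    from this[OF 1 2 3 dim_lower(2,6)] show "Suc (Suc (Suc d * Suc ?t)) \<le> 20 * dim d eps" .
  qed auto
qed

lemma difference_prog:
  assumes b: "fits d eps s" and N: "s reg_N = int (Suc d)" and d: "s reg_d = int d"
    and F: "\<forall>y\<le>d. s (arr 3 (int y)) = peak d eps y"
  shows "halts d eps s difference_prog (10 * dim d eps)
    (\<lambda>s'. agree ({reg_x, reg_j} \<union> cells 3) s s' \<and> (\<forall>y\<le>d. s' (arr 3 (int y)) = coef d eps y))"
proof -
  let ?X = "{reg_x, reg_j} \<union> cells 3"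
  \<comment> \<open>After \<open>j\<close> rounds the entries up to index \<open>j\<close> are
    final, as they hold differences at 0; all later entries have order \<open>j\<close>.\<close>
  define tab where "tab j y = (diff ^^ min j y) (peak d eps) (y - min j y)" for j y
  define I where "I i s' \<longleftrightarrow> agree ?X s s' \<and> s' reg_j = int (Suc i) \<and> (\<forall>y\<le>d. s' (arr 3 (int y)) = tab i y)"
    for i s'
  have small: "\<bar>tab j y\<bar> < 2 ^ capacity d eps" if "y \<le> d" for j y
    unfolding tab_def by (rule capacity_diff) (use that in auto)
  \<comment> \<open>Inside round \<open>i\<close> the top \<open>m\<close> entries have already been
    raised to the next order.\<close>
  define J where "J i m s' \<longleftrightarrow> agree ?X s s' \<and> s' reg_j = int (Suc i) \<and> s' reg_x = int d - int m \<and>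
      (\<forall>y\<le>d. s' (arr 3 (int y)) = (if y > d - m then tab (Suc i) y else tab i y))"
    for i m s'
  have "halts d eps s difference_prog (Suc (Suc (d * Suc (Suc (Suc (d * Suc (Suc 1)) + 1)))))
    (\<lambda>s'. agree ?X s s' \<and> (\<forall>y\<le>d. s' (arr 3 (int y)) = coef d eps y))"
    unfolding difference_prog_def
    apply (rule terminates_seq_assign[where x = reg_j and v = 1], fact b, simp, simp, simp, rule small_const, simp)
    apply (rule terminates_While[where I = I], assumption, simp)
    subgoal using F by (simp add: I_def agree_def tab_def)
    subgoal premises p for i s1
    proof
      note i = p(2) and I = p(3) and b = p(4)
      have s1: "s1 reg_N = int (Suc d)" "s1 reg_d = int d" "s1 reg_j = int (Suc i)"
        using I N d by (simp_all add: I_def agree_def)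
      show "aval eps s1 (Less (Reg reg_j) (Reg reg_N)) \<noteq> 0" using i s1 by simp
      show "halts d eps s1
       (Seq (Set_to reg_x (Reg reg_d))
       (Seq (While (Less (Minus (Reg reg_j) (Const 1)) (Reg reg_x))
               (Seq (Assign (Arr 3 (Reg reg_x))
                      (Minus (Cell (Arr 3 (Reg reg_x))) (Cell (Arr 3 (Minus (Reg reg_x) (Const 1))))))
                    (Set_to reg_x (Minus (Reg reg_x) (Const 1)))))
            (Set_to reg_j (Plus (Reg reg_j) (Const 1)))))
       (Suc (Suc (d * Suc (Suc 1)) + 1)) (I (Suc i))"
        apply (rule terminates_seq_assign[where x = reg_x and v = "int d"], fact b, simp, simp add: s1, simp,
            rule small_nat, use dim_lower(2)[of d eps] in simp)
        apply (rule terminates_seq[where R = "J i (d - i)"])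
        apply (rule terminates_mono[where Q = "J i (d - i)"])
        apply (rule terminates_While[where I = "J i" and n = "d - i" and t = "Suc 1"], assumption, simp)
        subgoal using I by (auto simp: I_def J_def agree_def)
        subgoal premises q for m s2
        proof
          note m = q(2) and J = q(3) and b = q(4)
          obtain x where x: "x \<le> d" "i < x" "d - m = x" "d - Suc m = x - 1"
            "int d - int m = int x" "int d - int (Suc m) = int x - 1"
            using m i by (intro that[of "d - m"]) auto
          have s2: "s2 reg_j = int (Suc i)" "s2 reg_x = int x" "agree ?X s s2"
            "\<forall>y\<le>d. s2 (arr 3 (int y)) = (if y > x then tab (Suc i) y else tab i y)"
            using J unfolding J_def x by auto
          have x1: "int x - 1 = int (x - 1)" using x by simp
          have "s2 (arr 3 (int x)) = tab i x" "s2 (arr 3 (int (x - 1))) = tab i (x - 1)"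
          proof -
            have "\<not> x < x - 1" "x - 1 \<le> d" using x(1) by auto
            from s2(4)[rule_format, OF this(2)] this(1)
            show "s2 (arr 3 (int (x - 1))) = tab i (x - 1)" by (simp only: if_False)
            from s2(4)[rule_format, OF x(1)] show "s2 (arr 3 (int x)) = tab i x" by (simp only: less_irrefl if_False)
          qed
          moreover have "tab i x - tab i (x - 1) = tab (Suc i) x"
          proof -
            have "min i x = i" "min i (x - 1) = i" "min (Suc i) x = Suc i"
              "x - i = Suc (x - Suc i)" "x - 1 - i = x - Suc i" using x by auto
            then show ?thesis by (simp only: tab_def diff_funpow_Suc)
          qed
          ultimately have new: "s2 (arr 3 (int x)) - s2 (arr 3 (int (x - 1))) = tab (Suc i) x" by simp
          show "aval eps s2 (Less (Minus (Reg reg_j) (Const 1)) (Reg reg_x)) \<noteq> 0" using s2 x by simp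
          show "halts d eps s2 (Seq (Assign (Arr 3 (Reg reg_x))
                      (Minus (Cell (Arr 3 (Reg reg_x))) (Cell (Arr 3 (Minus (Reg reg_x) (Const 1))))))
                    (Set_to reg_x (Minus (Reg reg_x) (Const 1)))) (Suc 1) (J i (Suc m))"
            apply (rule terminates_seq_assign[where x = "arr 3 (int x)" and v = "tab (Suc i) x"], fact b,
                simp add: s2, simp only: aval.simps aval_Arr s2(1,2) x1 new, simp, rule small[OF x(1)])
            apply (rule terminates_assign[where x = reg_x and v = "int x - 1"], assumption,
                simp, simp add: s2, simp, unfold x1, rule small_nat,
                use x(1) dim_lower(2)[of d eps] in linarith)
            unfolding J_def x(4,6) using s2 x(1,2) by (auto intro!: agree_upd)
        qed
        subgoal using i by (simp add: J_def)
        subgoal by assumption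
        apply simp
        apply assumption
        apply (rule terminates_assign[where x = reg_j and v = "int (Suc (Suc i))"], assumption,
            simp, simp add: J_def, simp, rule small_nat, use i dim_lower(2)[of d eps] in linarith)
        subgoal premises q for s2 using q(3) i by (auto simp: I_def J_def agree_def tab_def min_def)
        done
    qed
    subgoal using N by (simp add: I_def agree_def)
    subgoal by (simp add: I_def tab_def coef_def min_def)
    done
  then show ?thesis
  proof (rule terminates_mono)
    have "d * Suc (Suc (Suc (d * Suc (Suc 1)) + 1)) \<le> Suc d * (5 * Suc d)"
      by (intro mult_le_mono) auto
    also have "\<dots> = 5 * (Suc d * Suc d)" by (rule mult.left_commute)
    also have "\<dots> \<le> 5 * dim d eps" using dim_lower(9)[of d eps] by (rule mult_le_mono2)
    finally show "Suc (Suc (d * Suc (Suc (Suc (d * Suc (Suc 1)) + 1)))) \<le> 10 * dim d eps"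
      using dim_lower(6)[of d eps] by linarith
  qed
qed

end

section \<open>Evaluating all monomials of one vector\<close>

definition subset_step :: com where
  "subset_step =
     Seq (Cond (Less (Cell (Arr 2 (Reg reg_t))) (Reg reg_k))
           (Seq (Assign (Arr 1 (Reg reg_len)) (Times (Cell (Arr 1 (Reg reg_t))) (Cell (Arr 0 (Reg reg_in)))))
           (Seq (Assign (Arr 2 (Reg reg_len)) (Plus (Cell (Arr 2 (Reg reg_t))) (Const 1)))
                (Set_to reg_len (Plus (Reg reg_len) (Const 1)))))
           Skip)
         (Set_to reg_t (Plus (Reg reg_t) (Const 1)))"

definition subset_prog :: com where
  "subset_prog =
     Seq (Set_to reg_len (Const 1)) (Seq (Assign (Arr 1 (Const 0)) (Const 1))
    (Seq (Assign (Arr 2 (Const 0)) (Const 0)) (Seq (Set_to reg_j (Const 0))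
    (While (Less (Reg reg_j) (Reg reg_d))
       (Seq (Set_to reg_old (Reg reg_len)) (Seq (Set_to reg_t (Const 0))
       (Seq (While (Less (Reg reg_t) (Reg reg_old)) subset_step)
       (Seq (Set_to reg_in (Plus (Reg reg_in) (Const 1)))
            (Set_to reg_j (Plus (Reg reg_j) (Const 1)))))))))))"

text \<open>Memory holds only the value and the size of each subset, never its elements; the size
  determines both the cutoff and the coefficient.\<close>

definition tabulates :: "int list \<Rightarrow> nat list list \<Rightarrow> memory \<Rightarrow> bool" where
  "tabulates v L s \<longleftrightarrow> s reg_len = int (length L) \<and>
     (\<forall>t<length L. s (arr 1 (int t)) = monomial v (L ! t) \<and> s (arr 2 (int t)) = int (length (L ! t)))"

lemma tabulates_append:
  assumes "tabulates v L s" "a = monomial v S" "c = int (length S)"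
  shows "tabulates v (L @ [S])
    (s(arr 1 (int (length L)) := a, arr 2 (int (length L)) := c, reg_len := int (Suc (length L))))"
  using assms by (auto simp: tabulates_def nth_append less_Suc_eq)

abbreviation (input) subset_regs :: "int set" where
  "subset_regs \<equiv> {reg_len, reg_old, reg_t, reg_j, reg_in} \<union> cells 1 \<union> cells 2"

text \<open>The list after \<open>t\<close> of the old entries have been treated. For
  \<open>L = subs k j\<close> and \<open>t = length L\<close> it is
  \<open>subs k (Suc j)\<close>.\<close>

definition extend :: "nat \<Rightarrow> nat list list \<Rightarrow> nat \<Rightarrow> nat \<Rightarrow> nat list list" where
  "extend k L j t = L @ map ((#) j) (filter (\<lambda>S. length S < k) (take t L))"

lemma extend_Suc:
  "t < length L \<Longrightarrow> extend k L j (Suc t) = extend k L j t @ (if length (L ! t) < k then [j # L ! t] else [])"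
  by (simp add: extend_def take_Suc_conv_app_nth)

lemma extend_nth: "t < length L \<Longrightarrow> extend k L j i ! t = L ! t"
  by (simp add: extend_def nth_append)

lemma length_extend: "length L \<le> length (extend k L j t)" "length (extend k (subs k j) j t) \<le> length (subs k (Suc j))"
proof -
  have "filter P L = filter P (take t L) @ filter P (drop t L)" for P and L :: "nat list list"
    by (simp flip: filter_append)
  then have "length (filter P (take t L)) \<le> length (filter P L)" for P and L :: "nat list list"
    by (metis length_append le_add1)
  then show "length (extend k (subs k j) j t) \<le> length (subs k (Suc j))" by (simp add: extend_def)
qed (simp add: extend_def)

context
  fixes eps :: real and d :: nat
  assumes eps01: "0 < eps" "eps < 1"
begin

lemma subset_step:
  fixes v :: "int list"
  defines "L \<equiv> subs (deg d eps)"
  assumes b: "fits d eps s" and v: "length v = d" "set v \<subseteq> {0, 1}"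
    and jt: "j < d" "t < length (L j)"
    and s: "s reg_k = int (deg d eps)" "s (arr 0 (int i)) = v ! j" "s reg_in = int i" "s reg_t = int t"
    and tab: "tabulates v (extend (deg d eps) (L j) j t) s"
  shows "halts d eps s subset_step 5
    (\<lambda>s'. agree ({reg_len, reg_t} \<union> cells 1 \<union> cells 2) s s' \<and> s' reg_t = int (Suc t) \<and>
      tabulates v (extend (deg d eps) (L j) j (Suc t)) s')"
proof -
  define M where "M = extend (deg d eps) (L j) j t"
  define S where "S = L j ! t"
  \<comment> \<open>New products are appended at the end, so entry \<open>t\<close> is still the old
    subset.\<close>
  have ltS: "t < length M" "M ! t = S"
    using jt(2) length_extend(1)[of "L j" "deg d eps" j t] extend_nth[OF jt(2)] by (auto simp: M_def S_def)
  have inS: "S \<in> set (subs (deg d eps) j)" using jt(2) by (simp add: S_def L_def)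
  have sS: "length S \<le> deg d eps" "set S \<subseteq> {..<j}" using subs_bounds[OF inS] by auto
  have mem: "s reg_len = int (length M)" "s (arr 1 (int t)) = monomial v S" "s (arr 2 (int t)) = int (length S)"
    using tab ltS unfolding M_def[symmetric] by (auto simp: tabulates_def)
  have lens: "length (extend (deg d eps) (L j) j t') \<le> dim d eps" for t'
    using length_extend(2)[of "deg d eps" j t'] binom_le_mono[of "Suc j" d "deg d eps"] jt(1) dim_lower(8)[of d eps]
    unfolding L_def length_subs by linarith
  have mono: "monomial v (j # S) = monomial v S * v ! j" by (simp add: monomial_def)
  have "monomial v (j # S) \<in> {0, 1}" using sS jt(1) v by (intro monomial_01) auto
  then have mono_small: "\<bar>monomial v (j # S)\<bar> < 2 ^ capacity d eps" by (intro small_const) auto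
  have advance: "halts d eps s' (Set_to reg_t (Plus (Reg reg_t) (Const 1))) 1
     (\<lambda>s'. agree ({reg_len, reg_t} \<union> cells 1 \<union> cells 2) s s' \<and> s' reg_t = int (Suc t) \<and>
      tabulates v (extend (deg d eps) (L j) j (Suc t)) s')"
    if b: "fits d eps s'" and a: "agree ({reg_len} \<union> cells 1 \<union> cells 2) s s'"
      and tab: "tabulates v (extend (deg d eps) (L j) j (Suc t)) s'" for s'
  proof -
    have t: "s' reg_t = int t" using a s by (simp add: agree_def)
    show ?thesis
      apply (rule terminates_assign[where x = reg_t and v = "int (Suc t)"], fact b, simp, simp add: t, simp,
          rule small_nat, use jt(2) lens[of t] ltS length_extend(1)[of "L j" "deg d eps" j t] in linarith)
      using a tab by (auto simp: agree_def tabulates_def)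
  qed
  have "halts d eps s subset_step (Suc (Suc (Suc 1)) + 1)
    (\<lambda>s'. agree ({reg_len, reg_t} \<union> cells 1 \<union> cells 2) s s' \<and> s' reg_t = int (Suc t) \<and>
      tabulates v (extend (deg d eps) (L j) j (Suc t)) s')"
    unfolding subset_step_def
  proof (rule terminates_seq[where R = "\<lambda>s'. agree ({reg_len} \<union> cells 1 \<union> cells 2) s s' \<and>
      tabulates v (extend (deg d eps) (L j) j (Suc t)) s'"], rule terminates_Cond[OF b])
    assume "aval eps s (Less (Cell (Arr 2 (Reg reg_t))) (Reg reg_k)) \<noteq> 0"
    then have less: "length S < deg d eps" using s mem by (simp split: if_splits)
    then have ext: "extend (deg d eps) (L j) j (Suc t) = M @ [j # S]"
      using extend_Suc[OF jt(2)] by (simp add: M_def S_def)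
    have lM: "length M < dim d eps" using lens[of "Suc t"] unfolding ext by simp
    show "halts d eps s (Seq (Assign (Arr 1 (Reg reg_len)) (Times (Cell (Arr 1 (Reg reg_t))) (Cell (Arr 0 (Reg reg_in)))))
           (Seq (Assign (Arr 2 (Reg reg_len)) (Plus (Cell (Arr 2 (Reg reg_t))) (Const 1)))
                (Set_to reg_len (Plus (Reg reg_len) (Const 1))))) (Suc (Suc 1))
      (\<lambda>s'. agree ({reg_len} \<union> cells 1 \<union> cells 2) s s' \<and> tabulates v (extend (deg d eps) (L j) j (Suc t)) s')"
      apply (rule terminates_seq_assign[where x = "arr 1 (int (length M))" and v = "monomial v (j # S)"], fact b,
          simp add: mem, simp add: mem s mono, simp, rule mono_small)
      apply (rule terminates_seq_assign[where x = "arr 2 (int (length M))" and v = "int (Suc (length S))"], assumption,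
          simp add: mem, simp add: mem s, simp, rule small_nat, use less deg_le_dim(1)[of d eps] in linarith)
      apply (rule terminates_assign[where x = reg_len and v = "int (Suc (length M))"], assumption,
          simp, simp add: mem, simp, rule small_nat, use lM in linarith)
      unfolding ext
      apply (rule conjI)
      subgoal by (auto intro!: agree_upd agree_refl)
      subgoal by (rule tabulates_append) (use tab in \<open>simp_all add: M_def\<close>)
      done
  next
    assume "aval eps s (Less (Cell (Arr 2 (Reg reg_t))) (Reg reg_k)) = 0"
    then have "\<not> length S < deg d eps" using s mem by (simp split: if_splits)
    then have ext: "extend (deg d eps) (L j) j (Suc t) = M"
      using extend_Suc[OF jt(2)] by (simp add: M_def S_def)
    show "halts d eps s Skip (Suc (Suc 1))
      (\<lambda>s'. agree ({reg_len} \<union> cells 1 \<union> cells 2) s s' \<and> tabulates v (extend (deg d eps) (L j) j (Suc t)) s')"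
      by (rule terminates_mono[OF terminates_Skip[OF b, where Q = "\<lambda>s'. s' = s"]])
        (use tab in \<open>auto simp: ext M_def agree_refl\<close>)
  qed (use advance in auto)
  then show ?thesis by (rule terminates_mono) auto
qed

text \<open>\<open>reg_in\<close> advances by \<open>d\<close> and is not reset, so that consecutive
  runs read consecutive input vectors. The \<open>d * B\<close> inner rounds fit into the
  dimension.\<close>

lemma subset_prog:
  assumes b: "fits d eps s" and v: "length v = d" "set v \<subseteq> {0, 1}"
    and s: "s reg_k = int (deg d eps)" "s reg_d = int d" "s reg_in = int i"
      "\<And>j. j < d \<Longrightarrow> s (arr 0 (int (i + j))) = v ! j"
    and i: "int (i + d) < 2 ^ capacity d eps"
  shows "halts d eps s subset_prog (13 * dim d eps)
    (\<lambda>s'. agree subset_regs s s' \<and> s' reg_in = int (i + d) \<and> tabulates v (subs (deg d eps) d) s')"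
proof -
  define k L where "k = deg d eps" "L = subs (deg d eps)"
  note defs = this
  define B where "B = binom_le d k"
  have LB: "length (L j) \<le> B" if "j \<le> d" for j
    using binom_le_mono[OF that] by (simp add: defs B_def length_subs)
  have BD: "B \<le> dim d eps" using dim_lower(8)[of d eps] by (simp add: B_def defs)
  define I where "I j s' \<longleftrightarrow> agree subset_regs s s' \<and> s' reg_j = int j \<and> s' reg_in = int (i + j) \<and> tabulates v (L j) s'"
    for j s'
  define J where "J j t s' \<longleftrightarrow> agree subset_regs s s' \<and> s' reg_j = int j \<and> s' reg_in = int (i + j) \<and>
      s' reg_old = int (length (L j)) \<and> s' reg_t = int t \<and> tabulates v (extend k (L j) j t) s'"
    for j t s'
  have "halts d eps s subset_prog
     (Suc (Suc (Suc (Suc (Suc (d * Suc (Suc (Suc (Suc (B * Suc 5) + Suc 1)))))))))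
    (\<lambda>s'. agree subset_regs s s' \<and> s' reg_in = int (i + d) \<and> tabulates v (subs (deg d eps) d) s')"
    unfolding subset_prog_def
    apply (rule terminates_seq_assign[where x = reg_len and v = 1], fact b, simp, simp, simp, rule small_const, simp)
    apply (rule terminates_seq_assign[where x = "arr 1 0" and v = 1], assumption, simp, simp, simp, rule small_const, simp)
    apply (rule terminates_seq_assign[where x = "arr 2 0" and v = 0], assumption, simp, simp, simp, rule small_const, simp)
    apply (rule terminates_seq_assign[where x = reg_j and v = 0], assumption, simp, simp, simp, rule small_const, simp)
    apply (rule terminates_While[where I = I], assumption, simp)
    subgoal using s by (auto simp: I_def defs tabulates_def monomial_def intro!: agree_upd agree_refl)
    subgoal premises p for j s1
    proof
      note j = p(5) and I = p(6) and b = p(7)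
      have s1: "s1 reg_d = int d" "s1 reg_j = int j" "s1 reg_len = int (length (L j))"
        using I s by (simp_all add: I_def agree_def tabulates_def)
      show "aval eps s1 (Less (Reg reg_j) (Reg reg_d)) \<noteq> 0" using j s1 by simp
      show "halts d eps s1
        (Seq (Set_to reg_old (Reg reg_len)) (Seq (Set_to reg_t (Const 0))
       (Seq (While (Less (Reg reg_t) (Reg reg_old)) subset_step)
       (Seq (Set_to reg_in (Plus (Reg reg_in) (Const 1)))
            (Set_to reg_j (Plus (Reg reg_j) (Const 1)))))))
        (Suc (Suc (Suc (B * Suc 5) + Suc 1))) (I (Suc j))"
        apply (rule terminates_seq_assign[where x = reg_old and v = "int (length (L j))"], fact b, simp, simp add: s1, simp,
            rule small_nat, use LB[of j] BD j in linarith)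
        apply (rule terminates_seq_assign[where x = reg_t and v = 0], assumption, simp, simp, simp, rule small_const, simp)
        apply (rule terminates_seq[where R = "J j (length (L j))"])
        apply (rule terminates_mono[where Q = "J j (length (L j))"])
        apply (rule terminates_While[where I = "J j" and n = "length (L j)" and t = 5], assumption, simp)
        subgoal using I by (auto simp: I_def J_def extend_def tabulates_def intro!: agree_upd)
        subgoal premises q for r s2
        proof
          note r = q(3) and J = q(4) and b = q(5)
          show "aval eps s2 (Less (Reg reg_t) (Reg reg_old)) \<noteq> 0" using r J by (simp add: J_def)
          have s2: "s2 reg_k = int (deg d eps)" "s2 (arr 0 (int (i + j))) = v ! j"
            using J s(1) s(4)[OF j] by (simp_all add: J_def agree_def)
          show "halts d eps s2 subset_step 5 (J j (Suc r))"
          proof (rule terminates_mono[OF subset_step[OF b v j _ s2]])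
            show "r < length (subs (deg d eps) j)" using r by (simp add: defs)
            show "s2 reg_in = int (i + j)" "s2 reg_t = int r"
              "tabulates v (extend (deg d eps) (subs (deg d eps) j) j r) s2"
              using J by (simp_all add: J_def defs)
          qed (use J in \<open>auto simp: J_def defs agree_def\<close>)
        qed
        subgoal by (simp add: J_def)
        subgoal by assumption
        subgoal using LB[of j] j by simp
        subgoal by assumption
        subgoal premises q for s2
        proof -
          have i2: "\<bar>int (i + Suc j)\<bar> < 2 ^ capacity d eps" using i j by simp
          show ?thesis
            apply (rule terminates_seq_assign[where x = reg_in and v = "int (i + Suc j)"], rule q(3), simp,
                use q(4) in \<open>simp add: J_def\<close>, simp, rule i2)
            apply (rule terminates_assign[where x = reg_j and v = "int (Suc j)"], assumption, simp,
                use q(4) in \<open>simp add: J_def\<close>, simp, rule small_nat, use j dim_lower(2)[of d eps] in linarith)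
            using q(4) by (auto simp: I_def J_def extend_def defs tabulates_def intro!: agree_upd)
        qed
        done
    qed
    subgoal using s by (simp add: I_def agree_def)
    subgoal by (simp add: I_def defs)
    done
  then show ?thesis
  proof (rule terminates_mono)
    have "d * B \<le> B * Suc d" by (simp add: mult.commute)
    also have "\<dots> \<le> dim d eps" using dim_lower(5)[of d eps] by (simp add: B_def defs)
    finally have 1: "d * B \<le> dim d eps" .
    have 2: "d * Suc (Suc (Suc (Suc (B * Suc 5) + Suc 1))) = 6 * (d * B) + 6 * d" by (simp add: algebra_simps)
    show "Suc (Suc (Suc (Suc (Suc (d * Suc (Suc (Suc (Suc (B * Suc 5) + Suc 1)))))))) \<le> 13 * dim d eps"
      unfolding 2 using 1 dim_lower(2,6)[of d eps] by linarith
  qed auto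
qed

end

section \<open>Writing the vectors of the new instance\<close>

definition emit_entry :: com where
  "emit_entry =
     Cond (Less (Reg reg_vec) (Reg reg_n))
            (Assign (Reg reg_out) (Plus (Const 1) (Times (Less (Const 1) (Reg reg_g)) (Minus (Reg reg_y) (Const 1)))))
            (Seq (Set_to reg_p
                   (Div (Plus (Times (Reg reg_V) (Cell (Arr 3 (Cell (Arr 2 (Reg reg_t))))))
                              (Times (Reg reg_W) (Cell (Arr 3 (Const 0)))))
                        (Times (Const 2) (Cell (Arr 3 (Const 0))))))
                 (Assign (Reg reg_out)
                   (Times (Minus (Times (Const 2) (Less (Reg reg_r) (Reg reg_p))) (Const 1))
                          (Plus (Const 1) (Times (Minus (Reg reg_g) (Times (Const 2) (Div (Reg reg_g) (Const 2))))
                                                 (Minus (Reg reg_y) (Const 1)))))))"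

definition emit_step :: com where
  "emit_step =
     Seq (Set_to reg_t (Div (Reg reg_i) (Times (Const 4) (Reg reg_W))))
    (Seq (Set_to reg_r (Minus (Div (Reg reg_i) (Const 4)) (Times (Reg reg_t) (Reg reg_W))))
    (Seq (Set_to reg_g (Minus (Reg reg_i) (Times (Const 4) (Div (Reg reg_i) (Const 4)))))
    (Seq (Set_to reg_y (Minus (Times (Const 2) (Cell (Arr 1 (Reg reg_t)))) (Const 1)))
    (Seq emit_entry
    (Seq (Set_to reg_out (Plus (Reg reg_out) (Const 1)))
         (Set_to reg_i (Plus (Reg reg_i) (Const 1))))))))"

text \<open>After \<open>subset_prog\<close> the register \<open>reg_len\<close> contains
  \<open>binom_le d (deg d eps)\<close>; counting the subsets replaces a computation of binomial
  coefficients.\<close>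

definition emit_prog :: com where
  "emit_prog =
     Seq (Set_to reg_V (Times (Times (Times (Const 10) (Reg reg_len)) (Reg reg_len)) (Reg reg_E)))
    (Seq (Set_to reg_W (Times (Reg reg_P) (Reg reg_V)))
    (Seq (Set_to reg_dim (Times (Times (Const 4) (Reg reg_len)) (Reg reg_W)))
    (Seq (Set_to 1 (Reg reg_dim))
    (Seq (Set_to reg_i (Const 0))
    (While (Less (Reg reg_i) (Reg reg_dim)) emit_step)))))"

definition main_prog :: com where
  "main_prog =
     Seq (Set_to reg_vec (Const 0)) (Seq (Set_to reg_out (Const 2)) (Seq (Set_to reg_in (Const 0))
    (While (Less (Reg reg_vec) (Times (Const 2) (Reg reg_n)))
       (Seq subset_prog (Seq emit_prog (Set_to reg_vec (Plus (Reg reg_vec) (Const 1))))))))"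

definition reduction_prog :: com where
  "reduction_prog =
     Seq (Set_to reg_n (Cell (Const 0))) (Seq (Set_to reg_d (Cell (Const 1)))
    (Seq (Set_to reg_N (Plus (Reg reg_d) (Const 1)))
    (Seq copy_prog (Seq level_prog (Seq doublings_prog (Seq power_prog
    (Seq table_prog (Seq difference_prog main_prog))))))))"

definition entry :: "nat \<Rightarrow> real \<Rightarrow> nat \<Rightarrow> nat \<Rightarrow> int list \<Rightarrow> nat \<Rightarrow> int" where
  "entry d eps n u v i = (if u < n then entry_left d eps v i else entry_right d eps v i)"

abbreviation (input) step_regs :: "int set" where
  "step_regs \<equiv> {reg_t, reg_r, reg_g, reg_y, reg_p, reg_out, reg_i}"

context
  fixes eps :: real and d :: nat
  assumes eps01: "0 < eps" "eps < 1"
begin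

text \<open>For a bit \<open>c\<close>, the term \<open>1 + c * (y - 1)\<close> selects between 1
  and \<open>y\<close>. Of the division behind \<open>positives\<close> only the quotient is stored;
  the numerator is an intermediate value, so it does not have to respect the capacity.\<close>

lemma emit_step:
  assumes b: "fits d eps s" and v: "length v = d" "set v \<subseteq> {0, 1}"
    and i: "i < dim d eps" and out: "\<bar>int (Suc a)\<bar> < 2 ^ capacity d eps"
    and s: "s reg_n = int n" "s reg_vec = int u" "s reg_W = copies d eps" "s reg_V = scale d eps"
      "s reg_i = int i" "s reg_out = int a"
    and tab: "tabulates v (subs (deg d eps) d) s" and coef: "\<forall>y\<le>d. s (arr 3 (int y)) = coef d eps y"
  shows "halts d eps s emit_step 9
    (\<lambda>s'. agree (insert (int a) step_regs) s s' \<and> s' reg_i = int (Suc i) \<and> s' reg_out = int (Suc a) \<and>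
      s' (int a) = entry d eps n u v i)"
proof -
  define W where "W = nat (copies d eps)"
  have W: "W > 0" "copies d eps = int W" using copies_pos[of d eps] by (simp_all add: W_def)
  define t where "t = i div (4 * W)"
  define S where "S = block d eps i"
  have t: "t < length (subs (deg d eps) d)" "subs (deg d eps) d ! t = S"
    using block_in_subs(1)[OF i] by (simp_all add: t_def W_def S_def block_def length_subs)
  have S: "length S \<le> d" "length S \<le> deg d eps"
    using subs_bounds[OF block_in_subs(2)[OF i]] by (simp_all add: S_def)
  have mS: "monomial v S \<in> {0, 1}" unfolding S_def by (rule monomial_block_01[OF i v(2,1)])
  define y where "y = 2 * monomial v S - 1"
  define p where "p = positives d eps (length S)"
  have p: "0 \<le> p" "p \<le> int W" using positives_range[OF eps01 S] by (simp_all add: p_def W)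
  have WD: "W \<le> dim d eps" using dim_lower(7)[of d eps] by (simp add: W_def)
  have mem: "s (arr 1 (int t)) = monomial v S" "s (arr 2 (int t)) = int (length S)"
     "s (arr 3 (int (length S))) = coef d eps (length S)" "s (arr 3 0) = peak d eps 0"
    using tab t coef S by (auto simp: tabulates_def coef_def dest: spec[of _ 0])
  define r where "r = i div 4 mod W"
  define g where "g = i mod 4"
  have tv: "int i div (4 * int W) = int t" by (simp add: t_def zdiv_int)
  have rv: "int i div 4 - int t * int W = int r"
  proof -
    have "int i div 4 = int (i div 4)" by (simp add: zdiv_int)
    moreover have "t = i div 4 div W" by (simp add: t_def div_mult2_eq)
    ultimately show ?thesis by (simp only: r_def of_nat_mod of_nat_div minus_div_mult_eq_mod)
  qed
  have gv: "int i - 4 * (int i div 4) = int g" by (simp add: g_def zmod_int minus_mult_div_eq_mod)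
  have g2: "int g - 2 * (int g div 2) = int (i mod 2)"
    unfolding minus_mult_div_eq_mod g_def by (simp add: zmod_int mod_mod_cancel)
  have left: "1 + (if 1 < int g then 1 else 0) * (y - 1) = entry_left d eps v i"
    by (auto simp: entry_left_def g_def y_def S_def)
  have right: "(2 * (if int r < p then 1 else 0) - 1) * (1 + int (i mod 2) * (y - 1)) = entry_right d eps v i"
    by (auto simp: entry_right_def r_def W_def p_def y_def S_def even_iff_mod_2_eq_zero)
  have small: "\<bar>entry_left d eps v i\<bar> < 2 ^ capacity d eps" "\<bar>entry_right d eps v i\<bar> < 2 ^ capacity d eps"
    by (rule small_const; use mS in \<open>auto simp: entry_left_def entry_right_def S_def\<close>)+
  have ysmall: "\<bar>y\<bar> < 2 ^ capacity d eps" by (rule small_const) (use mS in \<open>auto simp: y_def\<close>)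
  have psmall: "\<bar>p\<bar> < 2 ^ capacity d eps" using small_nat[of "nat p" d] p WD by simp
  define R where "R s' \<longleftrightarrow> agree (insert (int a) step_regs) s s' \<and> s' reg_i = int i \<and>
        s' reg_out = int a \<and> s' (int a) = entry d eps n u v i" for s'
  define s4 where "s4 = s(reg_t := int t, reg_r := int r, reg_g := int g, reg_y := y)"
  have s4: "s4 reg_t = int t" "s4 reg_r = int r" "s4 reg_g = int g" "s4 reg_y = y" "s4 reg_n = int n"
    "s4 reg_vec = int u" "s4 reg_W = int W" "s4 reg_V = scale d eps" "s4 reg_i = int i" "s4 reg_out = int a"
    "s4 (arr 2 (int t)) = int (length S)" "s4 (arr 3 (int (length S))) = coef d eps (length S)"
    "s4 (arr 3 0) = peak d eps 0"
    by (simp_all add: s4_def s mem W)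
  have a4: "agree step_regs s s4" by (simp add: s4_def agree_def)
  have cond: "halts d eps s4 emit_entry (Suc (Suc 1)) R"
    if b4: "fits d eps s4"
    unfolding emit_entry_def
  proof (rule terminates_Cond[OF b4])
    assume "aval eps s4 (Less (Reg reg_vec) (Reg reg_n)) \<noteq> 0"
    then have un: "u < n" using s4 by (simp split: if_splits)
    have "halts d eps s4
       (Assign (Reg reg_out) (Plus (Const 1) (Times (Less (Const 1) (Reg reg_g)) (Minus (Reg reg_y) (Const 1))))) 1 R"
      apply (rule terminates_assign[where x = "int a" and v = "entry_left d eps v i"], fact b4, simp add: s4,
          use left in \<open>simp add: s4\<close>, simp, rule small)
      using a4 un s4 by (auto simp: R_def agree_def entry_def)
    then show "halts d eps s4
       (Assign (Reg reg_out) (Plus (Const 1) (Times (Less (Const 1) (Reg reg_g)) (Minus (Reg reg_y) (Const 1))))) (Suc 1) R"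
      by (rule terminates_mono) auto
  next
    assume "aval eps s4 (Less (Reg reg_vec) (Reg reg_n)) = 0"
    then have un: "\<not> u < n" using s4 by (simp split: if_splits)
    have pv: "(scale d eps * coef d eps (length S) + int W * peak d eps 0) div (2 * peak d eps 0) = p"
      by (simp add: p_def positives_def W)
    show "halts d eps s4 (Seq (Set_to reg_p
                   (Div (Plus (Times (Reg reg_V) (Cell (Arr 3 (Cell (Arr 2 (Reg reg_t))))))
                              (Times (Reg reg_W) (Cell (Arr 3 (Const 0)))))
                        (Times (Const 2) (Cell (Arr 3 (Const 0))))))
                 (Assign (Reg reg_out)
                   (Times (Minus (Times (Const 2) (Less (Reg reg_r) (Reg reg_p))) (Const 1))
                          (Plus (Const 1) (Times (Minus (Reg reg_g) (Times (Const 2) (Div (Reg reg_g) (Const 2))))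
                                                 (Minus (Reg reg_y) (Const 1))))))) (Suc 1) R"
      apply (rule terminates_seq_assign[where x = reg_p and v = p], fact b4, simp,
          simp only: aval.simps aval_Arr s4 pv, simp, rule psmall)
      apply (rule terminates_assign[where x = "int a" and v = "entry_right d eps v i"], assumption, simp add: s4,
          use right in \<open>simp add: s4 g2\<close>, simp, rule small)
      using a4 un s4 by (auto simp: R_def agree_def entry_def)
  qed simp
  have "halts d eps s emit_step (Suc (Suc (Suc (Suc (Suc (Suc 1) + Suc 1)))))
    (\<lambda>s'. agree (insert (int a) step_regs) s s' \<and> s' reg_i = int (Suc i) \<and> s' reg_out = int (Suc a) \<and>
      s' (int a) = entry d eps n u v i)"
    unfolding emit_step_def
    apply (rule terminates_seq_assign[where x = reg_t and v = "int t"], fact b, simp, simp add: s W tv, simp,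
        rule small_nat, use i in \<open>simp add: t_def le_trans[OF div_le_dividend]\<close>)
    apply (rule terminates_seq_assign[where x = reg_r and v = "int r"], assumption, simp, simp add: s W rv, simp,
        rule small_nat, use W WD in \<open>simp add: r_def le_trans[OF less_imp_le[OF mod_less_divisor]]\<close>)
    apply (rule terminates_seq_assign[where x = reg_g and v = "int g"], assumption, simp, simp add: s gv, simp,
        rule small_const, simp add: g_def le_trans[OF less_imp_le[OF mod_less_divisor]])
    apply (rule terminates_seq_assign[where x = reg_y and v = y], assumption, simp, simp add: mem y_def, simp,
        rule ysmall)
    apply (fold s4_def)
    apply (rule terminates_seq[where R = R], rule cond, assumption)
    apply (rule terminates_seq_assign[where x = reg_out and v = "int (Suc a)"], assumption, simp, simp add: R_def, simp,
        rule out)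
    apply (rule terminates_assign[where x = reg_i and v = "int (Suc i)"], assumption, simp, simp add: R_def, simp,
        rule small_nat, use i in simp)
    apply (auto simp: R_def agree_def)
    done
  then show ?thesis by (rule terminates_mono) auto
qed

end

context
  fixes eps :: real and d :: nat
  assumes eps01: "0 < eps" "eps < 1"
begin

lemma emit_prog:
  assumes b: "fits d eps s" and v: "length v = d" "set v \<subseteq> {0, 1}"
    and out: "\<bar>int (a + dim d eps)\<bar> < 2 ^ capacity d eps" "2 \<le> a"
    and s: "s reg_n = int n" "s reg_vec = int u" "s reg_E = 2 ^ (level eps + 1)" "s reg_P = 2 ^ deg d eps"
      "s reg_out = int a"
    and tab: "tabulates v (subs (deg d eps) d) s" and coef: "\<forall>y\<le>d. s (arr 3 (int y)) = coef d eps y"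
  shows "halts d eps s emit_prog (11 * dim d eps)
    (\<lambda>s'. agree ({reg_V, reg_W, reg_dim, 1} \<union> step_regs \<union> {int a..<int (a + dim d eps)}) s s' \<and>
      s' reg_out = int (a + dim d eps) \<and> s' 1 = int (dim d eps) \<and>
      (\<forall>i<dim d eps. s' (int (a + i)) = entry d eps n u v i))"
proof -
  let ?X = "{reg_V, reg_W, reg_dim, 1} \<union> step_regs \<union> {int a..<int (a + dim d eps)}"
  define I where "I i s' \<longleftrightarrow> agree ?X s s' \<and> s' reg_V = scale d eps \<and> s' reg_W = copies d eps \<and>
      s' reg_dim = int (dim d eps) \<and> s' 1 = int (dim d eps) \<and> s' reg_i = int i \<and> s' reg_out = int (a + i) \<and>
      (\<forall>j<i. s' (int (a + j)) = entry d eps n u v j)" for i s'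
  have len: "s reg_len = int (binom_le d (deg d eps))" using tab by (simp add: tabulates_def length_subs)
  have Wn: "copies d eps = int (nat (copies d eps))" using copies_pos[of d eps] by simp
  have D: "4 * int (binom_le d (deg d eps)) * copies d eps = int (dim d eps)"
    using copies_pos[of d eps] by (simp add: dim_def)
  have Wsmall: "\<bar>copies d eps\<bar> < 2 ^ capacity d eps"
    by (subst Wn, rule small_nat, rule dim_lower)
  have "1 * scale d eps \<le> copies d eps" unfolding copies_def using scale_pos[of d eps] by (intro mult_right_mono) auto
  then have Vsmall: "\<bar>scale d eps\<bar> < 2 ^ capacity d eps" using Wsmall scale_pos[of d eps] by linarith
  have "halts d eps s emit_prog (Suc (Suc (Suc (Suc (Suc (Suc (dim d eps * Suc 9)))))))
    (\<lambda>s'. agree ?X s s' \<and> s' reg_out = int (a + dim d eps) \<and> s' 1 = int (dim d eps) \<and>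
      (\<forall>i<dim d eps. s' (int (a + i)) = entry d eps n u v i))"
    unfolding emit_prog_def
    apply (rule terminates_seq_assign[where x = reg_V and v = "scale d eps"], fact b, simp,
        simp add: len s scale_def power2_eq_square, simp, rule Vsmall)
    apply (rule terminates_seq_assign[where x = reg_W and v = "copies d eps"], assumption, simp,
        simp add: s copies_def, simp, rule Wsmall)
    apply (rule terminates_seq_assign[where x = reg_dim and v = "int (dim d eps)"], assumption, simp,
        use D in \<open>simp add: len\<close>, simp, rule small_nat, simp)
    apply (rule terminates_seq_assign[where x = 1 and v = "int (dim d eps)"], assumption, simp,
        simp, simp, rule small_nat, simp)
    apply (rule terminates_seq_assign[where x = reg_i and v = 0], assumption, simp,
        simp, simp, rule small_const, simp)
    apply (rule terminates_While[where I = I], assumption, simp)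
    subgoal using s by (auto simp: I_def agree_def)
    subgoal premises p for i s1
    proof
      note i = p(6) and I = p(7) and b = p(8)
      show "aval eps s1 (Less (Reg reg_i) (Reg reg_dim)) \<noteq> 0" using I i by (simp add: I_def)
      have ag: "agree ?X s s1" using I by (simp add: I_def)
      have notin: "arr c (int y) \<notin> ?X" if "1 \<le> c" for c y using arr_less[of c "int y"] that by auto
      have arrs: "s1 (arr 1 (int y)) = s (arr 1 (int y))" "s1 (arr 2 (int y)) = s (arr 2 (int y))"
        "s1 (arr 3 (int y)) = s (arr 3 (int y))" for y
        by (rule agreeD[OF ag notin], simp)+
      have regs: "s1 reg_n = s reg_n" "s1 reg_vec = s reg_vec" "s1 reg_len = s reg_len"
        by (rule agreeD[OF ag], simp)+
      have s1: "s1 reg_n = int n" "s1 reg_vec = int u" "s1 reg_W = copies d eps" "s1 reg_V = scale d eps"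
        "s1 reg_i = int i" "s1 reg_out = int (a + i)" "tabulates v (subs (deg d eps) d) s1"
        "\<forall>y\<le>d. s1 (arr 3 (int y)) = coef d eps y"
        using I s(1,2) tab coef unfolding I_def tabulates_def arrs regs by simp_all
      have "\<bar>int (Suc (a + i))\<bar> < 2 ^ capacity d eps" using i out(1) by simp
      from emit_step[OF eps01 b v i this s1] show "halts d eps s1 emit_step 9 (I (Suc i))"
      proof (rule terminates_mono)
        fix s2 assume 2: "agree (insert (int (a + i)) step_regs) s1 s2 \<and> s2 reg_i = int (Suc i) \<and>
          s2 reg_out = int (Suc (a + i)) \<and> s2 (int (a + i)) = entry d eps n u v i"
        have ag2: "agree (insert (int (a + i)) step_regs) s1 s2" using 2 by simp
        have "agree ?X s s2" by (rule agree_trans[OF ag ag2]) (use i in auto)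
        \<comment> \<open>\<open>2 \<le> a\<close> keeps the dimension in cell 1 apart from the
          entries being written.\<close>
        moreover have "s2 1 = s1 1" "s2 reg_V = s1 reg_V" "s2 reg_W = s1 reg_W" "s2 reg_dim = s1 reg_dim"
          by (rule agreeD[OF ag2], use out(2) in simp)+
        moreover have "s2 (int (a + j)) = entry d eps n u v j" if "j < Suc i" for j
        proof (cases "j = i")
          case False
          then have "s2 (int (a + j)) = s1 (int (a + j))" by (intro agreeD[OF ag2]) auto
          then show ?thesis using I that False by (simp add: I_def)
        qed (use 2 in simp)
        ultimately show "I (Suc i) s2" using 2 I unfolding I_def by simp
      qed simp
    qed
    subgoal by (simp add: I_def)
    subgoal by (simp add: I_def)
    done
  then show ?thesis by (rule terminates_mono) (use dim_lower(6)[of d eps] in auto)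
qed

end

lemma concat_nth_uniform:
  assumes "\<forall>x\<in>set xs. length x = m" "u < length xs" "r < m"
  shows "concat xs ! (u * m + r) = xs ! u ! r"
  using assms
proof (induction xs arbitrary: u)
  case (Cons x xs)
  show ?case
  proof (cases u)
    case (Suc u')
    then show ?thesis using Cons by (simp add: nth_append)
  qed (use Cons in \<open>simp add: nth_append\<close>)
qed simp

lemma length_concat_uniform:
  "\<forall>x\<in>set xs. length x = m \<Longrightarrow> length (concat xs) = length xs * m"
  by (induction xs) auto

context
  fixes eps :: real and d :: nat
  assumes eps01: "0 < eps" "eps < 1"
begin

lemma main_prog:
  assumes b: "fits d eps s" and n: "1 \<le> n" "n \<le> 2 ^ d"
    and Vs: "\<And>u. u < 2 * n \<Longrightarrow> length (Vs ! u) = d \<and> set (Vs ! u) \<subseteq> {0, 1}"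
    and s: "s reg_n = int n" "s reg_d = int d" "s reg_E = 2 ^ (level eps + 1)" "s reg_P = 2 ^ deg d eps"
      "s reg_k = int (deg d eps)"
    and coef: "\<forall>y\<le>d. s (arr 3 (int y)) = coef d eps y"
    and inp: "\<And>u j. u < 2 * n \<Longrightarrow> j < d \<Longrightarrow> s (arr 0 (int (u * d + j))) = Vs ! u ! j"
  shows "halts d eps s main_prog (60 * n * dim d eps)
    (\<lambda>s'. s' 0 = s 0 \<and> s' 1 = int (dim d eps) \<and>
      (\<forall>u<2 * n. \<forall>i<dim d eps. s' (int (2 + u * dim d eps + i)) = entry d eps n u (Vs ! u) i))"
proof -
  define D where "D = dim d eps"
  define X where "X = subset_regs \<union> step_regs \<union> {reg_vec, reg_V, reg_W, reg_dim, 1} \<union> {2..}"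
  \<comment> \<open>Cell 1 holds the new dimension only from the end of the first round on;
    \<open>1 \<le> n\<close> ensures that such a round takes place.\<close>
  define I where "I u s' \<longleftrightarrow> agree X s s' \<and> s' reg_vec = int u \<and> s' reg_out = int (2 + u * D) \<and>
      s' reg_in = int (u * d) \<and> (u > 0 \<longrightarrow> s' 1 = int D) \<and>
      (\<forall>u'<u. \<forall>i<D. s' (int (2 + u' * D + i)) = entry d eps n u' (Vs ! u') i)" for u s'
  have dD: "d \<le> D" using dim_lower(2)[of d eps] by (simp add: D_def)
  have addr: "\<bar>int x\<bar> < 2 ^ capacity d eps" if "x \<le> 2 + 2 * n * D" for x
    using capacity_address[OF n(2)] that by (simp add: D_def)
  have out_le: "2 + u * D + D \<le> 2 + 2 * n * D" "u * d + d \<le> 2 + 2 * n * D" "Suc u \<le> 2 + 2 * n * D"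
    if "u < 2 * n" for u
  proof -
    have "Suc u * D \<le> 2 * n * D" using that by (intro mult_le_mono1) simp
    then show 1: "2 + u * D + D \<le> 2 + 2 * n * D" by simp
    have "Suc u * d \<le> Suc u * D" "Suc u * 1 \<le> Suc u * D"
      using dD dim_lower(6)[of d eps] by (intro mult_le_mono2; simp add: D_def)+
    with \<open>Suc u * D \<le> 2 * n * D\<close> show "u * d + d \<le> 2 + 2 * n * D" "Suc u \<le> 2 + 2 * n * D" by simp_all
  qed
  let ?body = "Seq subset_prog (Seq emit_prog (Set_to reg_vec (Plus (Reg reg_vec) (Const 1))))"
  have "halts d eps s main_prog (Suc (Suc (Suc (Suc (2 * n * Suc (13 * D + (11 * D + 1)))))))
    (\<lambda>s'. s' 0 = s 0 \<and> s' 1 = int D \<and>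
      (\<forall>u<2 * n. \<forall>i<D. s' (int (2 + u * D + i)) = entry d eps n u (Vs ! u) i))"
    unfolding main_prog_def
    apply (rule terminates_seq_assign[where x = reg_vec and v = 0], fact b, simp, simp, simp, rule small_const, simp)
    apply (rule terminates_seq_assign[where x = reg_out and v = 2], assumption, simp, simp, simp, rule small_const, simp)
    apply (rule terminates_seq_assign[where x = reg_in and v = 0], assumption, simp, simp, simp, rule small_const, simp)
    apply (rule terminates_While[where I = I], assumption, simp)
    subgoal by (simp add: I_def X_def agree_def)
    subgoal premises p for u s1
    proof
      note u = p(4) and I = p(5) and b1 = p(6)
      have ag: "agree X s s1" using I by (simp add: I_def)
      have regs: "s1 reg_n = int n" "s1 reg_d = int d" "s1 reg_E = 2 ^ (level eps + 1)" "s1 reg_P = 2 ^ deg d eps"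
        "s1 reg_k = int (deg d eps)"
        by (subst agreeD[OF ag], simp add: X_def, rule s)+
      have arrs: "s1 (arr 0 (int y)) = s (arr 0 (int y))" "s1 (arr 3 (int y)) = s (arr 3 (int y))" for y
        using arr_less[of 0 "int y"] arr_less[of 3 "int y"] by (intro agreeD[OF ag]; simp add: X_def)+
      show "aval eps s1 (Less (Reg reg_vec) (Times (Const 2) (Reg reg_n))) \<noteq> 0"
        using u I regs by (simp add: I_def)
      note v = Vs[OF u, THEN conjunct1] Vs[OF u, THEN conjunct2]
      show "halts d eps s1 ?body (13 * D + (11 * D + 1)) (I (Suc u))"
        unfolding D_def
      proof (rule terminates_seq[OF subset_prog[OF eps01 b1 v regs(5,2)]])
        show "s1 reg_in = int (u * d)" using I by (simp add: I_def)
        show "s1 (arr 0 (int (u * d + j))) = Vs ! u ! j" if "j < d" for j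
          unfolding arrs by (rule inp[OF u that])
        show "int (u * d + d) < 2 ^ capacity d eps" using addr[OF out_le(2)[OF u]] by simp
        fix s2 assume b2: "fits d eps s2" and 2: "agree subset_regs s1 s2 \<and>
          s2 reg_in = int (u * d + d) \<and> tabulates (Vs ! u) (subs (deg d eps) d) s2"
        then have ag2: "agree subset_regs s1 s2" by simp
        have s2: "s2 reg_n = int n" "s2 reg_vec = int u" "s2 reg_E = 2 ^ (level eps + 1)" "s2 reg_P = 2 ^ deg d eps"
          "s2 reg_out = int (2 + u * D)"
          by (subst agreeD[OF ag2], simp, use regs I in \<open>simp add: I_def\<close>)+
        have coef2: "\<forall>y\<le>d. s2 (arr 3 (int y)) = coef d eps y"
          using coef arrs agreeD[OF ag2, of "arr 3 _"] by simp
        show "halts d eps s2 (Seq emit_prog (Set_to reg_vec (Plus (Reg reg_vec) (Const 1))))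
          (11 * dim d eps + 1) (I (Suc u))"
        proof (rule terminates_seq[OF emit_prog[OF eps01 b2 v _ _ s2 _ coef2]])
          show "\<bar>int (2 + u * D + dim d eps)\<bar> < 2 ^ capacity d eps"
            using addr[OF out_le(1)[OF u]] by (simp add: D_def)
          show "tabulates (Vs ! u) (subs (deg d eps) d) s2" using 2 by simp
          let ?Y = "{reg_V, reg_W, reg_dim, 1} \<union> step_regs \<union> {int (2 + u * D)..<int (2 + u * D + dim d eps)}"
          fix s3 assume b3: "fits d eps s3" and 3: "agree ?Y s2 s3 \<and>
            s3 reg_out = int (2 + u * D + dim d eps) \<and> s3 1 = int (dim d eps) \<and>
            (\<forall>i<dim d eps. s3 (int (2 + u * D + i)) = entry d eps n u (Vs ! u) i)"
          then have ag3: "agree ?Y s2 s3" by simp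
          have "c < 0 \<Longrightarrow> c \<notin> {int (2 + u * D)..<z}" for c z
            using of_nat_0_le_iff[of "2 + u * D", where 'a = int] unfolding atLeastLessThan_iff by linarith
          then have "reg_vec \<notin> ?Y" "reg_in \<notin> ?Y" by (simp_all del: of_nat_add of_nat_mult)
          with agreeD[OF ag3] 2 s2 have vec3: "s3 reg_vec = int u" and in3: "s3 reg_in = int (Suc u * d)" by simp_all
          have agX: "agree X s s3"
          proof (rule agree_trans[OF agree_trans[OF ag ag2] ag3])
            have "2 \<le> int (2 + u * D)" by simp
            then have "{int (2 + u * D)..<int (2 + u * D + dim d eps)} \<subseteq> {2..}"
              unfolding atLeastLessThan_def by (intro le_infI1) (simp only: atLeast_subset_iff)
            then show "?Y \<subseteq> X" by (auto simp: X_def simp del: of_nat_add of_nat_mult)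
          qed (auto simp: X_def)
          have old: "s3 (int (2 + u' * D + i)) = entry d eps n u' (Vs ! u') i" if "u' < Suc u" "i < D" for u' i
          proof (cases "u' = u")
            case False
            then have "u' < u" using that by simp
            then have "Suc u' * D \<le> u * D" by (intro mult_le_mono1) simp
            then have lt: "2 + u' * D + i < 2 + u * D" using that(2) by simp
            define c where "c = 2 + u' * D + i"
            have c: "2 \<le> c" "c < 2 + u * D" using lt by (simp_all add: c_def)
            have "s3 (int c) = s2 (int c)"
              by (rule agreeD[OF ag3]) (use c in \<open>auto simp del: of_nat_add of_nat_mult\<close>)
            also have "\<dots> = s1 (int c)" by (rule agreeD[OF ag2]) (use c in auto)
            finally show ?thesis using I \<open>u' < u\<close> that(2) by (simp add: I_def c_def)
          qed (use 3 that in \<open>simp add: D_def\<close>)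
          show "halts d eps s3 (Set_to reg_vec (Plus (Reg reg_vec) (Const 1))) 1 (I (Suc u))"
            apply (rule terminates_assign[where x = reg_vec and v = "int (Suc u)"], fact b3, simp, simp add: vec3,
                simp, rule addr[OF out_le(3)[OF u]])
            subgoal premises q
            proof -
              have neq: "int c \<noteq> reg_vec" for c by linarith
              have "agree X s (s3(reg_vec := int (Suc u)))" by (rule agree_upd[OF agX]) (simp add: X_def)
              moreover have "s3 reg_out = int (2 + Suc u * D)" using 3 by (simp add: D_def)
              moreover have "s3 1 = int D" using 3 by (simp add: D_def)
              ultimately show ?thesis using old in3 unfolding I_def
                by (simp only: fun_upd_same fun_upd_other[OF neq]) simp
            qed
            done
        qed simp
      qed
    qed
    subgoal premises p for s1
    proof -
      have "s1 reg_n = int n" "s1 reg_vec = int (2 * n)"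
        using p(4) s agreeD[of X s s1 reg_n] by (simp_all add: I_def X_def)
      then show ?thesis by simp
    qed
    subgoal premises p for s1
      using p(5) n(1) agreeD[of X s s1 0] by (simp add: I_def X_def)
    done
  then show ?thesis unfolding D_def
  proof (rule terminates_mono)
    have "1 * 40 \<le> n * dim d eps" using n(1) dim_lower(6)[of d eps] by (intro mult_le_mono) auto
    moreover have "n * 40 \<le> n * dim d eps" using dim_lower(6)[of d eps] by (intro mult_le_mono2)
    moreover have "2 * n * Suc (13 * dim d eps + (11 * dim d eps + 1)) = 48 * (n * dim d eps) + 4 * n"
      by (simp add: algebra_simps)
    ultimately show "Suc (Suc (Suc (Suc (2 * n * Suc (13 * dim d eps + (11 * dim d eps + 1)))))) \<le> 60 * n * dim d eps"
      unfolding mult.assoc[of 60] by linarith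
  qed
qed

lemma reduction_prog:
  assumes b: "fits d eps s" and n: "1 \<le> n" "n \<le> 2 ^ d"
    and Vs: "\<And>u. u < 2 * n \<Longrightarrow> length (Vs ! u) = d \<and> set (Vs ! u) \<subseteq> {0, 1}"
    and s: "s 0 = int n" "s 1 = int d"
    and inp: "\<And>u j. u < 2 * n \<Longrightarrow> j < d \<Longrightarrow> s (int (2 + u * d + j)) = Vs ! u ! j"
  shows "halts d eps s reduction_prog (120 * n * dim d eps)
    (\<lambda>s'. s' 0 = int n \<and> s' 1 = int (dim d eps) \<and>
      (\<forall>u<2 * n. \<forall>i<dim d eps. s' (int (2 + u * dim d eps + i)) = entry d eps n u (Vs ! u) i))"
proof -
  let ?D = "dim d eps"
  let ?Q = "\<lambda>s'. s' 0 = int n \<and> s' 1 = int ?D \<and>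
      (\<forall>u<2 * n. \<forall>i<?D. s' (int (2 + u * ?D + i)) = entry d eps n u (Vs ! u) i)"
  define s0 where "s0 = s(reg_n := int n, reg_d := int d, reg_N := int (Suc d))"
  have s0: "s0 reg_n = int n" "s0 reg_d = int d" "s0 reg_N = int (Suc d)" "s0 0 = int n"
    "\<And>j. s0 (2 + int j) = s (2 + int j)"
    using s by (simp_all add: s0_def)
  have body: "halts d eps s0 (Seq copy_prog (Seq level_prog (Seq doublings_prog (Seq power_prog
    (Seq table_prog (Seq difference_prog main_prog))))))
    (5 * n * ?D + 5 + (5 * ?D + (5 * ?D + (5 * ?D + (20 * ?D + (10 * ?D + 60 * n * ?D)))))) ?Q"
    if b0: "fits d eps s0"
  proof (rule terminates_seq[OF copy_prog[OF eps01 b0 s0(1) n(2) s0(2)]])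
    fix s1 assume b1: "fits d eps s1"
      and 1: "agree ({reg_i} \<union> cells 0) s0 s1 \<and> (\<forall>j<2 * n * d. s1 (arr 0 (int j)) = s0 (2 + int j))"
    then have a1: "agree ({reg_i} \<union> cells 0) s0 s1" by simp
    have s1: "s1 reg_n = int n" "s1 reg_d = int d" "s1 reg_N = int (Suc d)" "s1 0 = int n"
      by (subst agreeD[OF a1], simp, rule s0)+
    have in1: "s1 (arr 0 (int (u * d + j))) = Vs ! u ! j" if "u < 2 * n" "j < d" for u j
    proof -
      have "u * d + j < Suc u * d" using that(2) by simp
      also have "\<dots> \<le> 2 * n * d" using that(1) by (intro mult_le_mono1) simp
      finally have "s1 (arr 0 (int (u * d + j))) = s0 (2 + int (u * d + j))" using 1 by blast
      then show ?thesis unfolding s0(5) using inp[OF that] by (simp add: algebra_simps)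
    qed
    show "halts d eps s1 (Seq level_prog (Seq doublings_prog (Seq power_prog
        (Seq table_prog (Seq difference_prog main_prog)))))
      (5 * ?D + (5 * ?D + (5 * ?D + (20 * ?D + (10 * ?D + 60 * n * ?D)))))
      ?Q"
    proof (rule terminates_seq[OF level_prog[OF eps01 b1 s1(3)]])
      fix s2 assume b2: "fits d eps s2" and 2: "agree {reg_E, reg_l} s1 s2 \<and>
        s2 reg_E = 2 ^ (level eps + 1) \<and> s2 reg_l = int (zeros d eps)"
      then have a2: "agree {reg_E, reg_l} s1 s2" by simp
      have s2: "s2 reg_n = int n" "s2 reg_d = int d" "s2 reg_N = int (Suc d)" "s2 0 = int n"
        by (subst agreeD[OF a2], simp, rule s1)+
      have l2: "s2 reg_E = 2 ^ (level eps + 1)" "s2 reg_l = int (zeros d eps)" using 2 by auto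
      show "halts d eps s2 (Seq doublings_prog (Seq power_prog
          (Seq table_prog (Seq difference_prog main_prog))))
        (5 * ?D + (5 * ?D + (20 * ?D + (10 * ?D + 60 * n * ?D))))
        ?Q"
      proof (rule terminates_seq[OF doublings_prog[OF eps01 b2 s2(3) l2(2)]])
        fix s3 assume b3: "fits d eps s3" and 3: "agree {reg_q, reg_K} s2 s3 \<and>
          s3 reg_q = 4 ^ doublings d eps \<and> s3 reg_K = 2 ^ doublings d eps"
        then have a3: "agree {reg_q, reg_K} s2 s3" by simp
        have s3: "s3 reg_n = int n" "s3 reg_d = int d" "s3 reg_N = int (Suc d)" "s3 0 = int n"
          by (subst agreeD[OF a3], simp, rule s2)+
        have l3: "s3 reg_E = 2 ^ (level eps + 1)" "s3 reg_l = int (zeros d eps)"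
          by (subst agreeD[OF a3], simp, rule l2)+
        have q3: "s3 reg_q = 4 ^ doublings d eps" "s3 reg_K = 2 ^ doublings d eps" using 3 by auto
        show "halts d eps s3 (Seq power_prog (Seq table_prog (Seq difference_prog main_prog)))
          (5 * ?D + (20 * ?D + (10 * ?D + 60 * n * ?D)))
          ?Q"
        proof (rule terminates_seq[OF power_prog[OF eps01 b3 l3(2) q3(2)]])
          fix s4 assume b4: "fits d eps s4" and 4: "agree {reg_k, reg_P, reg_i} s3 s4 \<and>
            s4 reg_k = int (deg d eps) \<and> s4 reg_P = 2 ^ deg d eps"
          then have a4: "agree {reg_k, reg_P, reg_i} s3 s4" by simp
          have s4: "s4 reg_n = int n" "s4 reg_d = int d" "s4 reg_N = int (Suc d)" "s4 0 = int n"
            by (subst agreeD[OF a4], simp, rule s3)+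
          have l4: "s4 reg_E = 2 ^ (level eps + 1)" "s4 reg_l = int (zeros d eps)"
            by (subst agreeD[OF a4], simp, rule l3)+
          have q4: "s4 reg_q = 4 ^ doublings d eps" by (subst agreeD[OF a4], simp, rule q3)
          have k4: "s4 reg_P = 2 ^ deg d eps" "s4 reg_k = int (deg d eps)" using 4 by auto
          show "halts d eps s4 (Seq table_prog (Seq difference_prog main_prog))
            (20 * ?D + (10 * ?D + 60 * n * ?D))
            ?Q"
          proof (rule terminates_seq[OF table_prog[OF eps01 b4 s4(3) q4 l4(2)]])
            let ?T = "{reg_x, reg_R, reg_Q, reg_D, reg_F, reg_j} \<union> cells 3"
            fix s5 assume b5: "fits d eps s5" and 5: "agree ?T s4 s5 \<and>
              (\<forall>y\<le>d. s5 (arr 3 (int y)) = peak d eps y)"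
            then have a5: "agree ?T s4 s5" by simp
            have s5: "s5 reg_N = int (Suc d)" "s5 reg_d = int d" by (subst agreeD[OF a5], simp, rule s4)+
            show "halts d eps s5 (Seq difference_prog main_prog)
              (10 * ?D + 60 * n * ?D) ?Q"
            proof (rule terminates_seq[OF difference_prog[OF eps01 b5 s5]])
              show "\<forall>y\<le>d. s5 (arr 3 (int y)) = peak d eps y" using 5 by simp
              fix s6 assume b6: "fits d eps s6" and 6: "agree ({reg_x, reg_j} \<union> cells 3) s5 s6 \<and>
                (\<forall>y\<le>d. s6 (arr 3 (int y)) = coef d eps y)"
              then have a6: "agree ({reg_x, reg_j} \<union> cells 3) s5 s6" by simp
              have a46: "agree ?T s4 s6" by (rule agree_trans[OF a5 a6]) auto
              have s6: "s6 reg_n = int n" "s6 reg_d = int d" "s6 reg_E = 2 ^ (level eps + 1)"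
                "s6 reg_P = 2 ^ deg d eps" "s6 reg_k = int (deg d eps)" "s6 0 = int n"
                by (subst agreeD[OF a46], simp, rule s4 l4 k4)+
              have in6: "s6 (arr 0 (int (u * d + j))) = Vs ! u ! j" if "u < 2 * n" "j < d" for u j
              proof -
                define c where "c = arr 0 (int (u * d + j))"
                have c: "c < - 31" "c \<notin> cells 3" unfolding c_def by (rule arr_less; simp) simp
                have "s6 c = s4 c" using c by (intro agreeD[OF a46]) auto
                also have "\<dots> = s3 c" using c by (intro agreeD[OF a4]) auto
                also have "\<dots> = s2 c" using c by (intro agreeD[OF a3]) auto
                also have "\<dots> = s1 c" using c by (intro agreeD[OF a2]) auto
                finally show ?thesis using in1[OF that] by (simp only: c_def)
              qed
              show "halts d eps s6 main_prog (60 * n * ?D)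
                ?Q"
                using main_prog[OF b6 n Vs s6(1-5) _ in6] 6 unfolding s6(6) by simp
            qed
          qed
        qed
      qed
    qed
  qed
  have dD: "Suc d \<le> ?D" by (rule dim_lower)
  have "halts d eps s reduction_prog (Suc (Suc (Suc
    (5 * n * ?D + 5 + (5 * ?D + (5 * ?D + (5 * ?D + (20 * ?D + (10 * ?D + 60 * n * ?D))))))))) ?Q"
    unfolding reduction_prog_def
    apply (rule terminates_seq_assign[where x = reg_n and v = "int n"], fact b, simp, simp add: s, simp,
        rule capacity_address[OF n(2)], use dim_lower(6)[of d eps] mult_le_mono2[of 1 "?D" n] in linarith)
    apply (rule terminates_seq_assign[where x = reg_d and v = "int d"], assumption, simp, simp add: s, simp,
        rule small_nat, use dD in simp)
    apply (rule terminates_seq_assign[where x = reg_N and v = "int (Suc d)"], assumption, simp, simp, simp,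
        rule small_nat, use dD in simp)
    apply (fold s0_def)
    apply (rule body, assumption)
    done
  then show ?thesis
  proof (rule terminates_mono)
    have 1: "1 * ?D \<le> n * ?D" using n(1) by (intro mult_le_mono1)
    have 2: "5 * n * ?D = 5 * (n * ?D)" "60 * n * ?D = 60 * (n * ?D)"
      "120 * n * ?D = 120 * (n * ?D)" by simp_all
    show "Suc (Suc (Suc (5 * n * ?D + 5 + (5 * ?D + (5 * ?D + (5 * ?D + (20 * ?D +
        (10 * ?D + 60 * n * ?D)))))))) \<le> 120 * n * ?D"
      unfolding 2 using 1 dim_lower(6)[of d eps] by linarith
  qed
qed

end

section \<open>The reduction\<close>

lemma finite_dot_values:
  assumes "finite A" "finite B"
  shows "finite {dot a b |a b. a \<in> A \<and> b \<in> B}"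
proof -
  have "{dot a b |a b. a \<in> A \<and> b \<in> B} = (\<lambda>(a, b). dot a b) ` (A \<times> B)" by auto
  then show ?thesis using assms by simp
qed

lemma OPT_ge:
  assumes "finite A" "finite B" "a \<in> A" "b \<in> B"
  shows "dot a b \<le> OPT A B"
  unfolding OPT_def using assms by (intro Max_ge finite_dot_values) auto

lemma OPT_attained:
  assumes "finite A" "finite B" "A \<noteq> {}" "B \<noteq> {}"
  obtains a b where "a \<in> A" "b \<in> B" "OPT A B = dot a b"
proof -
  have "OPT A B \<in> {dot a b |a b. a \<in> A \<and> b \<in> B}"
    unfolding OPT_def using assms by (intro Max_in finite_dot_values) auto
  with that show ?thesis by blast
qed

text \<open>Repetition-freeness is what keeps \<open>n\<close>, and with it all addresses, within
  the cell capacity.\<close>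

lemma vectors_card:
  assumes "vectors {0, 1} n d vs"
  shows "n \<le> 2 ^ d"
proof -
  have "n = card (set vs)" using assms distinct_card[of vs] by (simp add: vectors_def)
  also have "\<dots> \<le> card {xs. set xs \<subseteq> {0, 1 :: int} \<and> length xs = d}"
    using assms by (intro card_mono finite_lists_length_eq) (auto simp: vectors_def)
  also have "\<dots> = 2 ^ d" by (simp add: card_lists_length_eq numeral_2_eq_2)
  finally show ?thesis .
qed

lemma bounded_mem_load:
  assumes "\<And>x. x \<in> set xs \<Longrightarrow> \<bar>x\<bar> < 2 ^ b"
  shows "bounded_mem b (load xs)"
  using assms by (auto simp: bounded_mem_def load_def nat_less_iff)

context
  fixes eps :: real and d n :: nat and As Bs :: "int list list"
  assumes eps01: "0 < eps" "eps < 1" and n: "1 \<le> n"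
    and As: "vectors {0, 1} n d As" and Bs: "vectors {0, 1} n d Bs"
begin

lemma vectors_images:
  "vectors {-1, 1} n (dim d eps) (map (image_left d eps) As)"
  "vectors {-1, 1} n (dim d eps) (map (image_right d eps) Bs)"
proof -
  have inj: "inj_on (image_left d eps) (set As)" "inj_on (image_right d eps) (set Bs)"
    using As Bs image_injective[of _ d _ eps] by (meson inj_onI vectors_def)+
  have len: "length (image_left d eps v) = dim d eps" "length (image_right d eps v) = dim d eps" for v
    by (simp_all add: image_left_def image_right_def)
  show "vectors {-1, 1} n (dim d eps) (map (image_left d eps) As)"
    using As inj(1) set_image_left[of _ d eps] len by (auto simp: vectors_def distinct_map)
  show "vectors {-1, 1} n (dim d eps) (map (image_right d eps) Bs)"
    using Bs inj(2) set_image_right[of _ d eps] len by (auto simp: vectors_def distinct_map)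
qed

lemma dot_images:
  assumes "a \<in> set As" "b \<in> set Bs"
  obtains x where "x \<le> d" "int x = dot a b"
    "dot (image_left d eps a) (image_right d eps b) = 4 * rounded d eps x"
proof -
  have a: "set a \<subseteq> {0, 1}" "length a = d" and b: "set b \<subseteq> {0, 1}" "length b = d"
    using assms As Bs by (auto simp: vectors_def)
  obtain x where x: "int x = dot a b" "x \<le> d" by (rule dot_01[OF a b])
  with dot_image[OF eps01 a b x(1)] that show ?thesis by blast
qed

lemma OPT_large:
  assumes "\<exists>a\<in>set As. \<exists>b\<in>set Bs. dot a b = 0"
  shows "4 * scale d eps \<le> OPT (set (map (image_left d eps) As)) (set (map (image_right d eps) Bs))"
proof -
  obtain a b where ab: "a \<in> set As" "b \<in> set Bs" "dot a b = 0" using assms by blast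
  obtain x where "int x = dot a b" "dot (image_left d eps a) (image_right d eps b) = 4 * rounded d eps x"
    by (rule dot_images[OF ab(1,2)])
  then have "dot (image_left d eps a) (image_right d eps b) = 4 * scale d eps"
    using ab(3) rounded_0[OF eps01] by simp
  moreover have "dot (image_left d eps a) (image_right d eps b) \<le>
      OPT (set (map (image_left d eps) As)) (set (map (image_right d eps) Bs))"
    using ab by (intro OPT_ge) auto
  ultimately show ?thesis by simp
qed

text \<open>As \<open>1 \<le> n\<close>, the maximum is attained at a pair of images, and
  \<open>rounded_small\<close> bounds that inner product from both sides.\<close>

lemma OPT_small:
  assumes "\<not> (\<exists>a\<in>set As. \<exists>b\<in>set Bs. dot a b = 0)"
  shows "\<bar>real_of_int (OPT (set (map (image_left d eps) As)) (set (map (image_right d eps) Bs)))\<bar>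
    \<le> real_of_int (4 * scale d eps) * eps"
proof -
  have "As \<noteq> []" "Bs \<noteq> []" using n As Bs by (auto simp: vectors_def)
  then obtain a' b' where a': "a' \<in> set (map (image_left d eps) As)" "b' \<in> set (map (image_right d eps) Bs)"
    and O: "OPT (set (map (image_left d eps) As)) (set (map (image_right d eps) Bs)) = dot a' b'"
    by (auto intro: OPT_attained[of "set (map (image_left d eps) As)" "set (map (image_right d eps) Bs)"])
  then obtain a b where ab: "a \<in> set As" "b \<in> set Bs" "a' = image_left d eps a" "b' = image_right d eps b"
    by auto
  obtain x where x: "x \<le> d" "int x = dot a b"
    and D: "dot (image_left d eps a) (image_right d eps b) = 4 * rounded d eps x"
    by (rule dot_images[OF ab(1,2)])
  have "dot a b \<noteq> 0" using assms ab by blast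
  then have "1 \<le> x" using x(2) by (cases x) auto
  from rounded_small[OF eps01 this x(1)] show ?thesis unfolding O ab(3,4) D by simp
qed

text \<open>\<open>1320000 = 1000 * 11 * 120\<close>: there are at most \<open>120 * n * D\<close>
  steps with \<open>D = dim d eps\<close>, each costing at most \<open>1000 * Suc (10 * D)\<close>,
  and \<open>Suc (10 * D) \<le> 11 * D\<close>.\<close>

lemma maps_within_reduction:
  "maps_within reduction_prog eps (encode n d As Bs)
     (encode n (dim d eps) (map (image_left d eps) As) (map (image_right d eps) Bs))
     (n * poly (monom 1320000 2) (dim d eps))"
proof -
  define D where "D = dim d eps"
  define Vs where "Vs = As @ Bs"
  define Us where "Us = map (image_left d eps) As @ map (image_right d eps) Bs"
  define s where "s = load (encode n d As Bs)"
  have n2: "n \<le> 2 ^ d" by (rule vectors_card[OF As])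
  have len: "length As = n" "length Bs = n" using As Bs by (auto simp: vectors_def)
  have uni: "\<forall>v\<in>set Vs. length v = d" using As Bs by (auto simp: Vs_def vectors_def)
  have uniU: "\<forall>v\<in>set Us. length v = D" by (auto simp: Us_def D_def image_left_def image_right_def)
  have lenV: "length Vs = 2 * n" "length Us = 2 * n" using len by (simp_all add: Vs_def Us_def)
  have V: "length (Vs ! u) = d \<and> set (Vs ! u) \<subseteq> {0, 1}" if "u < 2 * n" for u
  proof -
    have "Vs ! u \<in> set Vs" using that lenV by simp
    then show ?thesis using As Bs by (auto simp: Vs_def vectors_def)
  qed
  have enc: "encode n d As Bs = [int n, int d] @ concat Vs" by (simp add: encode_def Vs_def)
  have encU: "encode n D (map (image_left d eps) As) (map (image_right d eps) Bs) = [int n, int D] @ concat Us"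
    by (simp add: encode_def Us_def)
  have "\<bar>x\<bar> < 2 ^ capacity d eps" if "x \<in> set (encode n d As Bs)" for x
  proof -
    have "x = int n \<or> x = int d \<or> x \<in> {0, 1}" using that As Bs by (fastforce simp: encode_def vectors_def)
    moreover have "\<bar>int n\<bar> < 2 ^ capacity d eps"
      using mult_le_mono2[of 1 "dim d eps" n] dim_lower(6)[of d eps]
      by (intro capacity_address[OF n2]) linarith
    moreover have "\<bar>int d\<bar> < 2 ^ capacity d eps" using dim_lower(2)[of d eps] by (intro small_nat) simp
    moreover have "\<bar>x\<bar> < 2 ^ capacity d eps" if "x \<in> {0, 1}" using that by (intro small_const) auto
    ultimately show ?thesis by blast
  qed
  then have b: "fits d eps s" unfolding s_def by (rule bounded_mem_load)
  have s: "s 0 = int n" "s 1 = int d" by (simp_all add: s_def enc load_def)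
  have inp: "s (int (2 + u * d + j)) = Vs ! u ! j" if "u < 2 * n" "j < d" for u j
  proof -
    have "u * d + j < Suc u * d" using that(2) by simp
    also have "\<dots> \<le> 2 * n * d" using that(1) by (intro mult_le_mono1) simp
    also have "\<dots> = length (concat Vs)" using length_concat_uniform[OF uni] lenV by simp
    finally have "u * d + j < length (concat Vs)" .
    moreover have "nat (int (2 + u * d + j)) = Suc (Suc (u * d + j))" by (simp only: nat_int)
    ultimately have "s (int (2 + u * d + j)) = concat Vs ! (u * d + j)"
      unfolding s_def enc load_def by (simp del: of_nat_add of_nat_mult)
    then show ?thesis using concat_nth_uniform[OF uni, of u j] that lenV by simp
  qed
  from reduction_prog[OF eps01 b n n2 V s inp] obtain t s' where
    t: "exec eps reduction_prog s t s'" "t \<le> 1000 * Suc (capacity d eps) * (120 * n * D)"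
    and s': "s' 0 = int n" "s' 1 = int D"
      "\<And>u i. u < 2 * n \<Longrightarrow> i < D \<Longrightarrow> s' (int (2 + u * D + i)) = entry d eps n u (Vs ! u) i"
    unfolding terminates_def D_def by blast
  have "Suc (capacity d eps) \<le> 11 * D" using dim_lower(6)[of d eps] by (simp add: capacity_def D_def)
  then have "1000 * Suc (capacity d eps) * (120 * n * D) \<le> 1000 * (11 * D) * (120 * n * D)"
    by (intro mult_le_mono) auto
  also have "\<dots> = n * poly (monom 1320000 2) D" by (simp add: poly_monom power2_eq_square)
  finally have time: "t \<le> n * poly (monom 1320000 2) D" using t(2) by linarith
  have entry: "entry d eps n u (Vs ! u) i = Us ! u ! i" if "u < 2 * n" "i < D" for u i
    using that len by (auto simp: entry_def Vs_def Us_def nth_append image_left_def image_right_def D_def)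
  have "holds s' ([int n, int D] @ concat Us)"
    unfolding holds_def
  proof (intro allI impI)
    fix i assume i: "i < length ([int n, int D] @ concat Us)"
    consider "i = 0" | "i = 1" | "i \<ge> 2" by linarith
    then show "s' (int i) = ([int n, int D] @ concat Us) ! i"
    proof cases
      case 3
      define j where "j = i - 2"
      have D: "D > 0" using dim_lower(6)[of d eps] by (simp add: D_def)
      have "j < length (concat Us)" using i 3 by (simp add: j_def)
      also have "\<dots> = 2 * n * D" using length_concat_uniform[OF uniU] lenV by simp
      finally have "j div D < 2 * n" using less_mult_imp_div_less by blast
      moreover have "j mod D < D" using D by simp
      moreover have "i = 2 + j div D * D + j mod D" "([int n, int D] @ concat Us) ! i = concat Us ! (j div D * D + j mod D)"
        using 3 by (simp_all add: j_def nth_append numeral_2_eq_2)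
      ultimately show ?thesis
        using s'(3)[of "j div D" "j mod D"] entry concat_nth_uniform[OF uniU, of "j div D" "j mod D"] lenV by metis
    qed (use s' in simp_all)
  qed
  then have "holds s' (encode n D (map (image_left d eps) As) (map (image_right d eps) Bs))"
    unfolding encU .
  then show ?thesis unfolding maps_within_def D_def[symmetric] using t(1) time s_def by blast
qed

end

text \<open>What remains of the dimension after splitting off the cube and \<open>1 / eps\<close>.
  The factor \<open>2 ^ (level eps + 1) * eps\<close> lies in \<open>[1, 2]\<close>, so this is the
  degree up to an additive constant.\<close>

definition dim_exponent :: "nat \<Rightarrow> real \<Rightarrow> real" where
  "dim_exponent d eps = log 2 (40 * 2 ^ deg d eps * (2 ^ (level eps + 1) * eps))"

text \<open>\<open>40 \<le> 2^6\<close> and the rounding of \<open>1 / eps\<close> add at most 7 to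
  the degree, which is at most \<open>40 * dlog_root d eps\<close>; the 7 is absorbed because
  \<open>dlog_root\<close> is at least 1.\<close>

lemma dim_exponent_bound:
  assumes eps01: "0 < eps" "eps < 1"
  shows "\<bar>dim_exponent d eps\<bar> \<le> 47 * dlog_root d eps"
proof -
  define X where "X = 40 * 2 ^ deg d eps * (2 ^ (level eps + 1) * eps)"
  have "1 * 1 * 1 \<le> X" unfolding X_def using level[OF eps01] by (intro mult_mono) auto
  then have 1: "0 \<le> log 2 X" by simp
  have "X \<le> 64 * 2 ^ deg d eps * 2" unfolding X_def using level_upper[OF eps01] eps01 by (intro mult_mono) auto
  also have "\<dots> = 2 ^ (deg d eps + 7)" by (simp add: power_add)
  also have "\<dots> = 2 powr real (deg d eps + 7)" by (rule powr_realpow[symmetric]) simp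
  finally have "log 2 X \<le> log 2 (2 powr real (deg d eps + 7))" using \<open>1 * 1 * 1 \<le> X\<close> by (intro log_mono) auto
  then have "log 2 X \<le> real (deg d eps) + 7" by simp
  then show ?thesis
    using 1 deg_bound[OF eps01, of d] dlog_root_ge_1[OF eps01, of d] by (simp add: dim_exponent_def X_def)
qed

lemma dim_formula:
  assumes eps01: "0 < eps" "eps < 1"
  shows "real (dim d eps) = real (binom_le d (deg d eps)) ^ 3 * 2 powr dim_exponent d eps * (1 / eps)"
proof -
  have "0 < 40 * 2 ^ deg d eps * (2 ^ (level eps + 1) * eps)" using eps01 by simp
  then have "2 powr dim_exponent d eps = 40 * 2 ^ deg d eps * (2 ^ (level eps + 1) * eps)"
    unfolding dim_exponent_def by (intro powr_log_cancel) auto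
  then show ?thesis using eps01 by (simp add: dim_eq)
qed

lemma four_scale_gt:
  assumes eps01: "0 < eps" "eps < 1"
  shows "1 / eps < real_of_int (4 * scale d eps)"
proof -
  have B: "1 \<le> binom_le d (deg d eps)" using binom_deg_ge[of d eps] by simp
  have "1 / eps \<le> 1 * 2 ^ (level eps + 1)" using level[OF eps01] eps01 by (simp add: field_simps)
  also have "\<dots> < 40 * 2 ^ (level eps + 1)" by simp
  also have "\<dots> \<le> 40 * real (binom_le d (deg d eps)) ^ 2 * 2 ^ (level eps + 1)"
    using B one_le_power[of "real (binom_le d (deg d eps))" 2] by (intro mult_right_mono) auto
  also have "\<dots> = real_of_int (4 * scale d eps)" by (simp add: scale_def)
  finally show ?thesis .
qed

text \<open>The threshold is \<open>4 * scale d \<epsilon>\<close>, since each gadget contributes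
  \<open>4 * a_S * b_S\<close>. Only the vectors depend on the instance; program, polynomial,
  dimension and threshold are fixed beforehand.\<close>

theorem theoremC1:
  shows "\<exists>(reduction :: com) (q :: nat poly) (m :: nat \<Rightarrow> real \<Rightarrow> nat) (e :: nat \<Rightarrow> real \<Rightarrow> real)
          (d\<^sub>1 :: nat \<Rightarrow> real \<Rightarrow> nat) (T :: nat \<Rightarrow> real \<Rightarrow> int).
    (\<lambda>(d, \<epsilon>). real (m d \<epsilon>)) \<in> O[principal (UNIV \<times> {0<..<1})](\<lambda>(d, \<epsilon>). dlog_root d \<epsilon>) \<and>
    (\<lambda>(d, \<epsilon>). e d \<epsilon>) \<in> O[principal (UNIV \<times> {0<..<1})](\<lambda>(d, \<epsilon>). dlog_root d \<epsilon>) \<and>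
    (\<forall>(\<epsilon>::real) (d::nat). 0 < \<epsilon> \<and> \<epsilon> < 1 \<longrightarrow>
      real (d\<^sub>1 d \<epsilon>) = real (binom_le d (m d \<epsilon>)) ^ 3 * 2 powr (e d \<epsilon>) * (1 / \<epsilon>) \<and>
      real_of_int (T d \<epsilon>) > 1 / \<epsilon> \<and>
      (\<forall>(n::nat) As Bs. n \<ge> 1 \<and> vectors {0, 1} n d As \<and> vectors {0, 1} n d Bs \<longrightarrow>
        (\<exists>As' Bs'.
          vectors {-1, 1} n (d\<^sub>1 d \<epsilon>) As' \<and> vectors {-1, 1} n (d\<^sub>1 d \<epsilon>) Bs' \<and>
          maps_within reduction \<epsilon> (encode n d As Bs) (encode n (d\<^sub>1 d \<epsilon>) As' Bs')
            (n * poly q (d\<^sub>1 d \<epsilon>)) \<and>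
          ((\<exists>a\<in>set As. \<exists>b\<in>set Bs. dot a b = 0) \<longrightarrow>
             OPT (set As') (set Bs') \<ge> T d \<epsilon>) \<and>
          (\<not> (\<exists>a\<in>set As. \<exists>b\<in>set Bs. dot a b = 0) \<longrightarrow>
             \<bar>real_of_int (OPT (set As') (set Bs'))\<bar> \<le> real_of_int (T d \<epsilon>) * \<epsilon>))))"
proof (rule exI[of _ reduction_prog], rule exI[of _ "monom 1320000 2"], rule exI[of _ deg],
    rule exI[of _ dim_exponent], rule exI[of _ dim], rule exI[of _ "\<lambda>d \<epsilon>. 4 * scale d \<epsilon>"],
    intro conjI allI impI)
  show "(\<lambda>(d, \<epsilon>). real (deg d \<epsilon>)) \<in> O[principal (UNIV \<times> {0<..<1})](\<lambda>(d, \<epsilon>). dlog_root d \<epsilon>)"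
    by (rule bigoI[where c = 40])
      (auto simp: eventually_principal abs_of_nonneg[OF order_trans[OF zero_le_one dlog_root_ge_1]] intro: deg_bound)
  show "(\<lambda>(d, \<epsilon>). dim_exponent d \<epsilon>) \<in> O[principal (UNIV \<times> {0<..<1})](\<lambda>(d, \<epsilon>). dlog_root d \<epsilon>)"
    by (rule bigoI[where c = 47])
      (auto simp: eventually_principal abs_of_nonneg[OF order_trans[OF zero_le_one dlog_root_ge_1]] intro: dim_exponent_bound)
next
  fix \<epsilon> :: real and d :: nat assume "0 < \<epsilon> \<and> \<epsilon> < 1"
  then have eps01: "0 < \<epsilon>" "\<epsilon> < 1" by auto
  show "real (dim d \<epsilon>) = real (binom_le d (deg d \<epsilon>)) ^ 3 * 2 powr (dim_exponent d \<epsilon>) * (1 / \<epsilon>)"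
    by (rule dim_formula[OF eps01])
  show "1 / \<epsilon> < real_of_int (4 * scale d \<epsilon>)" by (rule four_scale_gt[OF eps01])
  fix n :: nat and As Bs assume "1 \<le> n \<and> vectors {0, 1} n d As \<and> vectors {0, 1} n d Bs"
  then have A: "1 \<le> n" "vectors {0, 1} n d As" "vectors {0, 1} n d Bs" by auto
  show "\<exists>As' Bs'.
          vectors {-1, 1} n (dim d \<epsilon>) As' \<and> vectors {-1, 1} n (dim d \<epsilon>) Bs' \<and>
          maps_within reduction_prog \<epsilon> (encode n d As Bs) (encode n (dim d \<epsilon>) As' Bs')
            (n * poly (monom 1320000 2) (dim d \<epsilon>)) \<and>
          ((\<exists>a\<in>set As. \<exists>b\<in>set Bs. dot a b = 0) \<longrightarrow>
             OPT (set As') (set Bs') \<ge> 4 * scale d \<epsilon>) \<and>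
          (\<not> (\<exists>a\<in>set As. \<exists>b\<in>set Bs. dot a b = 0) \<longrightarrow>
             \<bar>real_of_int (OPT (set As') (set Bs'))\<bar> \<le> real_of_int (4 * scale d \<epsilon>) * \<epsilon>)"
    using vectors_images[OF eps01 A] maps_within_reduction[OF eps01 A] OPT_large[OF eps01 A]
      OPT_small[OF eps01 A] by blast
qed

end
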